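(* An immersed bundle $L$ of $j$-stable $2$-planes in $\mathbb{C}^4$, with mean curvature sphere $S$, is a constrained Willmore surface if and only if there exists $q\in\Omega^1(\mathrm{End}_j(\underline{\mathbb{C}}^4/L,L))$ such that $$Sq=*q=qS$$ and $$d^{\mathcal{D}_S}q=0,\qquad d^{\mathcal{D}_S}*\mathcal{N}_S=2[q\wedge*\mathcal{N}_S].$$
   Context: Quaternionic model of $S^4$. $\mathbb{H}^2$ is identified with $\mathbb{C}^4$; left multiplication by the quaternion $j$ gives a complex anti-linear $j:\mathbb{C}^4\to\mathbb{C}^4$, $j^2=-1$. Fix $\det\in\wedge^4(\mathbb{C}^4)^*\backslash\{0\}$ with $\overline{\det\circ\wedge^4j}=\det$ and $\det(v_1,v_2,jv_1,jv_2)>0$ whenever $v_1,v_2,jv_1,jv_2$ are linearly independent. $\wedge^2\mathbb{C}^4$ has real structure $\wedge^2j$ and metric $(v_1\wedge v_2,v_3\wedge v_4)=\det(v_1,v_2,v_3,v_4)$, which has signature $(5,1)$ on $\mathrm{Fix}(\wedge^2j)=\mathbb{R}^{5,1}$, so $\wedge^2\mathbb{C}^4=(\mathbb{R}^{5,1})^{\mathbb{C}}$. $j$-stable $2$-planes $L$ correspond to real null lines $\wedge^2L$, i.e. to points of $S^4\cong\mathbb{P}(\mathcal{L})$, $\mathcal{L}$ the non-zero null vectors of $\mathbb{R}^{5,1}$. $M$ is an oriented surface; $\underline{\mathbb{C}}^4=M\times\mathbb{C}^4$; $d$ denotes trivial flat connections. An immersed bundle of $j$-stable $2$-planes is a rank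 $2$ $j$-stable subbundle $L\subset\underline{\mathbb{C}}^4$ such that $\Lambda:=\wedge^2L:M\to\mathbb{P}(\mathcal{L})$ is an immersion (standing assumption: not contained in any proper subsphere of $S^4$). $M$ carries the conformal structure induced by $\Lambda$ (that of the metrics $(d_X\sigma,d_Y\sigma)$, $\sigma\in\Gamma(\Lambda)$ never-zero), with complex structure $J$, and $*\omega=-\omega\circ J$ on $1$-forms. The theory is local. Constrained Willmore. $\Lambda^{(1)}=\langle\sigma,\sigma_z,\sigma_{\bar z}\rangle$ and $V=\langle\sigma,\sigma_z,\sigma_{\bar z},\sigma_{z\bar z}\rangle$ (complexified central sphere congruence), $z$ a holomorphic chart; $\mathcal{D}_V:=\pi_V\circ d\circ\pi_V+\pi_{V^\perp}\circ d\circ\pi_{V^\perp}$, $\mathcal{N}_V:=d-\mathcal{D}_V$; $\wedge^2$ of $\mathbb{R}^{5,1}$ is identified with $o(\mathbb{R}^{5,1})$ by $(a\wedge b)(w)=(w,a)b-(w,b)a$. $L$ is constrained Willmore if there is a real $q\in\Omega^1(\Lambda\wedge\Lambda^{(1)})$ with $d^{\mathcal{D}_V}q=0$ and $d^{\mathcal{D}_V}*\mathcal{N}_V=2[q\wedge*\mathcal{N}_V]$. Here $[\mu\wedge\eta](X,Y)=[\mu_X,\eta_Y]-[\mu_Y,\eta_X]$ and $d^\nabla$ is the exterior derivative on endomorphism-valued forms. Mean curvature sphere. Let $\delta:=\pi_{\underline{\mathbb{C}}^4/L}\circ d|_L$. The mean curvature sphere of $L$ is the unique $j$-commuting complex structure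 $S\in\Gamma(\mathrm{End}(\underline{\mathbb{C}}^4))$, $S^2=-I$, with $SL=L$, $(dS)L\subset L$, $*\delta=S\circ\delta=\delta\circ S|_L$ ($S$ also denoting the induced map of $\underline{\mathbb{C}}^4/L$) and $(S\,dS-*dS)L=0$. $\mathcal{N}_S:=\frac12S\,dS$, $\mathcal{D}_S:=d-\mathcal{N}_S$. $\mathrm{End}_j(\underline{\mathbb{C}}^4/L,L)$ is the bundle of $j$-commuting endomorphisms $q$ of $\underline{\mathbb{C}}^4$ with $qL=0$ and $\mathrm{Im}\,q\subset L$. *)

theory Defs
  imports "HOL-Analysis.Analysis"
begin

text \<open>Linear algebra: the quaternionic structure, bivectors, and their metric.\<close>

type_synonym cvec4 = "complex ^ 4"

text \<open>Bivectors are skew elements of the tensor square of \<open>\<complex>\<^sup>4\<close>, so that complex scaling is \<open>*s\<close>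
  and the complex linear algebra of \<^const>\<open>vec.span\<close> applies to them.\<close>

type_synonym bivec = "complex ^ (4 \<times> 4)"

text \<open>\<open>(a + b j, c + d j)\<close> in the quaternionic plane is \<open>(a, b, c, d)\<close>; complex scalars and
  quaternions act on the left, whence \<open>j (a + b j) = - cnj b + cnj a j\<close>.\<close>

definition jj :: "cvec4 \<Rightarrow> cvec4" where
  "jj v = vector [- cnj (v $ 2), cnj (v $ 1), - cnj (v $ 4), cnj (v $ 3)]"

definition clinear_on :: "(complex ^ 'n) set \<Rightarrow> (complex ^ 'n \<Rightarrow> complex ^ 'n) \<Rightarrow> bool" where
  "clinear_on B f \<longleftrightarrow>
     (\<forall>v\<in>B. f v \<in> B) \<and>
     (\<forall>v\<in>B. \<forall>w\<in>B. f (v + w) = f v + f w) \<and>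
     (\<forall>c. \<forall>v\<in>B. f (c *s v) = c *s f v)"

definition quaternionic_det :: "(cvec4 \<Rightarrow> cvec4 \<Rightarrow> cvec4 \<Rightarrow> cvec4 \<Rightarrow> complex) \<Rightarrow> bool" where
  "quaternionic_det dt \<longleftrightarrow>
     (\<forall>b c d. Vector_Spaces.linear (*s) (*) (\<lambda>a. dt a b c d)) \<and>
     (\<forall>a c d. Vector_Spaces.linear (*s) (*) (\<lambda>b. dt a b c d)) \<and>
     (\<forall>a b d. Vector_Spaces.linear (*s) (*) (\<lambda>c. dt a b c d)) \<and>
     (\<forall>a b c. Vector_Spaces.linear (*s) (*) (\<lambda>d. dt a b c d)) \<and>
     (\<forall>a b c. dt a a b c = 0 \<and> dt a b b c = 0 \<and> dt a b c c = 0) \<and>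
     (\<exists>a b c d. dt a b c d \<noteq> 0) \<and>
     (\<forall>a b c d. cnj (dt (jj a) (jj b) (jj c) (jj d)) = dt a b c d) \<and>
     (\<forall>v w. distinct [v, w, jj v, jj w] \<and> vec.independent {v, w, jj v, jj w} \<longrightarrow>
        (\<exists>r>0. dt v w (jj v) (jj w) = complex_of_real r))"

definition wedge :: "cvec4 \<Rightarrow> cvec4 \<Rightarrow> bivec" where
  "wedge v w = (\<chi> p. v $ fst p * w $ snd p - v $ snd p * w $ fst p)"

definition bivectors :: "bivec set" where
  "bivectors = {A. \<forall>a b. A $ (b, a) = - A $ (a, b)}"

text \<open>The bilinear metric and the real structure on bivectors, expanded through
  \<open>A = 1/2 (\<Sum>a b. A\<^sub>a\<^sub>b e\<^sub>a \<and> e\<^sub>b)\<close>; see \<open>biv_form_wedge\<close> and \<open>biv_j_wedge\<close> below.\<close>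

definition biv_form ::
    "(cvec4 \<Rightarrow> cvec4 \<Rightarrow> cvec4 \<Rightarrow> cvec4 \<Rightarrow> complex) \<Rightarrow> bivec \<Rightarrow> bivec \<Rightarrow> complex" where
  "biv_form dt A B = (1 / 4) * (\<Sum>a\<in>UNIV. \<Sum>b\<in>UNIV. \<Sum>c\<in>UNIV. \<Sum>d\<in>UNIV.
      A $ (a, b) * B $ (c, d) * dt (axis a 1) (axis b 1) (axis c 1) (axis d 1))"

definition biv_j :: "bivec \<Rightarrow> bivec" where
  "biv_j A = (1 / 2) *s (\<Sum>a\<in>UNIV. \<Sum>b\<in>UNIV.
      cnj (A $ (a, b)) *s wedge (jj (axis a 1)) (jj (axis b 1)))"

definition real_bivectors :: "bivec set" where
  "real_bivectors = {A \<in> bivectors. biv_j A = A}"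

text \<open>The second exterior power of a 2-plane (every element is decomposable).\<close>

definition ext2 :: "cvec4 set \<Rightarrow> bivec set" where
  "ext2 P = {wedge v w |v w. v \<in> P \<and> w \<in> P}"

definition biv_perp ::
    "(cvec4 \<Rightarrow> cvec4 \<Rightarrow> cvec4 \<Rightarrow> cvec4 \<Rightarrow> complex) \<Rightarrow> bivec set \<Rightarrow> bivec set" where
  "biv_perp dt V = {w \<in> bivectors. \<forall>v\<in>V. biv_form dt v w = 0}"

definition biv_proj ::
    "(cvec4 \<Rightarrow> cvec4 \<Rightarrow> cvec4 \<Rightarrow> cvec4 \<Rightarrow> complex) \<Rightarrow> bivec set \<Rightarrow> bivec \<Rightarrow> bivec" where
  "biv_proj dt V w = (THE v. v \<in> V \<and> w - v \<in> biv_perp dt V)"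

text \<open>The skew endomorphism of the space of bivectors that \<open>A \<and> B\<close> stands for.\<close>

definition skew_op ::
    "(cvec4 \<Rightarrow> cvec4 \<Rightarrow> cvec4 \<Rightarrow> cvec4 \<Rightarrow> complex) \<Rightarrow> bivec \<Rightarrow> bivec \<Rightarrow> bivec \<Rightarrow> bivec" where
  "skew_op dt A B w = biv_form dt w A *s B - biv_form dt w B *s A"

lemma biv_j_wedge: "biv_j (wedge v w) = wedge (jj v) (jj w)"
  unfolding vec_eq_iff biv_j_def wedge_def split_paired_All forall_4 sum_4
  by (simp add: jj_def vector_def axis_def algebra_simps)

lemma biv_form_wedge:
  assumes "quaternionic_det dt"
  shows "biv_form dt (wedge a b) (wedge c d) = dt a b c d"
proof -
  let ?e = "\<lambda>i::4. axis i (1::complex)"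
  have lin: "Vector_Spaces.linear (*s) (*) (\<lambda>a. dt a b c d)"
    "Vector_Spaces.linear (*s) (*) (\<lambda>b. dt a b c d)"
    "Vector_Spaces.linear (*s) (*) (\<lambda>c. dt a b c d)"
    "Vector_Spaces.linear (*s) (*) (\<lambda>d. dt a b c d)" for a b c d
    using assms by (auto simp: quaternionic_det_def)
  have alt: "dt a a b c = 0" "dt a b c c = 0" for a b c
    using assms by (auto simp: quaternionic_det_def)
  have expand: "f v = (\<Sum>i\<in>UNIV. v $ i * f (?e i))"
    if "Vector_Spaces.linear (*s) (*) f" for f :: "cvec4 \<Rightarrow> complex" and v
  proof -
    interpret f: Vector_Spaces.linear "(*s)" "(*)" f by (rule that)
    have "f v = f (\<Sum>i\<in>UNIV. v $ i *s ?e i)" by (simp add: basis_expansion)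
    then show ?thesis by (simp add: f.sum f.scale)
  qed
  have swap12: "dt b a c d = - dt a b c d" for a b c d
  proof -
    interpret l1: Vector_Spaces.linear "(*s)" "(*)" "\<lambda>x. dt x (a + b) c d" by (rule lin)
    interpret l2: Vector_Spaces.linear "(*s)" "(*)" "\<lambda>x. dt a x c d" by (rule lin)
    interpret l3: Vector_Spaces.linear "(*s)" "(*)" "\<lambda>x. dt b x c d" by (rule lin)
    have "dt (a + b) (a + b) c d = dt a b c d + dt b a c d"
      by (subst l1.add, subst l2.add, subst l3.add) (simp add: alt)
    then have "dt a b c d + dt b a c d = 0" by (simp only: alt)
    then show ?thesis by (simp add: eq_neg_iff_add_eq_0 add.commute)
  qed
  have swap34: "dt a b d c = - dt a b c d" for a b c d
  proof -
    interpret l1: Vector_Spaces.linear "(*s)" "(*)" "\<lambda>x. dt a b x (c + d)" by (rule lin)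
    interpret l2: Vector_Spaces.linear "(*s)" "(*)" "\<lambda>x. dt a b c x" by (rule lin)
    interpret l3: Vector_Spaces.linear "(*s)" "(*)" "\<lambda>x. dt a b d x" by (rule lin)
    have "dt a b (c + d) (c + d) = dt a b c d + dt a b d c"
      by (subst l1.add, subst l2.add, subst l3.add) (simp add: alt)
    then have "dt a b c d + dt a b d c = 0" by (simp only: alt)
    then show ?thesis by (simp add: eq_neg_iff_add_eq_0 add.commute)
  qed
  have full: "dt a b c d = (\<Sum>i\<in>UNIV. \<Sum>k\<in>UNIV. \<Sum>l\<in>UNIV. \<Sum>m\<in>UNIV.
      a $ i * b $ k * c $ l * d $ m * dt (?e i) (?e k) (?e l) (?e m))" for a b c d
  proof -
    have "dt a b c d = (\<Sum>i\<in>UNIV. a $ i * dt (?e i) b c d)"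
      by (rule expand[OF lin(1)])
    also have "\<dots> = (\<Sum>i\<in>UNIV. a $ i * (\<Sum>k\<in>UNIV. b $ k * dt (?e i) (?e k) c d))"
      by (intro sum.cong refl arg_cong[where f = "(*) _"] expand[OF lin(2)])
    also have "\<dots> = (\<Sum>i\<in>UNIV. a $ i * (\<Sum>k\<in>UNIV. b $ k * (\<Sum>l\<in>UNIV. c $ l *
        dt (?e i) (?e k) (?e l) d)))"
      by (intro sum.cong refl arg_cong[where f = "(*) _"] expand[OF lin(3)])
    also have "\<dots> = (\<Sum>i\<in>UNIV. a $ i * (\<Sum>k\<in>UNIV. b $ k * (\<Sum>l\<in>UNIV. c $ l *
        (\<Sum>m\<in>UNIV. d $ m * dt (?e i) (?e k) (?e l) (?e m)))))"
      by (intro sum.cong refl arg_cong[where f = "(*) _"] expand[OF lin(4)])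
    finally show ?thesis by (simp only: sum_distrib_left mult.assoc)
  qed
  have "(\<Sum>i\<in>UNIV. \<Sum>k\<in>UNIV. \<Sum>l\<in>UNIV. \<Sum>m\<in>UNIV.
      wedge a b $ (i, k) * wedge c d $ (l, m) * dt (?e i) (?e k) (?e l) (?e m)) =
      dt a b c d - dt b a c d - (dt a b d c - dt b a d c)"
    unfolding full[of a b c d] full[of b a c d] full[of a b d c] full[of b a d c]
      sum_subtractf[symmetric]
    by (intro sum.cong refl) (simp add: wedge_def algebra_simps)
  also have "\<dots> = 4 * dt a b c d"
    unfolding swap34[of a b d c] swap34[of b a d c] swap12[of b a c d] by simp
  finally show ?thesis
    unfolding biv_form_def by simp
qed

text \<open>Calculus on open subsets of the plane \<^typ>\<open>complex\<close>, whose points also serve as tangent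
  vectors; \<open>dd f u X\<close> is the (real) directional derivative.\<close>

definition dd :: "(complex \<Rightarrow> 'e::real_normed_vector) \<Rightarrow> complex \<Rightarrow> complex \<Rightarrow> 'e" where
  "dd f u X = frechet_derivative f (at u) X"

primrec Ck_on :: "nat \<Rightarrow> complex set \<Rightarrow> (complex \<Rightarrow> 'e::real_normed_vector) \<Rightarrow> bool" where
  "Ck_on 0 U f \<longleftrightarrow> continuous_on U f"
| "Ck_on (Suc k) U f \<longleftrightarrow>
     (\<forall>u\<in>U. f differentiable (at u)) \<and> (\<forall>X. Ck_on k U (\<lambda>u. dd f u X))"

definition smooth_on :: "complex set \<Rightarrow> (complex \<Rightarrow> 'e::real_normed_vector) \<Rightarrow> bool" where
  "smooth_on U f \<longleftrightarrow> (\<forall>k. Ck_on k U f)"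

definition d_z :: "(complex \<Rightarrow> complex ^ 'n) \<Rightarrow> complex \<Rightarrow> complex ^ 'n" where
  "d_z f u = (1 / 2) *s (dd f u 1 - \<i> *s dd f u \<i>)"

definition d_zbar :: "(complex \<Rightarrow> complex ^ 'n) \<Rightarrow> complex \<Rightarrow> complex ^ 'n" where
  "d_zbar f u = (1 / 2) *s (dd f u 1 + \<i> *s dd f u \<i>)"

text \<open>Endomorphism-valued forms on an open set: a 1-form is a function \<open>\<omega> u X w\<close> of the point
  \<open>u\<close>, the tangent vector \<open>X\<close> and the argument \<open>w\<close> of the endomorphism. A connection is a
  function \<open>nab s u X\<close> of a section \<open>s\<close>, a point and a tangent vector. Tensors are
  evaluated on constant sections, and \<open>d\<^sup>\<nabla>\<close> on constant vector fields \<open>X\<close>, \<open>Y\<close>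
  (so that the bracket term vanishes).\<close>

definition endo_cov ::
    "((complex \<Rightarrow> 'e) \<Rightarrow> complex \<Rightarrow> complex \<Rightarrow> 'e) \<Rightarrow> (complex \<Rightarrow> 'e \<Rightarrow> 'e)
      \<Rightarrow> complex \<Rightarrow> complex \<Rightarrow> 'e \<Rightarrow> 'e::real_normed_vector" where
  "endo_cov nab A u X w = nab (\<lambda>v. A v w) u X - A u (nab (\<lambda>_. w) u X)"

definition ext_d ::
    "((complex \<Rightarrow> 'e) \<Rightarrow> complex \<Rightarrow> complex \<Rightarrow> 'e) \<Rightarrow> (complex \<Rightarrow> complex \<Rightarrow> 'e \<Rightarrow> 'e)
      \<Rightarrow> complex \<Rightarrow> complex \<Rightarrow> complex \<Rightarrow> 'e \<Rightarrow> 'e::real_normed_vector" where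
  "ext_d nab \<omega> u X Y w = endo_cov nab (\<lambda>v. \<omega> v Y) u X w - endo_cov nab (\<lambda>v. \<omega> v X) u Y w"

definition bracket_wedge ::
    "(complex \<Rightarrow> complex \<Rightarrow> 'e \<Rightarrow> 'e) \<Rightarrow> (complex \<Rightarrow> complex \<Rightarrow> 'e \<Rightarrow> 'e)
      \<Rightarrow> complex \<Rightarrow> complex \<Rightarrow> complex \<Rightarrow> 'e \<Rightarrow> 'e::real_normed_vector" where
  "bracket_wedge \<mu> \<eta> u X Y w =
     (\<mu> u X (\<eta> u Y w) - \<eta> u Y (\<mu> u X w)) - (\<mu> u Y (\<eta> u X w) - \<eta> u X (\<mu> u Y w))"

text \<open>\<open>- \<omega> \<circ> J\<close> in a holomorphic chart, where \<open>J\<close> is multiplication by \<open>\<i>\<close>.\<close>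

definition star ::
    "(complex \<Rightarrow> complex \<Rightarrow> 'e \<Rightarrow> 'e) \<Rightarrow> complex \<Rightarrow> complex \<Rightarrow> 'e \<Rightarrow> 'e::real_normed_vector" where
  "star \<omega> u X w = - \<omega> u (\<i> * X) w"

text \<open>Oriented surfaces. A chart is given by its inverse: a pair of an open set \<open>U\<close> of the plane
  and a homeomorphism of \<open>U\<close> onto an open subset of the surface. Functions on the surface are
  pulled back along it.\<close>

type_synonym 'm chart = "complex set \<times> (complex \<Rightarrow> 'm)"

definition transition :: "'m chart \<Rightarrow> 'm chart \<Rightarrow> complex \<Rightarrow> complex" where
  "transition a b = inv_into (fst b) (snd b) \<circ> snd a"

definition overlap :: "'m chart \<Rightarrow> 'm chart \<Rightarrow> complex set" where
  "overlap a b = {u \<in> fst a. snd a u \<in> snd b ` fst b}"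

definition oriented_surface :: "('m::{t2_space,second_countable_topology}) chart set \<Rightarrow> bool" where
  "oriented_surface \<A> \<longleftrightarrow>
     (\<forall>(U, \<phi>)\<in>\<A>. open U \<and> open (\<phi> ` U) \<and> (\<exists>z. homeomorphism U (\<phi> ` U) \<phi> z)) \<and>
     (\<Union>(U, \<phi>)\<in>\<A>. \<phi> ` U) = UNIV \<and>
     (\<forall>a\<in>\<A>. \<forall>b\<in>\<A>. smooth_on (overlap a b) (transition a b) \<and>
        (\<forall>u\<in>overlap a b.
           0 < Im (cnj (dd (transition a b) u 1) * dd (transition a b) u \<i>)))"

text \<open>A global 1-form with values in the endomorphisms of a fibre \<open>B\<close> is a family of local ones,
  one for each chart, related by the transition maps.\<close>

definition endo_one_form ::
    "'m chart set \<Rightarrow> (complex ^ 'n) set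
      \<Rightarrow> ('m chart \<Rightarrow> complex \<Rightarrow> complex \<Rightarrow> complex ^ 'n \<Rightarrow> complex ^ 'n) \<Rightarrow> bool" where
  "endo_one_form \<A> B q \<longleftrightarrow>
     (\<forall>a\<in>\<A>. \<forall>u\<in>fst a. (\<forall>X. clinear_on B (q a u X)) \<and> (\<forall>w\<in>B. linear (\<lambda>X. q a u X w))) \<and>
     (\<forall>a\<in>\<A>. \<forall>X. \<forall>w\<in>B. smooth_on (fst a) (\<lambda>u. q a u X w)) \<and>
     (\<forall>a\<in>\<A>. \<forall>b\<in>\<A>. \<forall>u\<in>overlap a b. \<forall>X. \<forall>w\<in>B.
        q a u X w = q b (transition a b u) (dd (transition a b) u X) w)"

text \<open>Bundles of 2-planes. The local notions take a field \<open>P\<close> of 2-planes on an open set \<open>U\<close> of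
  the plane.\<close>

definition local_section ::
    "complex set \<Rightarrow> (complex \<Rightarrow> cvec4 set) \<Rightarrow> complex set \<Rightarrow> (complex \<Rightarrow> cvec4) \<Rightarrow> bool" where
  "local_section U P W s \<longleftrightarrow> open W \<and> W \<subseteq> U \<and> smooth_on W s \<and> (\<forall>v\<in>W. s v \<in> P v)"

text \<open>Never-zero local sections of the bundle \<open>\<Lambda>\<close> of real null lines.\<close>

definition real_lift ::
    "complex set \<Rightarrow> (complex \<Rightarrow> cvec4 set) \<Rightarrow> complex set \<Rightarrow> (complex \<Rightarrow> bivec) \<Rightarrow> bool" where
  "real_lift U P W \<sigma> \<longleftrightarrow> open W \<and> W \<subseteq> U \<and> smooth_on W \<sigma> \<and>
     (\<forall>v\<in>W. \<sigma> v \<in> ext2 (P v) \<inter> real_bivectors \<and> \<sigma> v \<noteq> 0)"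

definition j_stable_bundle :: "'m chart set \<Rightarrow> ('m \<Rightarrow> cvec4 set) \<Rightarrow> bool" where
  "j_stable_bundle \<A> L \<longleftrightarrow>
     (\<forall>p. vec.subspace (L p) \<and> vec.dim (L p) = 2 \<and> jj ` L p \<subseteq> L p) \<and>
     (\<forall>(U, \<phi>)\<in>\<A>. \<forall>u\<in>U. \<exists>W s t. u \<in> W \<and>
        local_section U (\<lambda>v. L (\<phi> v)) W s \<and> local_section U (\<lambda>v. L (\<phi> v)) W t \<and>
        (\<forall>v\<in>W. L (\<phi> v) = vec.span {s v, t v}))"

text \<open>\<open>\<Lambda>\<close> is an immersion iff \<open>d\<sigma> mod \<Lambda>\<close> is injective, and proper subspheres of the conformal
  sphere are the projectivised null vectors of proper subspaces of the real bivectors.\<close>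

definition immersed_bundle :: "'m chart set \<Rightarrow> ('m \<Rightarrow> cvec4 set) \<Rightarrow> bool" where
  "immersed_bundle \<A> L \<longleftrightarrow>
     j_stable_bundle \<A> L \<and>
     (\<forall>(U, \<phi>)\<in>\<A>. \<forall>W \<sigma>. real_lift U (\<lambda>v. L (\<phi> v)) W \<sigma> \<longrightarrow>
        (\<forall>u\<in>W. \<forall>X. dd \<sigma> u X \<in> span {\<sigma> u} \<longrightarrow> X = 0)) \<and>
     \<not> (\<exists>H. subspace H \<and> H \<subset> real_bivectors \<and> (\<forall>p. ext2 (L p) \<inter> real_bivectors \<subseteq> H))"

text \<open>The charts of \<open>\<A>\<close> are holomorphic for the conformal structure induced by \<open>\<Lambda>\<close>: the complex
  structure \<open>J\<close> of the oriented conformal surface is the positive rotation by a right angle for the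
  metrics \<open>(d\<^sub>X \<sigma>, d\<^sub>Y \<sigma>)\<close>, and a positively oriented chart is holomorphic iff \<open>J\<close> is multiplication
  by \<open>\<i>\<close> in it, that is, iff this rotation is an isometry.\<close>

definition holomorphic_charts ::
    "(cvec4 \<Rightarrow> cvec4 \<Rightarrow> cvec4 \<Rightarrow> cvec4 \<Rightarrow> complex) \<Rightarrow> 'm chart set \<Rightarrow> ('m \<Rightarrow> cvec4 set) \<Rightarrow> bool" where
  "holomorphic_charts dt \<A> L \<longleftrightarrow>
     (\<forall>(U, \<phi>)\<in>\<A>. \<forall>W \<sigma>. real_lift U (\<lambda>v. L (\<phi> v)) W \<sigma> \<longrightarrow>
        (\<forall>u\<in>W. \<forall>X Y. biv_form dt (dd \<sigma> u (\<i> * X)) (dd \<sigma> u (\<i> * Y)) =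
                        biv_form dt (dd \<sigma> u X) (dd \<sigma> u Y)))"

text \<open>The spans defining \<open>\<Lambda>\<^sup>(\<^sup>1\<^sup>)\<close> and \<open>V\<close> do not depend on the lift, so the unions are over equal sets.\<close>

definition Lambda1 :: "complex set \<Rightarrow> (complex \<Rightarrow> cvec4 set) \<Rightarrow> complex \<Rightarrow> bivec set" where
  "Lambda1 U P u = (\<Union>(W, \<sigma>)\<in>{(W, \<sigma>). real_lift U P W \<sigma> \<and> u \<in> W}.
     vec.span {\<sigma> u, d_z \<sigma> u, d_zbar \<sigma> u})"

definition central_sphere :: "complex set \<Rightarrow> (complex \<Rightarrow> cvec4 set) \<Rightarrow> complex \<Rightarrow> bivec set" where
  "central_sphere U P u = (\<Union>(W, \<sigma>)\<in>{(W, \<sigma>). real_lift U P W \<sigma> \<and> u \<in> W}.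
     vec.span {\<sigma> u, d_z \<sigma> u, d_zbar \<sigma> u, d_zbar (d_z \<sigma>) u})"

definition D_V ::
    "(cvec4 \<Rightarrow> cvec4 \<Rightarrow> cvec4 \<Rightarrow> cvec4 \<Rightarrow> complex) \<Rightarrow> (complex \<Rightarrow> bivec set)
      \<Rightarrow> (complex \<Rightarrow> bivec) \<Rightarrow> complex \<Rightarrow> complex \<Rightarrow> bivec" where
  "D_V dt V s u X =
     biv_proj dt (V u) (dd (\<lambda>v. biv_proj dt (V v) (s v)) u X) +
     biv_proj dt (biv_perp dt (V u)) (dd (\<lambda>v. biv_proj dt (biv_perp dt (V v)) (s v)) u X)"

definition N_V ::
    "(cvec4 \<Rightarrow> cvec4 \<Rightarrow> cvec4 \<Rightarrow> cvec4 \<Rightarrow> complex) \<Rightarrow> (complex \<Rightarrow> bivec set)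
      \<Rightarrow> complex \<Rightarrow> complex \<Rightarrow> bivec \<Rightarrow> bivec" where
  "N_V dt V u X w = dd (\<lambda>_. w) u X - D_V dt V (\<lambda>_. w) u X"

definition constrained_willmore ::
    "(cvec4 \<Rightarrow> cvec4 \<Rightarrow> cvec4 \<Rightarrow> cvec4 \<Rightarrow> complex) \<Rightarrow> 'm chart set \<Rightarrow> ('m \<Rightarrow> cvec4 set) \<Rightarrow> bool" where
  "constrained_willmore dt \<A> L \<longleftrightarrow>
     (\<exists>q. endo_one_form \<A> bivectors q \<and>
        (\<forall>(U, \<phi>)\<in>\<A>. \<forall>u\<in>U.
           let P = (\<lambda>v. L (\<phi> v)); V = central_sphere U P; q' = q (U, \<phi>) in
             (\<forall>X. \<forall>w\<in>bivectors. q' u X (biv_j w) = biv_j (q' u X w)) \<and>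
             (\<forall>X. \<exists>A\<in>ext2 (P u). \<exists>B\<in>Lambda1 U P u. \<forall>w\<in>bivectors.
                q' u X w = skew_op dt A B w) \<and>
             (\<forall>X Y. \<forall>w\<in>bivectors. ext_d (D_V dt V) q' u X Y w = 0) \<and>
             (\<forall>X Y. \<forall>w\<in>bivectors. ext_d (D_V dt V) (star (N_V dt V)) u X Y w =
                2 *s bracket_wedge q' (star (N_V dt V)) u X Y w)))"

text \<open>The mean curvature sphere. The identities \<open>*\<delta> = S \<delta> = \<delta> S\<close> hold in the quotient by \<open>L\<close>, hence
  appear as congruences modulo \<open>L\<close> on local sections \<open>s\<close> of \<open>L\<close>.\<close>

definition mean_curvature_sphere ::
    "'m chart set \<Rightarrow> ('m \<Rightarrow> cvec4 set) \<Rightarrow> ('m \<Rightarrow> cvec4 \<Rightarrow> cvec4) \<Rightarrow> bool" where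
  "mean_curvature_sphere \<A> L S \<longleftrightarrow>
     (\<forall>p. clinear_on UNIV (S p) \<and> (\<forall>w. S p (jj w) = jj (S p w)) \<and> (\<forall>w. S p (S p w) = - w) \<and>
          S p ` L p = L p) \<and>
     (\<forall>(U, \<phi>)\<in>\<A>.
        (\<forall>w. smooth_on U (\<lambda>v. S (\<phi> v) w)) \<and>
        (\<forall>u\<in>U. \<forall>X. \<forall>w\<in>L (\<phi> u). dd (\<lambda>v. S (\<phi> v) w) u X \<in> L (\<phi> u)) \<and>
        (\<forall>W s. local_section U (\<lambda>v. L (\<phi> v)) W s \<longrightarrow>
           (\<forall>u\<in>W. \<forall>X.
              - dd s u (\<i> * X) - S (\<phi> u) (dd s u X) \<in> L (\<phi> u) \<and>
              S (\<phi> u) (dd s u X) - dd (\<lambda>v. S (\<phi> v) (s v)) u X \<in> L (\<phi> u))) \<and>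
        (\<forall>u\<in>U. \<forall>X. \<forall>w\<in>L (\<phi> u).
           S (\<phi> u) (dd (\<lambda>v. S (\<phi> v) w) u X) - star (\<lambda>x Y w'. dd (\<lambda>v. S (\<phi> v) w') x Y) u X w = 0))"

definition N_S ::
    "(complex \<Rightarrow> cvec4 \<Rightarrow> cvec4) \<Rightarrow> complex \<Rightarrow> complex \<Rightarrow> cvec4 \<Rightarrow> cvec4" where
  "N_S T u X w = (1 / 2) *s T u (dd (\<lambda>v. T v w) u X)"

definition D_S ::
    "(complex \<Rightarrow> cvec4 \<Rightarrow> cvec4) \<Rightarrow> (complex \<Rightarrow> cvec4) \<Rightarrow> complex \<Rightarrow> complex \<Rightarrow> cvec4" where
  "D_S T s u X = dd s u X - N_S T u X (s u)"

definition hom_j_one_form ::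
    "'m chart set \<Rightarrow> ('m \<Rightarrow> cvec4 set)
      \<Rightarrow> ('m chart \<Rightarrow> complex \<Rightarrow> complex \<Rightarrow> cvec4 \<Rightarrow> cvec4) \<Rightarrow> bool" where
  "hom_j_one_form \<A> L q \<longleftrightarrow>
     endo_one_form \<A> UNIV q \<and>
     (\<forall>(U, \<phi>)\<in>\<A>. \<forall>u\<in>U. \<forall>X.
        (\<forall>w. q (U, \<phi>) u X (jj w) = jj (q (U, \<phi>) u X w)) \<and>
        (\<forall>w\<in>L (\<phi> u). q (U, \<phi>) u X w = 0) \<and>
        (\<forall>w. q (U, \<phi>) u X w \<in> L (\<phi> u)))"

end

theory Submission
  imports Defs
begin

text \<open>The derivation \<open>\<rho>(A)\<close>, \<open>v \<and> w \<mapsto> Av \<and> w + v \<and> Aw\<close>, of bivectors intertwines the two pictures. Since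
  \<open>\<and>\<^sup>2S\<close> is the reflection in the central sphere \<open>V\<close>, one has \<open>N\<^sub>V = \<rho>(N\<^sub>S)\<close>, hence \<open>\<rho>\<close> carries
  \<open>d\<^sup>D\<close> and the brackets of the spinor equations to those of the bivector equations, and it is
  injective on linear maps. That \<open>\<and>\<^sup>2S\<close> is this reflection is seen in the frame \<open>\<alpha>\<close>, \<open>j\<alpha>\<close>, \<open>c\<close>, \<open>jc\<close>, where
  \<open>\<alpha>\<close> is a section of \<open>L\<close> with \<open>S\<alpha> = i\<alpha>\<close> and \<open>c = d_zbar \<alpha>\<close>: the mean curvature sphere conditions give
  \<open>\<alpha>\<^sub>z \<in> L\<close> and \<open>Sc = ic\<close>, so the derivatives of the lift \<open>\<alpha> \<and> j\<alpha>\<close> span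
  \<open>\<alpha> \<and> j\<alpha>\<close>, \<open>\<alpha> \<and> jc\<close>, \<open>c \<and> j\<alpha>\<close>, \<open>c \<and> jc\<close>. In the same frame \<open>\<Lambda> \<and> \<Lambda>\<^sup>(\<^sup>1\<^sup>)\<close> is \<open>\<rho>\<close> of the nilpotent
  endomorphisms \<open>\<complex>\<^sup>4/L \<rightarrow> L\<close> commuting with \<open>S\<close>. Finally \<open>*q = qS\<close> is automatic: a closed \<open>q\<close> satisfies
  \<open>q\<^sub>X \<delta>\<^sub>Y = q\<^sub>Y \<delta>\<^sub>X\<close> on \<open>L\<close>, and \<open>*\<delta> = S\<delta>\<close>.\<close>

subsection \<open>Smooth maps on the plane\<close>

text \<open>Write \<open>R = \<and>\<^sup>2S\<close>. The factor and the sign in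
  \<open>N\<^sub>V = \<rho>(N\<^sub>S)\<close> come from \<open>S\<^sup>2 = -1\<close>: in
  \<open>R dR\<close> the undifferentiated leg of \<open>dS v \<and> S w\<close> returns as
  \<open>- w\<close>, so \<open>R dR = - \<rho>(S dS) = -2 \<rho>(N\<^sub>S)\<close>, while
  projecting with \<open>1/2 (1 + R)\<close> and \<open>1/2 (1 - R)\<close> turns the split
  connection into \<open>d + 1/2 R dR\<close>. The obstacle is that the 1-forms are global whereas
  the frame is local and not canonical. Hence the frame serves only to establish identities at a
  point, and both passages between the pictures are frame-free: upwards \<open>\<rho>\<close>
  itself, downwards the contraction \<open>lower\<close>, for which
  \<open>lower (\<rho> f) = f + 1/2 tr f\<close>. The nilpotent maps in question have trace zero, so
  \<open>lower\<close> returns them exactly, and smoothness, linearity in the tangent vector and the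
  chart transitions are inherited without any gluing. The same formula gives the injectivity of
  \<open>\<rho>\<close>.\<close>

lemma dd_works: "f differentiable (at u) \<Longrightarrow> (f has_derivative dd f u) (at u)"
  using frechet_derivative_works[of f "at u"] by (simp add: dd_def[abs_def])

lemma dd_eqI: "(f has_derivative f') (at u) \<Longrightarrow> dd f u X = f' X"
  using frechet_derivative_at[of f f' u] by (simp add: dd_def)

lemma dd_linear: "f differentiable (at u) \<Longrightarrow> linear (dd f u)"
  using dd_works has_derivative_linear by blast

lemma dd_const: "dd (\<lambda>_. c) u X = 0"
  by (simp add: dd_def)

text \<open>\<open>frechet_derivative\<close> is a choice among the derivatives at the point, and
  being a derivative is a local property. Both choices are made from the same predicate, so the
  equality holds even where neither function is differentiable.\<close>

lemma dd_cong_open: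
  assumes "open U" "u \<in> U" "\<And>v. v \<in> U \<Longrightarrow> f v = g v"
  shows "dd f u = dd g u"
proof -
  have "(f has_derivative f') (at u) \<longleftrightarrow> (g has_derivative f') (at u)" for f'
    using has_derivative_transform_within_open[of f f' u UNIV U g]
      has_derivative_transform_within_open[of g f' u UNIV U f] assms by auto
  then show ?thesis
    by (simp add: dd_def frechet_derivative_def fun_eq_iff)
qed

lemma differentiable_cong_open:
  assumes "open U" "u \<in> U" "\<And>v. v \<in> U \<Longrightarrow> f v = g v" "f differentiable (at u)"
  shows "g differentiable (at u)"
  using assms has_derivative_transform_within_open[of f _ u UNIV U g]
  by (auto simp: differentiable_def)

lemma Ck_on_subset: "Ck_on k U f \<Longrightarrow> W \<subseteq> U \<Longrightarrow> Ck_on k W f"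
  by (induction k arbitrary: f) (auto intro: continuous_on_subset)

lemma Ck_on_cong:
  assumes "open U" "\<And>v. v \<in> U \<Longrightarrow> f v = g v" "Ck_on k U f"
  shows "Ck_on k U g"
  using assms(2,3)
proof (induction k arbitrary: f g)
  case 0
  then show ?case by (simp cong: continuous_on_cong)
next
  case (Suc k)
  have "Ck_on k U (\<lambda>u. dd g u X)" for X
    using Suc.IH[of "\<lambda>u. dd f u X" "\<lambda>u. dd g u X"] Suc.prems dd_cong_open[OF assms(1), of _ f g]
    by simp
  moreover have "g differentiable (at u)" if "u \<in> U" for u
    using differentiable_cong_open[OF assms(1) that, of f g] Suc.prems that by simp
  ultimately show ?case by simp
qed

lemma Ck_on_Suc_D: "Ck_on (Suc k) U f \<Longrightarrow> Ck_on k U f"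
proof (induction k arbitrary: f)
  case 0
  then have "f differentiable_on U"
    unfolding differentiable_on_def by (simp add: differentiable_at_withinI)
  then show ?case
    by (simp add: differentiable_imp_continuous_on)
next
  case (Suc k)
  from Suc.prems have f: "f differentiable (at u)" "Ck_on (Suc k) U (\<lambda>u. dd f u X)" if "u \<in> U" for u X
    using that by (simp_all only: Ck_on.simps(2)[of "Suc k"])
  from Suc.prems have "Ck_on k U (\<lambda>u. dd f u X)" for X
    by (intro Suc.IH) (simp only: Ck_on.simps(2)[of "Suc k"])
  with f show ?case by (simp only: Ck_on.simps(2)[of k]) blast
qed

lemma Ck_on_const: "Ck_on k U (\<lambda>_. c)"
  by (induction k arbitrary: c) (auto simp: dd_const)

lemma Ck_on_bounded_linear:
  assumes "bounded_linear h" "open U" "Ck_on k U f"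
  shows "Ck_on k U (\<lambda>u. h (f u))"
  using assms(3)
proof (induction k arbitrary: f)
  case 0
  then show ?case by (auto intro!: bounded_linear.continuous_on[OF assms(1)])
next
  case (Suc k)
  have der: "((\<lambda>v. h (f v)) has_derivative (\<lambda>X. h (dd f u X))) (at u)" if "u \<in> U" for u
    using bounded_linear.has_derivative[OF assms(1) dd_works] Suc.prems that by simp
  have "Ck_on k U (\<lambda>u. dd (\<lambda>v. h (f v)) u X)" for X
  proof (rule Ck_on_cong[OF assms(2)])
    show "Ck_on k U (\<lambda>u. h (dd f u X))" by (rule Suc.IH) (use Suc.prems in simp)
  qed (use dd_eqI[OF der] in simp)
  then show ?case
    using der by (auto simp: differentiable_def)
qed

lemma Ck_on_add:
  assumes "open U" "Ck_on k U f" "Ck_on k U g"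
  shows "Ck_on k U (\<lambda>u. f u + g u)"
  using assms(2,3)
proof (induction k arbitrary: f g)
  case 0
  then show ?case by (auto intro!: continuous_intros)
next
  case (Suc k)
  have der: "((\<lambda>v. f v + g v) has_derivative (\<lambda>X. dd f u X + dd g u X)) (at u)" if "u \<in> U" for u
    using Suc.prems that by (auto intro!: has_derivative_add dd_works)
  have "Ck_on k U (\<lambda>u. dd (\<lambda>v. f v + g v) u X)" for X
  proof (rule Ck_on_cong[OF assms(1)])
    show "Ck_on k U (\<lambda>u. dd f u X + dd g u X)" by (rule Suc.IH) (use Suc.prems in simp_all)
  qed (use dd_eqI[OF der] in simp)
  then show ?case
    using der by (auto simp: differentiable_def)
qed

text \<open>Induction through the Leibniz rule. Each summand keeps one undifferentiated factor,
  whose class is first lowered by \<open>Ck_on_Suc_D\<close>.\<close>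

lemma Ck_on_bounded_bilinear:
  assumes h: "bounded_bilinear h" and U: "open U" and fg: "Ck_on k U f" "Ck_on k U g"
  shows "Ck_on k U (\<lambda>u. h (f u) (g u))"
  using fg
proof (induction k arbitrary: f g)
  case 0
  then show ?case by (auto intro!: bounded_bilinear.continuous_on[OF h])
next
  case (Suc k)
  have der: "((\<lambda>v. h (f v) (g v)) has_derivative (\<lambda>X. h (f u) (dd g u X) + h (dd f u X) (g u))) (at u)"
    if "u \<in> U" for u
    using Suc.prems that by (auto intro!: bounded_bilinear.FDERIV[OF h] dd_works)
  have "Ck_on k U (\<lambda>u. h (f u) (dd g u X) + h (dd f u X) (g u))" for X
    by (rule Ck_on_add[OF U]; rule Suc.IH) (use Suc.prems Suc.prems[THEN Ck_on_Suc_D] in simp_all)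
  then have "Ck_on k U (\<lambda>u. dd (\<lambda>v. h (f v) (g v)) u X)" for X
    by (rule Ck_on_cong[OF U, rotated]) (use dd_eqI[OF der] in simp)
  then show ?case
    using der by (auto simp: differentiable_def)
qed

lemma smooth_on_subset: "smooth_on U f \<Longrightarrow> W \<subseteq> U \<Longrightarrow> smooth_on W f"
  by (auto simp: smooth_on_def intro: Ck_on_subset)

lemma smooth_on_cong: "open U \<Longrightarrow> (\<And>v. v \<in> U \<Longrightarrow> f v = g v) \<Longrightarrow> smooth_on U f \<Longrightarrow> smooth_on U g"
  by (auto simp: smooth_on_def intro: Ck_on_cong)

lemma smooth_on_const: "smooth_on U (\<lambda>_. c)"
  by (simp add: smooth_on_def Ck_on_const)

lemma smooth_on_bounded_linear:
  "bounded_linear h \<Longrightarrow> open U \<Longrightarrow> smooth_on U f \<Longrightarrow> smooth_on U (\<lambda>u. h (f u))"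
  by (auto simp: smooth_on_def intro: Ck_on_bounded_linear)

lemma smooth_on_bounded_bilinear:
  "bounded_bilinear h \<Longrightarrow> open U \<Longrightarrow> smooth_on U f \<Longrightarrow> smooth_on U g \<Longrightarrow> smooth_on U (\<lambda>u. h (f u) (g u))"
  by (auto simp: smooth_on_def intro: Ck_on_bounded_bilinear)

lemma smooth_on_add: "open U \<Longrightarrow> smooth_on U f \<Longrightarrow> smooth_on U g \<Longrightarrow> smooth_on U (\<lambda>u. f u + g u)"
  by (auto simp: smooth_on_def intro: Ck_on_add)

lemma smooth_on_minus: "open U \<Longrightarrow> smooth_on U f \<Longrightarrow> smooth_on U (\<lambda>u. - f u)"
  by (rule smooth_on_bounded_linear[OF bounded_linear_minus[OF bounded_linear_ident]])

lemma smooth_on_diff: "open U \<Longrightarrow> smooth_on U f \<Longrightarrow> smooth_on U g \<Longrightarrow> smooth_on U (\<lambda>u. f u - g u)"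
  using smooth_on_add[of U f "\<lambda>u. - g u"] smooth_on_minus[of U g] by simp

lemma smooth_on_sum:
  "open U \<Longrightarrow> (\<And>i. i \<in> I \<Longrightarrow> smooth_on U (f i)) \<Longrightarrow> smooth_on U (\<lambda>u. \<Sum>i\<in>I. f i u)"
  by (induction I rule: infinite_finite_induct) (auto intro: smooth_on_const smooth_on_add)

lemma smooth_on_dd: "smooth_on U f \<Longrightarrow> smooth_on U (\<lambda>u. dd f u X)"
  unfolding smooth_on_def by (blast dest: Ck_on.simps(2)[THEN iffD1])

lemma smooth_on_differentiable: "smooth_on U f \<Longrightarrow> u \<in> U \<Longrightarrow> f differentiable (at u)"
  unfolding smooth_on_def by (blast dest: Ck_on.simps(2)[THEN iffD1])

lemma smooth_on_continuous: "smooth_on U f \<Longrightarrow> continuous_on U f"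
  unfolding smooth_on_def by (blast dest: Ck_on.simps(1)[THEN iffD1])

lemma smooth_on_linear:
  fixes h :: "'a::euclidean_space \<Rightarrow> 'b::real_normed_vector"
  shows "linear h \<Longrightarrow> open U \<Longrightarrow> smooth_on U f \<Longrightarrow> smooth_on U (\<lambda>u. h (f u))"
  by (rule smooth_on_bounded_linear) (simp_all add: linear_conv_bounded_linear)

lemma dd_linear_comp:
  fixes h :: "'a::euclidean_space \<Rightarrow> 'b::real_normed_vector"
  assumes "linear h" "f differentiable (at u)"
  shows "dd (\<lambda>v. h (f v)) u X = h (dd f u X)"
  using dd_eqI[OF bounded_linear.has_derivative[OF _ dd_works[OF assms(2)]]] assms(1)
  by (simp add: linear_conv_bounded_linear)

lemma dd_bilinear:
  assumes "bounded_bilinear h" "f differentiable (at u)" "g differentiable (at u)"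
  shows "dd (\<lambda>v. h (f v) (g v)) u X = h (dd f u X) (g u) + h (f u) (dd g u X)"
  using dd_eqI[OF bounded_bilinear.FDERIV[OF assms(1) dd_works[OF assms(2)] dd_works[OF assms(3)]]]
  by (simp add: add.commute)

lemma dd_add:
  "f differentiable (at u) \<Longrightarrow> g differentiable (at u) \<Longrightarrow> dd (\<lambda>v. f v + g v) u X = dd f u X + dd g u X"
  by (rule dd_eqI[OF has_derivative_add[OF dd_works dd_works]])

lemma dd_diff:
  "f differentiable (at u) \<Longrightarrow> g differentiable (at u) \<Longrightarrow> dd (\<lambda>v. f v - g v) u X = dd f u X - dd g u X"
  by (rule dd_eqI[OF has_derivative_diff[OF dd_works dd_works]])

lemma dd_minus: "f differentiable (at u) \<Longrightarrow> dd (\<lambda>v. - f v) u X = - dd f u X"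
  by (rule dd_eqI[OF has_derivative_minus[OF dd_works]])

lemma dd_sum:
  "(\<And>i. i \<in> I \<Longrightarrow> f i differentiable (at u)) \<Longrightarrow> dd (\<lambda>v. \<Sum>i\<in>I. f i v) u X = (\<Sum>i\<in>I. dd (f i) u X)"
  by (rule dd_eqI[OF has_derivative_sum[OF dd_works]])

section \<open>Symmetry of mixed second derivatives\<close>

lemma has_derivative_along_line:
  fixes g :: "complex \<Rightarrow> real"
  assumes "g differentiable (at (p + t *\<^sub>R X))"
  shows "((\<lambda>t. g (p + t *\<^sub>R X)) has_real_derivative dd g (p + t *\<^sub>R X) X) (at t)"
proof -
  have "((\<lambda>t. g (p + t *\<^sub>R X)) has_derivative (\<lambda>h. dd g (p + t *\<^sub>R X) (h *\<^sub>R X))) (at t)"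
    by (rule has_derivative_compose[where f = "\<lambda>t. p + t *\<^sub>R X" and g = g, OF _ dd_works[OF assms]])
      (auto intro!: derivative_eq_intros)
  then show ?thesis
    using linear_scale[OF dd_linear[OF assms]]
    by (simp add: has_field_derivative_def mult_commute_abs)
qed

text \<open>The mean value theorem twice: along \<open>X\<close> for the difference of
  \<open>g\<close> between two opposite sides of the parallelogram, then along \<open>Y\<close> for
  the resulting difference of first derivatives.\<close>

lemma second_difference:
  fixes g :: "complex \<Rightarrow> real"
  assumes "Ck_on 2 U g" "h > 0"
    and inU: "\<And>s t. 0 \<le> s \<Longrightarrow> s \<le> h \<Longrightarrow> 0 \<le> t \<Longrightarrow> t \<le> h \<Longrightarrow> u + s *\<^sub>R X + t *\<^sub>R Y \<in> U"
  obtains s t where "0 \<le> s" "s \<le> h" "0 \<le> t" "t \<le> h"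
    "g (u + h *\<^sub>R X + h *\<^sub>R Y) - g (u + h *\<^sub>R X) - g (u + h *\<^sub>R Y) + g u =
     h * (h * dd (\<lambda>v. dd g v X) (u + s *\<^sub>R X + t *\<^sub>R Y) Y)"
proof -
  have d1: "g differentiable (at v)" "(\<lambda>v. dd g v X) differentiable (at v)" if "v \<in> U" for v
    using assms(1) that by (auto simp: numeral_2_eq_2)
  have comm: "u + s *\<^sub>R X + t *\<^sub>R Y = (u + t *\<^sub>R Y) + s *\<^sub>R X" for s t by simp
  have inU0: "u + s *\<^sub>R X \<in> U" if "0 \<le> s" "s \<le> h" for s
    using inU[of s 0] that assms(2) by simp
  have der1: "((\<lambda>s. g ((u + h *\<^sub>R Y) + s *\<^sub>R X) - g (u + s *\<^sub>R X)) has_real_derivative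
      (dd g ((u + h *\<^sub>R Y) + s *\<^sub>R X) X - dd g (u + s *\<^sub>R X) X)) (at s)" if "0 \<le> s" "s \<le> h" for s
    using inU[of s h] inU0[of s] that assms(2)
    by (intro DERIV_diff has_derivative_along_line d1) (simp_all add: add.commute add.left_commute)
  obtain s where s: "0 < s" "s < h"
    and e1: "(g ((u + h *\<^sub>R Y) + h *\<^sub>R X) - g (u + h *\<^sub>R X)) - (g ((u + h *\<^sub>R Y) + 0 *\<^sub>R X) - g (u + 0 *\<^sub>R X))
      = (h - 0) * (dd g ((u + h *\<^sub>R Y) + s *\<^sub>R X) X - dd g (u + s *\<^sub>R X) X)"
    using MVT2[OF assms(2) der1] by blast
  have der2: "((\<lambda>t. dd g ((u + s *\<^sub>R X) + t *\<^sub>R Y) X) has_real_derivative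
      dd (\<lambda>v. dd g v X) ((u + s *\<^sub>R X) + t *\<^sub>R Y) Y) (at t)" if "0 \<le> t" "t \<le> h" for t
    using has_derivative_along_line[of "\<lambda>v. dd g v X" "u + s *\<^sub>R X" t Y] d1(2) inU[of s t] that s
    by simp
  obtain t where t: "0 < t" "t < h"
    and e2: "dd g ((u + s *\<^sub>R X) + h *\<^sub>R Y) X - dd g ((u + s *\<^sub>R X) + 0 *\<^sub>R Y) X =
      (h - 0) * dd (\<lambda>v. dd g v X) ((u + s *\<^sub>R X) + t *\<^sub>R Y) Y"
    using MVT2[OF assms(2) der2] by blast
  show thesis
    by (rule that[of s t]) (use s t e1 e2 in \<open>simp_all add: comm\<close>)
qed

text \<open>Schwarz's theorem. The second difference over a small parallelogram is symmetric in
  \<open>X\<close> and \<open>Y\<close>, so the two mixed derivatives share a value, attained at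
  possibly different points near \<open>u\<close>; continuity then excludes distinct values at
  \<open>u\<close>.\<close>

lemma dd_commute_real:
  fixes g :: "complex \<Rightarrow> real"
  assumes U: "open U" "u \<in> U" and C2: "Ck_on 2 U g"
  shows "dd (\<lambda>v. dd g v X) u Y = dd (\<lambda>v. dd g v Y) u X"
proof (rule ccontr)
  define P where "P v = dd (\<lambda>v. dd g v X) v Y" for v
  define Q where "Q v = dd (\<lambda>v. dd g v Y) v X" for v
  assume "\<not> ?thesis"
  then have ne: "P u \<noteq> Q u" by (simp add: P_def Q_def)
  \<comment> \<open>Half the gap: two errors below \<open>e\<close> cannot bridge it.\<close>
  define e where "e = dist (P u) (Q u) / 2"
  have e: "e > 0" using ne by (simp add: e_def)
  have "continuous_on U P" "continuous_on U Q"
    using C2 by (simp_all add: numeral_2_eq_2 P_def[abs_def] Q_def[abs_def])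
  then have "isCont P u" "isCont Q u"
    using U by (simp_all add: continuous_on_eq_continuous_at)
  then obtain r1 r2 where r: "r1 > 0" "r2 > 0" "\<And>v. dist v u < r1 \<Longrightarrow> dist (P v) (P u) < e"
    "\<And>v. dist v u < r2 \<Longrightarrow> dist (Q v) (Q u) < e"
    using e unfolding continuous_at_eps_delta by blast
  obtain r3 where r3: "r3 > 0" "ball u r3 \<subseteq> U" using U open_contains_ball by blast
  define r0 where "r0 = min r1 (min r2 r3)"
  have r0: "r0 > 0" using r r3 by (simp add: r0_def)
  \<comment> \<open>With this side length the whole parallelogram lies in the ball of radius
    \<open>r0\<close>; the summand 1 keeps the denominator positive.\<close>
  define h where "h = r0 / (norm X + norm Y + 1)"
  have n: "norm X + norm Y + 1 > 0" using norm_ge_zero[of X] norm_ge_zero[of Y] by linarith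
  have h: "h > 0" using r0 n by (simp add: h_def)
  have near: "dist (u + s *\<^sub>R X + t *\<^sub>R Y) u < r0"
    if "0 \<le> s" "s \<le> h" "0 \<le> t" "t \<le> h" for s t
  proof -
    have "dist (u + s *\<^sub>R X + t *\<^sub>R Y) u \<le> s * norm X + t * norm Y"
      using norm_triangle_ineq[of "s *\<^sub>R X" "t *\<^sub>R Y"] that by (simp add: dist_norm)
    also have "\<dots> \<le> h * norm X + h * norm Y"
      using that by (intro add_mono mult_right_mono) auto
    also have "\<dots> < h * (norm X + norm Y + 1)" using h by (simp add: algebra_simps)
    also have "\<dots> = r0" using n by (simp add: h_def)
    finally show ?thesis .
  qed
  have near': "dist (u + t *\<^sub>R Y + s *\<^sub>R X) u < r0"
    if "0 \<le> s" "s \<le> h" "0 \<le> t" "t \<le> h" for s t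
    using near[OF that] by (simp add: add.commute add.left_commute)
  have inU: "v \<in> U" if "dist v u < r0" for v
    using that r3(2) by (auto simp: r0_def dist_commute)
  obtain s t where st: "0 \<le> s" "s \<le> h" "0 \<le> t" "t \<le> h"
    "g (u + h *\<^sub>R X + h *\<^sub>R Y) - g (u + h *\<^sub>R X) - g (u + h *\<^sub>R Y) + g u =
     h * (h * P (u + s *\<^sub>R X + t *\<^sub>R Y))"
    unfolding P_def by (rule second_difference[OF C2 h]) (auto intro: inU near)
  obtain s' t' where st': "0 \<le> s'" "s' \<le> h" "0 \<le> t'" "t' \<le> h"
    "g (u + h *\<^sub>R Y + h *\<^sub>R X) - g (u + h *\<^sub>R Y) - g (u + h *\<^sub>R X) + g u =
     h * (h * Q (u + s' *\<^sub>R Y + t' *\<^sub>R X))"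
    unfolding Q_def by (rule second_difference[OF C2 h, of u Y X]) (auto intro: inU near')
  have "g (u + h *\<^sub>R Y + h *\<^sub>R X) = g (u + h *\<^sub>R X + h *\<^sub>R Y)"
    by (simp add: add.commute add.left_commute)
  with st(5) st'(5) have "h * (h * P (u + s *\<^sub>R X + t *\<^sub>R Y)) = h * (h * Q (u + s' *\<^sub>R Y + t' *\<^sub>R X))"
    by linarith
  then have eq: "P (u + s *\<^sub>R X + t *\<^sub>R Y) = Q (u + s' *\<^sub>R Y + t' *\<^sub>R X)" using h by simp
  have "dist (P (u + s *\<^sub>R X + t *\<^sub>R Y)) (P u) < e"
    using near[OF st(1-4)] r(3) by (simp add: r0_def)
  moreover have "dist (Q (u + s' *\<^sub>R Y + t' *\<^sub>R X)) (Q u) < e"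
    using near'[OF st'(3,4,1,2)] r(4) by (simp add: r0_def)
  ultimately have "dist (P u) (Q u) < 2 * e"
    unfolding eq dist_real_def by linarith
  then show False by (simp add: e_def)
qed

lemma dd_commute:
  fixes f :: "complex \<Rightarrow> 'e::euclidean_space"
  assumes U: "open U" "u \<in> U" and f: "smooth_on U f"
  shows "dd (\<lambda>v. dd f v X) u Y = dd (\<lambda>v. dd f v Y) u X"
proof (rule euclidean_eqI)
  fix b :: 'e assume "b \<in> Basis"
  have lin: "linear (\<lambda>x. x \<bullet> b)" by (simp add: bounded_linear.linear bounded_linear_inner_left)
  have inn: "dd (\<lambda>v. f v \<bullet> b) v Z = dd f v Z \<bullet> b" if "v \<in> U" for v Z
    using dd_linear_comp[OF lin] smooth_on_differentiable[OF f that] by blast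
  have inn2: "dd (\<lambda>v. dd (\<lambda>v. f v \<bullet> b) v Z) u Z' = dd (\<lambda>v. dd f v Z) u Z' \<bullet> b" for Z Z'
    using dd_cong_open[OF U, of "\<lambda>v. dd (\<lambda>v. f v \<bullet> b) v Z" "\<lambda>v. dd f v Z \<bullet> b"] inn
      dd_linear_comp[OF lin smooth_on_differentiable[OF smooth_on_dd[OF f] U(2)]] by simp
  have "Ck_on 2 U (\<lambda>v. f v \<bullet> b)"
    using smooth_on_linear[OF lin U(1) f] by (simp add: smooth_on_def)
  from dd_commute_real[OF U this, of X Y]
  show "dd (\<lambda>v. dd f v X) u Y \<bullet> b = dd (\<lambda>v. dd f v Y) u X \<bullet> b"
    by (simp add: inn2)
qed

subsection \<open>Bivectors and derivations\<close>

lemma clinear_iff_linear: "clinear_on UNIV f \<longleftrightarrow> Vector_Spaces.linear (*s) (*s) f"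
proof
  assume "clinear_on UNIV f"
  then show "Vector_Spaces.linear (*s) (*s) f"
    by (simp add: clinear_on_def Vector_Spaces.linear_iff vec.vector_space_axioms)
next
  assume "Vector_Spaces.linear (*s) (*s) f"
  then show "clinear_on UNIV f"
    by (auto simp: clinear_on_def vec.linear_add vec.linear_scale)
qed

lemma
  assumes "clinear_on UNIV f"
  shows clinear_add: "f (v + w) = f v + f w"
    and clinear_scale: "f (k *s v) = k *s f v"
    and clinear_zero: "f 0 = 0"
    and clinear_neg: "f (- v) = - f v"
    and clinear_diff: "f (v - w) = f v - f w"
    and clinear_sum: "f (sum g I) = (\<Sum>i\<in>I. f (g i))"
  using assms unfolding clinear_iff_linear
  by (simp_all add: vec.linear_add vec.linear_scale vec.linear_0 vec.linear_neg vec.linear_diff vec.linear_sum)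

lemma clinearI:
  "(\<And>v w. f (v + w) = f v + f w) \<Longrightarrow> (\<And>k v. f (k *s v) = k *s f v) \<Longrightarrow> clinear_on UNIV f"
  by (simp add: clinear_on_def)

lemma scaleR_eq_vec_scale: "r *\<^sub>R (v :: complex ^ 'n) = of_real r *s v"
  unfolding vec_eq_iff
  by (simp only: vector_scaleR_component vector_smult_component scaleR_conv_of_real[where 'a = complex] simp_thms)

lemma clinear_imp_linear: "clinear_on UNIV f \<Longrightarrow> linear f"
  by (auto intro!: linearI simp: clinear_add clinear_scale scaleR_eq_vec_scale)

lemma clinear_eq_on_span:
  "clinear_on UNIV f \<Longrightarrow> clinear_on UNIV g \<Longrightarrow> (\<And>x. x \<in> B \<Longrightarrow> f x = g x) \<Longrightarrow> x \<in> vec.span B \<Longrightarrow> f x = g x"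
  unfolding clinear_iff_linear by (rule vec.linear_eq_on_span)

lemma clinear_expand:
  fixes f :: "complex ^ 'n \<Rightarrow> complex ^ 'n"
  assumes "clinear_on UNIV f"
  shows "f v = (\<Sum>i\<in>UNIV. v $ i *s f (axis i 1))"
proof -
  have "f v = f (\<Sum>i\<in>UNIV. v $ i *s axis i 1)" by (simp add: basis_expansion)
  then show ?thesis by (simp add: clinear_sum[OF assms] clinear_scale[OF assms])
qed

section \<open>The quaternionic structure and decomposable bivectors\<close>

lemma jj_jj [simp]: "jj (jj v) = - v"
  by (simp add: jj_def vec_eq_iff forall_4 vector_def)

lemma jj_add: "jj (v + w) = jj v + jj w"
  by (simp add: jj_def vec_eq_iff forall_4 vector_def)

lemma jj_scale: "jj (k *s v) = cnj k *s jj v"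
  by (simp add: jj_def vec_eq_iff forall_4 vector_def)

lemma jj_neg: "jj (- v) = - jj v"
  by (simp add: jj_def vec_eq_iff forall_4 vector_def)

lemma jj_diff: "jj (v - w) = jj v - jj w"
  by (simp add: jj_def vec_eq_iff forall_4 vector_def)

lemma jj_zero [simp]: "jj 0 = 0"
  by (simp add: jj_def vec_eq_iff forall_4 vector_def)

lemma jj_eq_zero_iff [simp]: "jj v = 0 \<longleftrightarrow> v = 0"
  by (metis jj_jj jj_zero neg_equal_0_iff_equal)

lemma linear_jj: "linear jj"
  by (auto intro!: linearI simp: jj_add jj_scale scaleR_eq_vec_scale)

text \<open>\<open>x v + y j v\<close> is the quaternion \<open>x + y j\<close> times
  \<open>v\<close>. Its conjugate \<open>cnj x - y j\<close> preserves \<open>M\<close> and turns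
  the product into the positive real norm times \<open>v\<close>. With \<open>M = {0}\<close> this
  is the independence of \<open>v\<close> and \<open>jj v\<close>; with \<open>M\<close> a
  \<open>j\<close>-stable plane it is their independence modulo that plane.\<close>

lemma quaternionic_line_cancel:
  assumes M: "vec.subspace M" "\<And>v. v \<in> M \<Longrightarrow> jj v \<in> M"
    and mem: "x *s v + y *s jj v \<in> M" and ne: "x \<noteq> 0 \<or> y \<noteq> 0"
  shows "v \<in> M"
proof -
  define p where "p = x *s v + y *s jj v"
  have p: "p \<in> M" using mem by (simp add: p_def)
  have "cnj x *s p - y *s jj p \<in> M"
    by (rule vec.subspace_diff[OF M(1) vec.subspace_scale[OF M(1) p] vec.subspace_scale[OF M(1) M(2)[OF p]]])
  also have "cnj x *s p - y *s jj p = (x * cnj x + y * cnj y) *s v"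
    by (simp add: p_def jj_add jj_scale vec_eq_iff algebra_simps)
  finally have "(inverse (x * cnj x + y * cnj y)) *s ((x * cnj x + y * cnj y) *s v) \<in> M"
    by (rule vec.subspace_scale[OF M(1)])
  moreover have "x * cnj x + y * cnj y \<noteq> 0"
  proof -
    have "x * cnj x + y * cnj y = of_real ((cmod x)\<^sup>2 + (cmod y)\<^sup>2)"
      by (simp only: complex_norm_square of_real_add)
    then show ?thesis using ne by (auto simp: add_nonneg_eq_0_iff simp flip: of_real_add of_real_power)
  qed
  moreover have "inverse n *s (n *s v) = v" if "n \<noteq> 0" for n
    using that by (simp add: vec.scale_scale)
  ultimately show ?thesis by metis
qed

lemma wedge_add_left: "wedge (u + v) w = wedge u w + wedge v w"
  and wedge_add_right: "wedge u (v + w) = wedge u v + wedge u w"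
  and wedge_scale_left: "wedge (k *s u) v = k *s wedge u v"
  and wedge_scale_right: "wedge u (k *s v) = k *s wedge u v"
  and wedge_neg_left: "wedge (- u) v = - wedge u v"
  and wedge_neg_right: "wedge u (- v) = - wedge u v"
  and wedge_diff_left: "wedge (u - v) w = wedge u w - wedge v w"
  and wedge_diff_right: "wedge u (v - w) = wedge u v - wedge u w"
  and wedge_zero_left [simp]: "wedge 0 v = 0"
  and wedge_zero_right [simp]: "wedge u 0 = 0"
  and wedge_self [simp]: "wedge u u = 0"
  by (simp_all add: wedge_def vec_eq_iff algebra_simps)

lemma wedge_swap: "wedge v u = - wedge u v"
  by (simp add: wedge_def vec_eq_iff)

lemmas wedge_bilin = wedge_add_left wedge_add_right wedge_scale_left wedge_scale_right
  wedge_neg_left wedge_neg_right wedge_diff_left wedge_diff_right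

lemma wedge_in_bivectors [simp, intro]: "wedge u v \<in> bivectors"
  by (simp add: wedge_def bivectors_def)

lemma bounded_bilinear_wedge: "bounded_bilinear wedge"
proof -
  have "bilinear wedge"
    unfolding bilinear_def by (auto intro!: linearI simp: wedge_bilin scaleR_eq_vec_scale)
  then show ?thesis by (simp add: bilinear_conv_bounded_bilinear)
qed

lemma bounded_bilinear_vec_scale: "bounded_bilinear ((*s) :: complex \<Rightarrow> complex ^ 'n \<Rightarrow> _)"
proof -
  have "bilinear ((*s) :: complex \<Rightarrow> complex ^ 'n \<Rightarrow> _)"
    unfolding bilinear_def
    by (auto intro!: linearI simp: vec.scale_left_distrib vec.scale_right_distrib vec_eq_iff
      vector_scaleR_component scaleR_conv_of_real[where 'a = complex])
  then show ?thesis by (simp add: bilinear_conv_bounded_bilinear)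
qed

lemma bivectors_swap: "B \<in> bivectors \<Longrightarrow> B $ (b, a) = - B $ (a, b)"
  unfolding bivectors_def by blast

lemma bivectorsI: "(\<And>a b. B $ (b, a) = - B $ (a, b)) \<Longrightarrow> B \<in> bivectors"
  unfolding bivectors_def by blast

lemma subspace_bivectors: "vec.subspace bivectors"
proof (rule vec.subspaceI)
  show "A + B \<in> bivectors" if "A \<in> bivectors" "B \<in> bivectors" for A B
  proof (rule bivectorsI)
    show "(A + B) $ (b, a) = - (A + B) $ (a, b)" for a b
      using bivectors_swap[OF that(1), of b a] bivectors_swap[OF that(2), of b a] by simp
  qed
  show "k *s B \<in> bivectors" if "B \<in> bivectors" for k B
  proof (rule bivectorsI)
    show "(k *s B) $ (b, a) = - (k *s B) $ (a, b)" for a b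
      using bivectors_swap[OF that, of b a] by simp
  qed
qed (rule bivectorsI; simp)

lemma bivector_expansion:
  assumes "B \<in> bivectors"
  shows "B = (1 / 2) *s (\<Sum>a\<in>UNIV. \<Sum>b\<in>UNIV. B $ (a, b) *s wedge (axis a 1) (axis b 1))" (is "B = ?R")
proof -
  have delta: "(\<Sum>a\<in>UNIV. \<Sum>b\<in>UNIV. if a = c then if b = d then B $ (a, b) else 0 else 0) = B $ (c, d)"
    for c d
  proof -
    have "(\<Sum>b\<in>UNIV. if a = c then if b = d then B $ (a, b) else 0 else 0) =
        (if a = c then B $ (a, d) else 0)" for a
      by simp
    then show ?thesis by simp
  qed
  have "?R $ (c, d) = B $ (c, d)" for c d
  proof -
    have "?R $ (c, d) = (1 / 2) * (\<Sum>a\<in>UNIV. \<Sum>b\<in>UNIV.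
        (if a = c then if b = d then B $ (a, b) else 0 else 0) -
        (if a = d then if b = c then B $ (a, b) else 0 else 0))"
      by (simp add: sum_component wedge_def axis_def) (intro sum.cong refl; simp)
    also have "\<dots> = (1 / 2) * (B $ (c, d) - B $ (d, c))"
      by (simp only: sum_subtractf delta)
    also have "\<dots> = B $ (c, d)"
      using bivectors_swap[OF assms, of d c] by simp
    finally show ?thesis .
  qed
  then show ?thesis by (simp add: vec_eq_iff split_paired_all)
qed

lemma bivectors_eq_span: "bivectors = vec.span {wedge v w |v w. True}"
proof
  show "bivectors \<subseteq> vec.span {wedge v w |v w. True}"
  proof
    fix B assume "B \<in> bivectors"
    from bivector_expansion[OF this] show "B \<in> vec.span {wedge v w |v w. True}"
      by (rule ssubst) (intro vec.span_scale vec.span_sum vec.span_base; blast)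
  qed
  show "vec.span {wedge v w |v w. True} \<subseteq> bivectors"
    by (rule vec.span_minimal) (auto intro: subspace_bivectors)
qed

lemma bivectors_induct [consumes 1, case_names wedge add scale]:
  assumes "B \<in> bivectors"
    and "\<And>v w. P (wedge v w)"
    and "\<And>A B. P A \<Longrightarrow> P B \<Longrightarrow> P (A + B)"
    and "\<And>k B. P B \<Longrightarrow> P (k *s B)"
  shows "P B"
proof -
  have "P 0" using assms(2)[of 0 0] by simp
  have "B \<in> vec.span {wedge v w |v w. True}" using assms(1) by (simp add: bivectors_eq_span)
  then show ?thesis
    by (rule vec.span_induct) (auto intro!: vec.subspaceI assms \<open>P 0\<close>)
qed

text \<open>The linear extension of an alternating bilinear map from decomposable bivectors. The sum
  runs over ordered pairs of basis vectors, hence the factor 1/2. It makes sense on the whole type,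
  so that linearity is available as \<open>clinear_on UNIV\<close>.\<close>

definition bext :: "(cvec4 \<Rightarrow> cvec4 \<Rightarrow> bivec) \<Rightarrow> bivec \<Rightarrow> bivec" where
  "bext \<phi> B = (1 / 2) *s (\<Sum>a\<in>UNIV. \<Sum>b\<in>UNIV. B $ (a, b) *s \<phi> (axis a 1) (axis b 1))"

lemma clinear_bext: "clinear_on UNIV (bext \<phi>)"
  by (rule clinearI)
    (simp_all add: bext_def vec.scale_left_distrib sum.distrib vec.scale_right_distrib
      vec.scale_sum_right mult.assoc mult.left_commute)

lemma bext_wedge:
  assumes add: "\<And>u v w. \<phi> (u + v) w = \<phi> u w + \<phi> v w" "\<And>u v w. \<phi> u (v + w) = \<phi> u v + \<phi> u w"
    and sc: "\<And>k u v. \<phi> (k *s u) v = k *s \<phi> u v" "\<And>k u v. \<phi> u (k *s v) = k *s \<phi> u v"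
    and alt: "\<And>u v. \<phi> v u = - \<phi> u v"
  shows "bext \<phi> (wedge v w) = \<phi> v w"
proof -
  let ?e = "\<lambda>i::4. axis i (1::complex)"
  have lin: "Vector_Spaces.linear (*s) (*s) (\<phi> u)" "Vector_Spaces.linear (*s) (*s) (\<lambda>u. \<phi> u v)" for u v
    by (simp_all add: Vector_Spaces.linear_iff vec.vector_space_axioms add sc)
  have full: "\<phi> v w = (\<Sum>a\<in>UNIV. \<Sum>b\<in>UNIV. (v $ a * w $ b) *s \<phi> (?e a) (?e b))" for v w
  proof -
    have "\<phi> v w = \<phi> (\<Sum>a\<in>UNIV. v $ a *s ?e a) (\<Sum>b\<in>UNIV. w $ b *s ?e b)"
      by (simp only: basis_expansion)
    also have "\<dots> = (\<Sum>a\<in>UNIV. \<Sum>b\<in>UNIV. (v $ a * w $ b) *s \<phi> (?e a) (?e b))"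
      by (subst vec.linear_sum[OF lin(2)], subst vec.linear_sum[OF lin(1)])
        (simp add: sc vec.scale_sum_right mult.commute)
    finally show ?thesis .
  qed
  have "(\<Sum>a\<in>UNIV. \<Sum>b\<in>UNIV. wedge v w $ (a, b) *s \<phi> (?e a) (?e b)) = \<phi> v w - \<phi> w v"
    unfolding full[of v w] full[of w v] sum_subtractf[symmetric]
    by (intro sum.cong refl) (simp add: wedge_def vec.scale_left_diff_distrib mult.commute)
  also have "\<dots> = 2 *s \<phi> v w" using alt[of v w] by (simp add: vec_eq_iff)
  finally show ?thesis by (simp add: bext_def)
qed

definition biv_map :: "(cvec4 \<Rightarrow> cvec4) \<Rightarrow> bivec \<Rightarrow> bivec" where
  "biv_map f = bext (\<lambda>v w. wedge (f v) (f w))"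

text \<open>The \<open>\<rho>(f)\<close> of the overview, the infinitesimal counterpart of the
  exterior square \<open>biv_map f\<close>.\<close>

definition biv_der :: "(cvec4 \<Rightarrow> cvec4) \<Rightarrow> bivec \<Rightarrow> bivec" where
  "biv_der f = bext (\<lambda>v w. wedge (f v) w + wedge v (f w))"

lemma clinear_biv_map: "clinear_on UNIV (biv_map f)"
  and clinear_biv_der: "clinear_on UNIV (biv_der f)"
  by (simp_all add: biv_map_def biv_der_def clinear_bext)

lemma biv_map_wedge: "clinear_on UNIV f \<Longrightarrow> biv_map f (wedge v w) = wedge (f v) (f w)"
  unfolding biv_map_def
proof (rule bext_wedge)
  show "wedge (f v) (f u) = - wedge (f u) (f v)" for u v by (rule wedge_swap)
qed (simp_all add: clinear_add clinear_scale wedge_bilin)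

lemma biv_der_wedge: "clinear_on UNIV f \<Longrightarrow> biv_der f (wedge v w) = wedge (f v) w + wedge v (f w)"
  unfolding biv_der_def
proof (rule bext_wedge)
  show "wedge (f v) u + wedge v (f u) = - (wedge (f u) v + wedge u (f v))" for u v
    using wedge_swap[of "f v" u] wedge_swap[of v "f u"] by simp
qed (simp_all add: clinear_add clinear_scale wedge_bilin vec.scale_right_distrib)

lemma bext_in_bivectors:
  assumes "\<And>v w. \<phi> v w \<in> bivectors"
  shows "bext \<phi> B \<in> bivectors"
  unfolding bext_def
  by (intro vec.subspace_scale[OF subspace_bivectors] vec.subspace_sum[OF subspace_bivectors] assms)

lemma biv_map_in_bivectors: "biv_map f B \<in> bivectors"
  and biv_der_in_bivectors: "biv_der f B \<in> bivectors"
  by (auto simp: biv_map_def biv_der_def intro!: bext_in_bivectors vec.subspace_add[OF subspace_bivectors])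

lemma bext_add: "bext (\<lambda>v w. \<phi> v w + \<psi> v w) B = bext \<phi> B + bext \<psi> B"
  by (simp add: bext_def vec.scale_right_distrib sum.distrib)

lemma bext_scale: "bext (\<lambda>v w. k *s \<phi> v w) B = k *s bext \<phi> B"
  by (simp add: bext_def vec.scale_sum_right mult_ac)

lemma biv_der_add: "biv_der (\<lambda>v. f v + g v) B = biv_der f B + biv_der g B"
proof -
  have "(\<lambda>v w. wedge (f v + g v) w + wedge v (f w + g w)) =
      (\<lambda>v w. (wedge (f v) w + wedge v (f w)) + (wedge (g v) w + wedge v (g w)))"
    by (simp add: wedge_bilin fun_eq_iff)
  then show ?thesis by (simp only: biv_der_def bext_add)
qed

lemma biv_der_scale: "biv_der (\<lambda>v. k *s f v) B = k *s biv_der f B"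
proof -
  have "(\<lambda>v w. wedge (k *s f v) w + wedge v (k *s f w)) = (\<lambda>v w. k *s (wedge (f v) w + wedge v (f w)))"
    by (simp add: wedge_bilin fun_eq_iff vec.scale_right_distrib)
  then show ?thesis by (simp only: biv_der_def bext_scale)
qed

lemma biv_der_neg: "biv_der (\<lambda>v. - f v) B = - biv_der f B"
  using biv_der_scale[of "- 1" f B] by simp

lemma biv_der_diff: "biv_der (\<lambda>v. f v - g v) B = biv_der f B - biv_der g B"
  using biv_der_add[of f "\<lambda>v. - g v" B] by (simp add: biv_der_neg)

text \<open>On \<open>v \<and> w\<close> the mixed terms
  \<open>f v \<and> g w + g v \<and> f w\<close> arise in both orders of composition and cancel, so
  \<open>\<rho>\<close> is a homomorphism of Lie algebras.\<close>

lemma biv_der_commutator: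
  assumes f: "clinear_on UNIV f" and g: "clinear_on UNIV g" and B: "B \<in> bivectors"
  shows "biv_der f (biv_der g B) - biv_der g (biv_der f B) = biv_der (\<lambda>v. f (g v) - g (f v)) B"
proof -
  have fg: "clinear_on UNIV (\<lambda>v. f (g v) - g (f v))"
    by (rule clinearI) (simp_all add: f g clinear_add clinear_scale algebra_simps vec.scale_right_diff_distrib)
  note lins = clinear_add[OF clinear_biv_der] clinear_scale[OF clinear_biv_der]
  show ?thesis
    using B
  proof (induction rule: bivectors_induct)
    case (wedge v w)
    then show ?case by (simp add: biv_der_wedge f g fg lins wedge_bilin)
  next
    case (add A B)
    then show ?case by (simp add: lins algebra_simps)
  next
    case (scale k B)
    then show ?case by (simp only: lins vec.scale_right_diff_distrib[symmetric])
  qed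
qed

text \<open>A left inverse of \<open>\<rho>\<close> up to a multiple of the trace: the second index
  of \<open>F (v \<and> e\<^sub>b)\<close> is contracted with the dual basis. It is explicit in
  \<open>F\<close> and sees \<open>F\<close> only on bivectors. The factor 1/2 is
  \<open>1/(n - 2)\<close> for \<open>n = 4\<close>.\<close>

definition lower :: "(bivec \<Rightarrow> bivec) \<Rightarrow> cvec4 \<Rightarrow> cvec4" where
  "lower F v = (\<chi> c. (1 / 2) * (\<Sum>b\<in>UNIV. F (wedge v (axis b 1)) $ (c, b)))"

text \<open>Contracting \<open>f v \<and> e\<^sub>b + v \<and> f e\<^sub>b\<close> over
  \<open>b\<close> gives \<open>4 f v - f v + (tr f) v - f v\<close>, where the last
  \<open>f v\<close> is its own expansion in the basis.\<close>

lemma lower_biv_der: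
  assumes f: "clinear_on UNIV f"
  shows "lower (biv_der f) v = f v + ((1 / 2) * (\<Sum>b\<in>UNIV. f (axis b 1) $ b)) *s v"
proof -
  have ax: "axis b (1 :: complex) $ c = (if c = b then 1 else 0)" for b c :: 4
    by (simp add: axis_def)
  have "(\<Sum>b\<in>UNIV. biv_der f (wedge v (axis b 1)) $ (c, b)) =
      2 * f v $ c + (\<Sum>b\<in>UNIV. f (axis b 1) $ b) * v $ c" for c
  proof -
    have "(\<Sum>b\<in>UNIV. biv_der f (wedge v (axis b 1)) $ (c, b)) =
      (\<Sum>b\<in>UNIV. f v $ c - (if c = b then f v $ b else 0) + v $ c * f (axis b 1) $ b
         - v $ b * f (axis b 1) $ c)"
      unfolding biv_der_wedge[OF f] by (intro sum.cong refl) (auto simp: wedge_def ax)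
    also have "\<dots> = 4 * f v $ c - f v $ c + v $ c * (\<Sum>b\<in>UNIV. f (axis b 1) $ b) -
        (\<Sum>b\<in>UNIV. v $ b *s f (axis b 1)) $ c"
      by (simp add: sum.distrib sum_subtractf sum_distrib_left sum_component)
    also have "(\<Sum>b\<in>UNIV. v $ b *s f (axis b 1)) = f v"
      by (rule clinear_expand[OF f, symmetric])
    finally show ?thesis by (simp add: mult.commute)
  qed
  then show ?thesis by (simp add: lower_def vec_eq_iff algebra_simps)
qed

lemma lower_cong: "(\<And>B. B \<in> bivectors \<Longrightarrow> F B = G B) \<Longrightarrow> lower F = lower G"
  by (simp add: lower_def fun_eq_iff)

text \<open>By \<open>lower\<close> the derivation determines \<open>f + 1/2 tr f\<close>, so only
  the traces remain to be compared.\<close>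

lemma biv_der_inject:
  assumes f: "clinear_on UNIV f" and g: "clinear_on UNIV g"
    and eq: "\<And>B. B \<in> bivectors \<Longrightarrow> biv_der f B = biv_der g B"
  shows "f = g"
proof -
  define tr where "tr h = (\<Sum>b\<in>UNIV. h (axis b 1) $ b)" for h :: "cvec4 \<Rightarrow> cvec4"
  have *: "f v + ((1 / 2) * tr f) *s v = g v + ((1 / 2) * tr g) *s v" for v
    using lower_cong[of "biv_der f" "biv_der g"] eq lower_biv_der[OF f] lower_biv_der[OF g]
    by (simp add: tr_def)
  \<comment> \<open>In dimension 4 the scalar map \<open>1/2 tr h\<close> has trace
    \<open>2 tr h\<close>, whence the total 3.\<close>
  have t: "(\<Sum>b\<in>UNIV. (h (axis b 1) + ((1 / 2) * tr h) *s axis b 1) $ b) = 3 * tr h" for h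
    by (simp add: sum.distrib tr_def axis_def)
  have "3 * tr f = 3 * tr g"
    unfolding t[symmetric] by (simp only: *)
  then show ?thesis using * by (simp add: fun_eq_iff)
qed

lemma biv_j_add: "biv_j (A + B) = biv_j A + biv_j B"
  by (simp add: biv_j_def vec.scale_left_distrib sum.distrib vec.scale_right_distrib)

lemma biv_j_scale: "biv_j (k *s B) = cnj k *s biv_j B"
  by (simp add: biv_j_def vec.scale_sum_right mult_ac)

lemma biv_j_in_bivectors: "biv_j B \<in> bivectors"
  unfolding biv_j_def
  by (intro vec.subspace_scale[OF subspace_bivectors] vec.subspace_sum[OF subspace_bivectors]
      wedge_in_bivectors)

lemma biv_j_biv_j: "B \<in> bivectors \<Longrightarrow> biv_j (biv_j B) = B"
  by (induction rule: bivectors_induct)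
    (simp_all add: biv_j_wedge biv_j_add biv_j_scale wedge_bilin)

lemma biv_der_biv_j:
  assumes f: "clinear_on UNIV f" and B: "B \<in> bivectors" and comm: "\<And>v. f (jj v) = jj (f v)"
  shows "biv_der f (biv_j B) = biv_j (biv_der f B)"
  using B
  by (induction rule: bivectors_induct)
    (simp_all add: biv_j_wedge biv_j_add biv_j_scale f comm biv_der_wedge
      clinear_add[OF clinear_biv_der] clinear_scale[OF clinear_biv_der])

text \<open>The conjugate of \<open>f\<close> by \<open>jj\<close> is again complex linear, and its
  derivation is that of \<open>f\<close> conjugated by \<open>biv_j\<close>. The hypothesis
  identifies the two derivations, and injectivity of \<open>biv_der\<close> identifies the
  maps.\<close>

lemma jj_commute_if_biv_der:
  assumes f: "clinear_on UNIV f"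
    and comm: "\<And>B. B \<in> bivectors \<Longrightarrow> biv_der f (biv_j B) = biv_j (biv_der f B)"
  shows "f (jj v) = jj (f v)"
proof -
  \<comment> \<open>The inverse of \<open>jj\<close> is \<open>- jj\<close>.\<close>
  define g where "g v = - jj (f (jj v))" for v
  have g: "clinear_on UNIV g"
    by (rule clinearI) (simp_all add: g_def jj_add jj_scale f clinear_add clinear_scale)
  have bg: "biv_der g (wedge v w) = - wedge (jj (f (jj v))) w - wedge v (jj (f (jj w)))" for v w
    by (simp only: biv_der_wedge[OF g]) (simp add: g_def wedge_bilin)
  have "biv_der g B = biv_der f B" if "B \<in> bivectors" for B
  proof -
    have "biv_der g B = biv_j (biv_der f (biv_j B))"
      using that
      by (induction rule: bivectors_induct)
        (simp_all add: biv_j_wedge biv_j_add biv_j_scale f biv_der_wedge bg wedge_bilin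
          clinear_add[OF clinear_biv_der] clinear_scale[OF clinear_biv_der])
    then show ?thesis using comm[OF that] biv_j_biv_j biv_der_in_bivectors by simp
  qed
  then have "g = f" by (intro biv_der_inject[OF g f])
  then have "jj (f v) = jj (- jj (f (jj v)))" by (metis g_def)
  then show ?thesis by (simp add: jj_neg)
qed

section \<open>The metric on bivectors\<close>

locale qdet =
  fixes dt :: "cvec4 \<Rightarrow> cvec4 \<Rightarrow> cvec4 \<Rightarrow> cvec4 \<Rightarrow> complex"
  assumes qdet: "quaternionic_det dt"
begin

lemma dt_add:
  "dt (x + y) b c d = dt x b c d + dt y b c d"
  "dt a (x + y) c d = dt a x c d + dt a y c d"
  "dt a b (x + y) d = dt a b x d + dt a b y d"
  "dt a b c (x + y) = dt a b c x + dt a b c y"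
  and dt_scale:
  "dt (k *s x) b c d = k * dt x b c d"
  "dt a (k *s x) c d = k * dt a x c d"
  "dt a b (k *s x) d = k * dt a b x d"
  "dt a b c (k *s x) = k * dt a b c x"
proof -
  have lin: "Vector_Spaces.linear (*s) (*) (\<lambda>a. dt a b c d)"
    "Vector_Spaces.linear (*s) (*) (\<lambda>b. dt a b c d)"
    "Vector_Spaces.linear (*s) (*) (\<lambda>c. dt a b c d)"
    "Vector_Spaces.linear (*s) (*) (\<lambda>d. dt a b c d)" for a b c d
    using qdet by (auto simp: quaternionic_det_def)
  have gen: "f (x + y) = f x + f y \<and> f (k *s x) = k * f x"
    if "Vector_Spaces.linear (*s) (*) f" for f :: "cvec4 \<Rightarrow> complex"
  proof -
    interpret f: Vector_Spaces.linear "(*s)" "(*)" f by (rule that)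
    show ?thesis by (simp add: f.add f.scale)
  qed
  show "dt (x + y) b c d = dt x b c d + dt y b c d" "dt a (x + y) c d = dt a x c d + dt a y c d"
    "dt a b (x + y) d = dt a b x d + dt a b y d" "dt a b c (x + y) = dt a b c x + dt a b c y"
    "dt (k *s x) b c d = k * dt x b c d" "dt a (k *s x) c d = k * dt a x c d"
    "dt a b (k *s x) d = k * dt a b x d" "dt a b c (k *s x) = k * dt a b c x"
    using gen[OF lin(1)] gen[OF lin(2)] gen[OF lin(3)] gen[OF lin(4)] by blast+
qed

lemma dt_alt: "dt a a b c = 0" "dt a b b c = 0" "dt a b c c = 0"
  using qdet by (auto simp: quaternionic_det_def)

lemma dt_swap: "dt b a c d = - dt a b c d" "dt a c b d = - dt a b c d" "dt a b d c = - dt a b c d"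
proof -
  have "dt (a + b) (a + b) c d = dt a b c d + dt b a c d"
    "dt a (b + c) (b + c) d = dt a b c d + dt a c b d"
    "dt a b (c + d) (c + d) = dt a b c d + dt a b d c"
    unfolding dt_add by (simp_all add: dt_alt)
  then show "dt b a c d = - dt a b c d" "dt a c b d = - dt a b c d" "dt a b d c = - dt a b c d"
    unfolding dt_alt by (simp_all add: eq_neg_iff_add_eq_0 add.commute)
qed

lemma dt_alt': "dt a b a c = 0" "dt a b c a = 0" "dt a b c b = 0"
  using dt_swap(2)[of a a b c] dt_swap(3)[of a b a c] dt_swap(3)[of a b b c]
  by (simp_all add: dt_alt)

lemma dt_pair_swap: "dt c d a b = dt a b c d"
  using dt_swap(2)[of a c b d] dt_swap(1)[of a c b d] dt_swap(3)[of c a b d] dt_swap(2)[of c a d b]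
  by simp

lemma biv_form_add_left: "biv_form dt (A + A') B = biv_form dt A B + biv_form dt A' B"
  and biv_form_add_right: "biv_form dt A (B + B') = biv_form dt A B + biv_form dt A B'"
  by (simp_all add: biv_form_def distrib_left distrib_right sum.distrib)

lemma biv_form_scale_left: "biv_form dt (k *s A) B = k * biv_form dt A B"
  and biv_form_scale_right: "biv_form dt A (k *s B) = k * biv_form dt A B"
  by (simp_all add: biv_form_def sum_distrib_left mult_ac)

lemma biv_form_diff_left: "biv_form dt (A - A') B = biv_form dt A B - biv_form dt A' B"
  and biv_form_diff_right: "biv_form dt A (B - B') = biv_form dt A B - biv_form dt A B'"
  by (simp_all add: biv_form_def left_diff_distrib right_diff_distrib sum_subtractf)

lemma biv_form_zero [simp]: "biv_form dt 0 B = 0" "biv_form dt A 0 = 0"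
  by (simp_all add: biv_form_def)

lemmas biv_form_bilin = biv_form_add_left biv_form_add_right biv_form_scale_left biv_form_scale_right
  biv_form_diff_left biv_form_diff_right

lemmas biv_form_wedge = biv_form_wedge[OF qdet]

text \<open>Exchanging two pairs of arguments of the determinant is an even permutation.\<close>

lemma biv_form_commute:
  assumes "A \<in> bivectors" "B \<in> bivectors"
  shows "biv_form dt A B = biv_form dt B A"
  using assms(1)
proof (induction rule: bivectors_induct)
  case (wedge v w)
  show ?case
    using assms(2)
    by (induction rule: bivectors_induct) (simp_all add: biv_form_bilin biv_form_wedge dt_pair_swap)
qed (simp_all add: biv_form_bilin)

lemma clinear_skew_op: "clinear_on UNIV (skew_op dt A B)"
  by (rule clinearI)
    (simp_all add: skew_op_def biv_form_bilin vec_eq_iff algebra_simps)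

end

subsection \<open>Adapted frames\<close>

lemma span_pair: "x \<in> vec.span {p, q} \<longleftrightarrow> (\<exists>k l. x = k *s p + l *s q)"
  by (auto simp: vec.span_breakdown_eq algebra_simps)

lemma span_triple: "x \<in> vec.span {p, q, r} \<longleftrightarrow> (\<exists>k l m. x = k *s p + l *s q + m *s r)"
  by (auto simp: vec.span_breakdown_eq algebra_simps)

lemma clinear_comp: "clinear_on UNIV f \<Longrightarrow> clinear_on UNIV g \<Longrightarrow> clinear_on UNIV (\<lambda>v. f (g v))"
  by (rule clinearI) (simp_all add: clinear_add clinear_scale)

lemma ext2_span_pair:
  assumes "A \<in> ext2 (vec.span {p, q})"
  obtains k where "A = k *s wedge p q"
proof -
  obtain v w where A: "A = wedge v w" and "v \<in> vec.span {p, q}" "w \<in> vec.span {p, q}"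
    using assms by (auto simp: ext2_def)
  then obtain k l m n where v: "v = k *s p + l *s q" and w: "w = m *s p + n *s q"
    by (auto simp: span_pair)
  have "A = (k * n - l * m) *s wedge p q"
    unfolding A v w wedge_bilin by (simp add: wedge_swap[of q p] vec_eq_iff algebra_simps)
  then show thesis by (rule that)
qed

lemma clinear_span_mem:
  assumes f: "clinear_on UNIV f" and M: "vec.subspace M" and X: "\<And>x. x \<in> X \<Longrightarrow> f x \<in> M"
    and B: "B \<in> vec.span X"
  shows "f B \<in> M"
proof -
  have "vec.subspace {x. f x \<in> M}"
    by (rule vec.subspaceI)
      (simp_all add: f clinear_zero clinear_add clinear_scale vec.subspace_0[OF M]
        vec.subspace_add[OF M] vec.subspace_scale[OF M])
  then show ?thesis using vec.span_minimal[of X "{x. f x \<in> M}"] X B by blast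
qed

text \<open>Linear algebra at one point: \<open>a\<close>, \<open>c\<close> and \<open>T\<close>
  stand for the values of \<alpha>, \<open>d_zbar \<alpha>\<close> and the mean curvature sphere.
  Since \<open>jj\<close> is antilinear and commutes with \<open>T\<close>, the vectors
  \<open>jj a\<close> and \<open>jj c\<close> have eigenvalue \<open>- \<i>\<close>.\<close>

locale adapted_frame = qdet +
  fixes a c :: cvec4 and T :: "cvec4 \<Rightarrow> cvec4"
  assumes T_clinear: "clinear_on UNIV T" and T_jj: "T (jj w) = jj (T w)"
    and T_a: "T a = \<i> *s a" and T_c: "T c = \<i> *s c"
    and a_nonzero: "a \<noteq> 0" and c_notin: "c \<notin> vec.span {a, jj a}"
begin

lemma T_ja: "T (jj a) = (- \<i>) *s jj a" and T_jc: "T (jj c) = (- \<i>) *s jj c"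
  by (simp_all only: T_jj T_a T_c jj_scale complex_cnj_i)

lemma jj_span: "v \<in> vec.span {a, jj a} \<Longrightarrow> jj v \<in> vec.span {a, jj a}"
  unfolding span_pair
proof (elim exE)
  fix k l assume "v = k *s a + l *s jj a"
  then have "jj v = (- cnj l) *s a + cnj k *s jj a" by (simp add: jj_add jj_scale)
  then show "\<exists>k l. jj v = k *s a + l *s jj a" by blast
qed

text \<open>Quaternionic independence in two stages: a nonzero quaternion times \<open>c\<close> in
  the plane of \<open>a\<close> would put \<open>c\<close> there, and a nonzero quaternion times
  \<open>a\<close> cannot vanish.\<close>

lemma frame_coeffs_zero:
  assumes "x *s a + y *s jj a + z *s c + w *s jj c = 0"
  shows "x = 0" "y = 0" "z = 0" "w = 0"
proof -
  have "z = 0 \<and> w = 0"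
  proof (rule ccontr)
    assume "\<not> (z = 0 \<and> w = 0)"
    moreover have "z *s c + w *s jj c = (- x) *s a + (- y) *s jj a"
      using assms by (simp add: eq_neg_iff_add_eq_0 algebra_simps)
    then have "z *s c + w *s jj c \<in> vec.span {a, jj a}" unfolding span_pair by blast
    ultimately have "c \<in> vec.span {a, jj a}"
      using quaternionic_line_cancel[of "vec.span {a, jj a}" z c w] jj_span by auto
    then show False using c_notin by blast
  qed
  then show "z = 0" "w = 0" by auto
  have "x *s a + y *s jj a \<in> {0}" using assms \<open>z = 0 \<and> w = 0\<close> by simp
  then have "x = 0 \<and> y = 0"
    using quaternionic_line_cancel[of "{0}" x a y] a_nonzero by (auto simp: vec.subspace_single_0)
  then show "x = 0" "y = 0" by auto
qed

lemma frame_coeffs_unique: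
  assumes "x *s a + y *s jj a + z *s c + w *s jj c = x' *s a + y' *s jj a + z' *s c + w' *s jj c"
  shows "x = x'" "y = y'" "z = z'" "w = w'"
proof -
  have "(x - x') *s a + (y - y') *s jj a + (z - z') *s c + (w - w') *s jj c = 0"
    using assms by (simp add: vec.scale_left_diff_distrib algebra_simps)
  from frame_coeffs_zero[OF this] show "x = x'" "y = y'" "z = z'" "w = w'" by simp_all
qed

lemma frame_distinct: "distinct [a, c, jj a, jj c]"
proof -
  have "a \<noteq> c" using frame_coeffs_unique(1)[of 1 0 0 0 0 0 1 0] by auto
  moreover have "a \<noteq> jj a" using frame_coeffs_unique(1)[of 1 0 0 0 0 1 0 0] by auto
  moreover have "a \<noteq> jj c" using frame_coeffs_unique(1)[of 1 0 0 0 0 0 0 1] by auto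
  moreover have "c \<noteq> jj a" using frame_coeffs_unique(3)[of 0 0 1 0 0 1 0 0] by auto
  moreover have "c \<noteq> jj c" using frame_coeffs_unique(3)[of 0 0 1 0 0 0 0 1] by auto
  moreover have "jj a \<noteq> jj c" using frame_coeffs_unique(2)[of 0 1 0 0 0 0 0 1] by auto
  ultimately show ?thesis by auto
qed

lemma frame_independent: "vec.independent {a, c, jj a, jj c}"
proof (rule vec.independent_if_scalars_zero)
  fix f x assume s: "(\<Sum>x\<in>{a, c, jj a, jj c}. f x *s x) = 0" and x: "x \<in> {a, c, jj a, jj c}"
  have "f a *s a + f (jj a) *s jj a + f c *s c + f (jj c) *s jj c = 0"
    using s frame_distinct by (simp add: add_ac)
  from frame_coeffs_zero[OF this] show "f x = 0" using x by auto
qed simp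

lemma frame_span: "v \<in> vec.span {a, c, jj a, jj c}"
proof -
  have "card {a, c, jj a, jj c} = 4" using frame_distinct by simp
  then have "UNIV \<subseteq> vec.span {a, c, jj a, jj c}"
    using frame_independent by (intro vec.card_ge_dim_independent) (simp_all add: card_cart_basis)
  then show ?thesis by blast
qed

lemma frame_coords: "\<exists>x y z w. v = x *s a + y *s jj a + z *s c + w *s jj c"
proof -
  have "\<exists>x z y w. v = x *s a + z *s c + y *s jj a + w *s jj c"
    using frame_span[of v] by (auto simp: vec.span_breakdown_eq algebra_simps)
  then obtain x z y w where "v = x *s a + z *s c + y *s jj a + w *s jj c" by blast
  then have "v = x *s a + y *s jj a + z *s c + w *s jj c" by (simp add: add_ac)
  then show ?thesis by blast
qed

lemma eq_on_frame:
  assumes "clinear_on UNIV f" "clinear_on UNIV g"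
    and "f a = g a" "f c = g c" "f (jj a) = g (jj a)" "f (jj c) = g (jj c)"
  shows "f v = g v"
proof (rule clinear_eq_on_span[OF assms(1,2) _ frame_span])
  fix x assume "x \<in> {a, c, jj a, jj c}"
  then show "f x = g x" by (elim insertE emptyE; hypsubst; intro assms)
qed

text \<open>The scale of the metric in the frame; only its not vanishing matters. The positivity
  axiom speaks of the ordering \<open>a\<close>, \<open>c\<close>, \<open>jj a\<close>,
  \<open>jj c\<close>, one transposition away, so \<open>vol\<close> is in fact negative.\<close>

definition vol :: complex where "vol = dt a (jj a) c (jj c)"

lemma vol_nonzero: "vol \<noteq> 0"
proof -
  have "\<exists>r>0. dt a c (jj a) (jj c) = complex_of_real r"
    using qdet frame_distinct frame_independent unfolding quaternionic_det_def by blast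
  then have "dt a c (jj a) (jj c) \<noteq> 0" by auto
  then show ?thesis using dt_swap(2)[of a "jj a" c "jj c"] by (simp add: vol_def)
qed

lemma dt_frame:
  "dt a (jj a) c (jj c) = vol" "dt c (jj c) a (jj a) = vol"
  "dt a (jj c) c (jj a) = - vol" "dt c (jj a) a (jj c) = - vol"
  "dt a c (jj a) (jj c) = - vol" "dt (jj a) (jj c) a c = - vol"
proof -
  show 1: "dt a (jj a) c (jj c) = vol" by (simp add: vol_def)
  then show "dt c (jj c) a (jj a) = vol" by (simp add: dt_pair_swap[of c "jj c"])
  show "dt a (jj c) c (jj a) = - vol"
    using 1 dt_swap(3)[of a "jj c" c "jj a"] dt_swap(2)[of a "jj c" "jj a" c]
      dt_swap(3)[of a "jj a" "jj c" c] by simp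
  then show "dt c (jj a) a (jj c) = - vol" by (simp add: dt_pair_swap[of c "jj a"])
  show 2: "dt a c (jj a) (jj c) = - vol"
    using 1 dt_swap(2)[of a c "jj a" "jj c"] by simp
  then show "dt (jj a) (jj c) a c = - vol" by (simp add: dt_pair_swap[of "jj a" "jj c"])
qed

text \<open>The eigenspace of \<open>\<and>\<^sup>2T\<close> for 1: each generator pairs an
  eigenvector for \<open>\<i>\<close> with one for \<open>- \<i>\<close>. In \<open>Vminus\<close>
  the two eigenvalues agree and their product is -1.\<close>

definition Vplus :: "bivec set" where
  "Vplus = vec.span {wedge a (jj a), wedge a (jj c), wedge c (jj a), wedge c (jj c)}"

definition Vminus :: "bivec set" where
  "Vminus = vec.span {wedge a c, wedge (jj a) (jj c)}"

definition frame_bivectors :: "bivec set" where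
  "frame_bivectors = {wedge a (jj a), wedge a (jj c), wedge c (jj a), wedge c (jj c),
     wedge a c, wedge (jj a) (jj c)}"

lemma wedge_swap_frame:
  "wedge (jj a) a = - wedge a (jj a)" "wedge (jj c) a = - wedge a (jj c)"
  "wedge (jj a) c = - wedge c (jj a)" "wedge (jj c) c = - wedge c (jj c)"
  "wedge c a = - wedge a c" "wedge (jj c) (jj a) = - wedge (jj a) (jj c)"
  by (rule wedge_swap)+

lemma wedge_in_frame_span: "wedge v w \<in> vec.span frame_bivectors"
proof -
  obtain x y z t where v: "v = x *s a + y *s jj a + z *s c + t *s jj c" using frame_coords by blast
  obtain x' y' z' t' where w: "w = x' *s a + y' *s jj a + z' *s c + t' *s jj c"
    using frame_coords by blast
  have base: "wedge a (jj a) \<in> vec.span frame_bivectors" "wedge a (jj c) \<in> vec.span frame_bivectors"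
    "wedge c (jj a) \<in> vec.span frame_bivectors" "wedge c (jj c) \<in> vec.span frame_bivectors"
    "wedge a c \<in> vec.span frame_bivectors" "wedge (jj a) (jj c) \<in> vec.span frame_bivectors"
    by (rule vec.span_base, simp add: frame_bivectors_def)+
  have mem: "wedge p q \<in> vec.span frame_bivectors" if "p \<in> {a, jj a, c, jj c}" "q \<in> {a, jj a, c, jj c}" for p q
    using that by (auto simp: wedge_swap_frame base vec.span_neg vec.span_zero)
  show ?thesis
    unfolding v w wedge_add_left wedge_add_right wedge_scale_left wedge_scale_right
    by (intro vec.span_add vec.span_scale mem) auto
qed

lemma bivectors_eq_frame_span: "bivectors = vec.span frame_bivectors"
proof
  show "bivectors \<subseteq> vec.span frame_bivectors"
    unfolding bivectors_eq_span by (rule vec.span_minimal) (auto intro: wedge_in_frame_span)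
  show "vec.span frame_bivectors \<subseteq> bivectors"
    by (rule vec.span_minimal) (auto simp: frame_bivectors_def intro: subspace_bivectors)
qed

lemma eq_on_frame_bivectors:
  assumes "clinear_on UNIV f" "clinear_on UNIV g"
    and "\<And>B. B \<in> frame_bivectors \<Longrightarrow> f B = g B" and "B \<in> bivectors"
  shows "f B = g B"
  by (rule clinear_eq_on_span[OF assms(1,2,3)]) (use assms(4) in \<open>simp_all add: bivectors_eq_frame_span\<close>)

lemma Vplus_bivectors: "Vplus \<subseteq> bivectors" and Vminus_bivectors: "Vminus \<subseteq> bivectors"
  unfolding Vplus_def Vminus_def by (rule vec.span_minimal[OF _ subspace_bivectors]; simp)+

lemma biv_map_frame:
  "biv_map T (wedge a (jj a)) = wedge a (jj a)" "biv_map T (wedge a (jj c)) = wedge a (jj c)"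
  "biv_map T (wedge c (jj a)) = wedge c (jj a)" "biv_map T (wedge c (jj c)) = wedge c (jj c)"
  "biv_map T (wedge a c) = - wedge a c" "biv_map T (wedge (jj a) (jj c)) = - wedge (jj a) (jj c)"
  by (simp_all add: biv_map_wedge T_clinear T_a T_c T_ja T_jc wedge_bilin)

text \<open>Spectral projections of the involution \<open>biv_map T\<close>; linearity reduces the
  claim to the six frame bivectors, which are all eigenvectors.\<close>

lemma decompose:
  assumes "B \<in> bivectors"
  shows "(1 / 2) *s (B + biv_map T B) \<in> Vplus" "(1 / 2) *s (B - biv_map T B) \<in> Vminus"
proof -
  note lins = clinear_add[OF clinear_biv_map] clinear_scale[OF clinear_biv_map]
  have half: "(1 / 2) *s (B + B) = B" for B :: bivec by (simp add: vec_eq_iff)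
  have B: "B \<in> vec.span frame_bivectors" using assms by (simp add: bivectors_eq_frame_span)
  show "(1 / 2) *s (B + biv_map T B) \<in> Vplus"
  proof (rule clinear_span_mem[OF _ _ _ B])
    show "clinear_on UNIV (\<lambda>B. (1 / 2) *s (B + biv_map T B))"
      by (rule clinearI) (simp_all add: lins vec_eq_iff algebra_simps)
    fix B assume "B \<in> frame_bivectors"
    then show "(1 / 2) *s (B + biv_map T B) \<in> Vplus"
      unfolding frame_bivectors_def Vplus_def
      by (elim insertE emptyE; hypsubst; unfold biv_map_frame half)
        (simp_all add: vec.span_base vec.span_zero)
  qed (simp add: Vplus_def)
  show "(1 / 2) *s (B - biv_map T B) \<in> Vminus"
  proof (rule clinear_span_mem[OF _ _ _ B])
    show "clinear_on UNIV (\<lambda>B. (1 / 2) *s (B - biv_map T B))"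
      by (rule clinearI) (simp_all add: lins vec_eq_iff algebra_simps)
    fix B assume "B \<in> frame_bivectors"
    then show "(1 / 2) *s (B - biv_map T B) \<in> Vminus"
      unfolding frame_bivectors_def Vminus_def
      by (elim insertE emptyE; hypsubst; unfold biv_map_frame diff_minus_eq_add half)
        (simp_all add: vec.span_base vec.span_zero)
  qed (simp add: Vminus_def)
qed

text \<open>Each frame bivector pairs nontrivially with exactly one other, the one made of the two
  remaining vectors. Testing against that partner isolates its coefficient.\<close>

lemma biv_form_nondegenerate:
  assumes A: "A \<in> bivectors" and orth: "\<And>B. B \<in> bivectors \<Longrightarrow> biv_form dt A B = 0"
  shows "A = 0"
proof -
  have "A \<in> vec.span frame_bivectors" using A by (simp add: bivectors_eq_frame_span)
  then obtain x1 x2 x3 x4 x5 x6 where A: "A - x1 *s wedge a (jj a) - x2 *s wedge a (jj c)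
    - x3 *s wedge c (jj a) - x4 *s wedge c (jj c) - x5 *s wedge a c - x6 *s wedge (jj a) (jj c) = 0"
    unfolding frame_bivectors_def vec.span_breakdown_eq by auto
  then have A': "A = x1 *s wedge a (jj a) + x2 *s wedge a (jj c) + x3 *s wedge c (jj a)
    + x4 *s wedge c (jj c) + x5 *s wedge a c + x6 *s wedge (jj a) (jj c)"
    by (simp add: algebra_simps)
  have "biv_form dt A (wedge c (jj c)) = 0" "biv_form dt A (wedge c (jj a)) = 0"
    "biv_form dt A (wedge a (jj c)) = 0" "biv_form dt A (wedge a (jj a)) = 0"
    "biv_form dt A (wedge (jj a) (jj c)) = 0" "biv_form dt A (wedge a c) = 0"
    by (simp_all add: orth)
  then have "x1 = 0" "x2 = 0" "x3 = 0" "x4 = 0" "x5 = 0" "x6 = 0"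
    unfolding A' biv_form_bilin biv_form_wedge by (simp_all add: dt_frame dt_alt dt_alt' vol_nonzero)
  then show ?thesis by (simp add: A')
qed

text \<open>Every pairing of a generator of one space with a generator of the other repeats a frame
  vector in the determinant.\<close>

lemma Vplus_orthogonal_Vminus:
  assumes "A \<in> Vplus" "B \<in> Vminus"
  shows "biv_form dt A B = 0"
proof -
  obtain x1 x2 x3 x4 where "A - x1 *s wedge a (jj a) - x2 *s wedge a (jj c)
    - x3 *s wedge c (jj a) - x4 *s wedge c (jj c) = 0"
    using assms(1) unfolding Vplus_def vec.span_breakdown_eq by auto
  then have A: "A = x1 *s wedge a (jj a) + x2 *s wedge a (jj c) + x3 *s wedge c (jj a)
    + x4 *s wedge c (jj c)"
    by (simp add: algebra_simps)
  obtain x5 x6 where B: "B = x5 *s wedge a c + x6 *s wedge (jj a) (jj c)"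
    using assms(2) unfolding Vminus_def span_pair by auto
  show ?thesis
    unfolding A B biv_form_bilin biv_form_wedge by (simp add: dt_alt dt_alt')
qed

lemma decompose_sum: "(1 / 2) *s (B + biv_map T B) + (1 / 2) *s (B - biv_map T B) = (B :: bivec)"
  by (simp add: vec_eq_iff algebra_simps)

lemma orthogonal_both_zero:
  assumes "A \<in> bivectors" "\<And>B. B \<in> Vplus \<Longrightarrow> biv_form dt A B = 0"
    "\<And>B. B \<in> Vminus \<Longrightarrow> biv_form dt A B = 0"
  shows "A = 0"
proof (rule biv_form_nondegenerate[OF assms(1)])
  fix B assume "B \<in> bivectors"
  then have "biv_form dt A ((1 / 2) *s (B + biv_map T B) + (1 / 2) *s (B - biv_map T B)) = 0"
    unfolding biv_form_add_right using decompose assms(2,3) by simp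
  then show "biv_form dt A B = 0" by (simp only: decompose_sum)
qed

lemma Vminus_le_perp: "Vminus \<subseteq> biv_perp dt Vplus"
  using Vplus_orthogonal_Vminus Vminus_bivectors by (auto simp: biv_perp_def)

lemma Vplus_le_perp_perp: "Vplus \<subseteq> biv_perp dt (biv_perp dt Vplus)"
  using Vplus_bivectors biv_form_commute by (fastforce simp: biv_perp_def)

lemma subspace_biv_perp: "vec.subspace (biv_perp dt V)"
  by (rule vec.subspaceI)
    (auto simp: biv_perp_def biv_form_bilin intro: vec.subspace_add vec.subspace_scale
      vec.subspace_0 subspace_bivectors)

text \<open>\<open>biv_proj\<close> is a definite description, so uniqueness is the point: the
  difference of two candidates is orthogonal to both \<open>Vplus\<close> and \<open>Vminus\<close>,
  hence zero. For this the inclusions of \<open>Vminus\<close> in the complement and of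
  \<open>Vplus\<close> in the double complement suffice.\<close>

lemma biv_proj_sum:
  assumes p: "p \<in> Vplus" and m: "m \<in> Vminus"
  shows "biv_proj dt Vplus (p + m) = p" "biv_proj dt (biv_perp dt Vplus) (p + m) = m"
proof -
  have zero: "e = 0" if "e \<in> bivectors" "\<And>B. B \<in> Vplus \<Longrightarrow> biv_form dt B e = 0"
    "\<And>B. B \<in> Vminus \<Longrightarrow> biv_form dt B e = 0" for e
    using that biv_form_commute[OF that(1)] Vplus_bivectors Vminus_bivectors
    by (intro orthogonal_both_zero) auto
  show "biv_proj dt Vplus (p + m) = p"
    unfolding biv_proj_def
  proof (rule the_equality)
    show "p \<in> Vplus \<and> p + m - p \<in> biv_perp dt Vplus" using p m Vminus_le_perp by auto
    fix v assume v: "v \<in> Vplus \<and> p + m - v \<in> biv_perp dt Vplus"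
    have e1: "v - p \<in> Vplus" using v p by (auto simp: Vplus_def intro: vec.span_diff)
    have "m - (p + m - v) \<in> biv_perp dt Vplus"
      by (rule vec.subspace_diff[OF subspace_biv_perp]) (use v m Vminus_le_perp in auto)
    then have e2: "v - p \<in> biv_perp dt Vplus" by simp
    have "v - p = 0"
    proof (rule zero)
      show e: "v - p \<in> bivectors" using e1 Vplus_bivectors by blast
      show "biv_form dt B (v - p) = 0" if "B \<in> Vplus" for B
        using e2 that by (simp add: biv_perp_def)
      show "biv_form dt B (v - p) = 0" if "B \<in> Vminus" for B
        using Vplus_orthogonal_Vminus[OF e1 that] biv_form_commute[OF e] that Vminus_bivectors by auto
    qed
    then show "v = p" by simp
  qed
  show "biv_proj dt (biv_perp dt Vplus) (p + m) = m"
    unfolding biv_proj_def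
  proof (rule the_equality)
    show "m \<in> biv_perp dt Vplus \<and> p + m - m \<in> biv_perp dt (biv_perp dt Vplus)"
      using p m Vminus_le_perp Vplus_le_perp_perp by auto
    fix v assume v: "v \<in> biv_perp dt Vplus \<and> p + m - v \<in> biv_perp dt (biv_perp dt Vplus)"
    have e1: "v - m \<in> biv_perp dt Vplus"
      by (rule vec.subspace_diff[OF subspace_biv_perp]) (use v m Vminus_le_perp in auto)
    have "p - (p + m - v) \<in> biv_perp dt (biv_perp dt Vplus)"
      by (rule vec.subspace_diff[OF subspace_biv_perp]) (use v p Vplus_le_perp_perp in auto)
    then have e2: "v - m \<in> biv_perp dt (biv_perp dt Vplus)" by simp
    have "v - m = 0"
    proof (rule zero)
      show "v - m \<in> bivectors" using e1 by (simp add: biv_perp_def)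
      show "biv_form dt B (v - m) = 0" if "B \<in> Vplus" for B
        using e1 that by (simp add: biv_perp_def)
      show "biv_form dt B (v - m) = 0" if "B \<in> Vminus" for B
        using e2 that Vminus_le_perp by (auto simp: biv_perp_def)
    qed
    then show "v = m" by simp
  qed
qed

lemma biv_proj_Vplus: "B \<in> bivectors \<Longrightarrow> biv_proj dt Vplus B = (1 / 2) *s (B + biv_map T B)"
  and biv_proj_perp_Vplus:
    "B \<in> bivectors \<Longrightarrow> biv_proj dt (biv_perp dt Vplus) B = (1 / 2) *s (B - biv_map T B)"
  using biv_proj_sum[OF decompose, of B B] by (simp_all only: decompose_sum)

text \<open>Comparison on the six frame bivectors. The factor \<open>vol\<close> enters because
  \<open>wedge c (jj c)\<close> pairs with \<open>wedge a (jj a)\<close> to \<open>vol\<close>,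
  while the derivation sends it to \<open>q c \<and> jj c + c \<and> q (jj c)\<close>.\<close>

lemma skew_op_eq_biv_der:
  assumes q: "clinear_on UNIV q" "q a = 0" "q (jj a) = 0"
    "q c = (x * vol) *s a" "q (jj c) = (y * vol) *s jj a"
    and B: "B \<in> bivectors"
  shows "skew_op dt (wedge a (jj a)) (x *s wedge a (jj c) + y *s wedge c (jj a)) B = biv_der q B"
proof (rule eq_on_frame_bivectors[OF clinear_skew_op clinear_biv_der _ B])
  fix B assume "B \<in> frame_bivectors"
  then show "skew_op dt (wedge a (jj a)) (x *s wedge a (jj c) + y *s wedge c (jj a)) B = biv_der q B"
    unfolding frame_bivectors_def
    by (elim insertE emptyE; hypsubst;
        simp add: skew_op_def biv_form_bilin biv_form_wedge biv_der_wedge q dt_frame dt_alt dt_alt'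
          dt_pair_swap[of c "jj c"] wedge_bilin vec_eq_iff algebra_simps)
qed

text \<open>Commuting with \<open>T\<close>, the map \<open>q\<close> respects eigenvalues:
  \<open>c\<close> goes to a multiple of \<open>a\<close>, and \<open>jj c\<close> to a multiple of
  \<open>jj a\<close>. These two multiples are the two coefficients available in
  \<open>skew_op_eq_biv_der\<close>.\<close>

lemma nilpotent_imp_skew_op:
  assumes q: "clinear_on UNIV q" "\<And>v. v \<in> vec.span {a, jj a} \<Longrightarrow> q v = 0"
    "\<And>v. q v \<in> vec.span {a, jj a}" "\<And>v. T (q v) = q (T v)"
  shows "\<exists>A\<in>ext2 (vec.span {a, jj a}). \<exists>B\<in>vec.span {wedge a (jj a), wedge a (jj c), wedge c (jj a)}.
    \<forall>w\<in>bivectors. biv_der q w = skew_op dt A B w"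
proof -
  have a: "a \<in> vec.span {a, jj a}" "jj a \<in> vec.span {a, jj a}" by (simp_all add: vec.span_base)
  obtain k l where qc: "q c = k *s a + l *s jj a" using q(3) span_pair by blast
  have "l = 0"
  proof -
    have "T (q c) = \<i> *s q c" by (simp add: q(4) T_c clinear_scale[OF q(1)])
    then have "(\<i> * k) *s a + (- (\<i> * l)) *s jj a + 0 *s c + 0 *s jj c =
        (\<i> * k) *s a + (\<i> * l) *s jj a + 0 *s c + 0 *s jj c"
      by (simp add: qc clinear_add[OF T_clinear] clinear_scale[OF T_clinear] T_a T_ja
          vec.scale_right_distrib mult.commute)
    from frame_coeffs_unique(2)[OF this] show ?thesis by simp
  qed
  obtain m n where qd: "q (jj c) = m *s a + n *s jj a" using q(3) span_pair by blast
  have "m = 0"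
  proof -
    have "T (q (jj c)) = (- \<i>) *s q (jj c)" by (simp only: q(4) T_jc clinear_scale[OF q(1)])
    then have "(\<i> * m) *s a + (- (\<i> * n)) *s jj a + 0 *s c + 0 *s jj c =
        (- (\<i> * m)) *s a + (- (\<i> * n)) *s jj a + 0 *s c + 0 *s jj c"
      by (simp add: qd clinear_add[OF T_clinear] clinear_scale[OF T_clinear] T_a T_ja
          vec.scale_right_distrib mult.commute)
    from frame_coeffs_unique(1)[OF this] show ?thesis by simp
  qed
  let ?B = "(k / vol) *s wedge a (jj c) + (n / vol) *s wedge c (jj a)"
  have "\<forall>w\<in>bivectors. biv_der q w = skew_op dt (wedge a (jj a)) ?B w"
    using skew_op_eq_biv_der[OF q(1), of "k / vol" "n / vol"] q(2)[OF a(1)] q(2)[OF a(2)] qc qd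
      \<open>l = 0\<close> \<open>m = 0\<close> vol_nonzero by simp
  moreover have "wedge a (jj a) \<in> ext2 (vec.span {a, jj a})" using a by (auto simp: ext2_def)
  moreover have "?B \<in> vec.span {wedge a (jj a), wedge a (jj c), wedge c (jj a)}"
    by (intro vec.span_add vec.span_scale vec.span_base) auto
  ultimately show ?thesis by blast
qed

text \<open>Contraction of a slot with the basis, as it occurs in the trace of a map that is a
  determinant times a fixed vector.\<close>

lemma dt_expand:
  "(\<Sum>b\<in>UNIV. dt p q (axis b 1) r * v $ b) = dt p q v r"
  "(\<Sum>b\<in>UNIV. dt p q r (axis b 1) * v $ b) = dt p q r v"
proof -
  have gen: "(\<Sum>b\<in>UNIV. f (axis b 1) * v $ b) = f v"
    if "\<And>v w. f (v + w) = f v + f w" "\<And>k v. f (k *s v) = k * f v" for f :: "cvec4 \<Rightarrow> complex"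
  proof -
    have f0: "f 0 = 0" using that(2)[of 0 0] by simp
    have "f (\<Sum>b\<in>I. v $ b *s axis b 1) = (\<Sum>b\<in>I. f (axis b 1) * v $ b)" for I
      by (induction I rule: infinite_finite_induct) (simp_all add: that f0 mult.commute)
    from this[of UNIV] show ?thesis by (simp add: basis_expansion)
  qed
  show "(\<Sum>b\<in>UNIV. dt p q (axis b 1) r * v $ b) = dt p q v r"
    "(\<Sum>b\<in>UNIV. dt p q r (axis b 1) * v $ b) = dt p q r v"
    by (rule gen; simp add: dt_add dt_scale)+
qed

text \<open>The converse of \<open>nilpotent_imp_skew_op\<close>, with \<open>q\<close> identified
  as \<open>lower\<close> of the given operator and thus independent of the frame.\<close>

lemma skew_op_imp_nilpotent:
  assumes A: "A \<in> ext2 (vec.span {a, jj a})"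
    and B: "B \<in> vec.span {wedge a (jj a), wedge a (jj c), wedge c (jj a)}"
  shows "\<exists>q. clinear_on UNIV q \<and> (\<forall>v\<in>vec.span {a, jj a}. q v = 0) \<and>
    (\<forall>v. q v \<in> vec.span {a, jj a}) \<and> (\<forall>v. T (q v) = q (T v)) \<and>
    lower (skew_op dt A B) = q \<and> (\<forall>w\<in>bivectors. skew_op dt A B w = biv_der q w)"
proof -
  obtain k where A: "A = k *s wedge a (jj a)" using ext2_span_pair[OF A] by blast
  obtain x0 x y where B: "B = x0 *s wedge a (jj a) + x *s wedge a (jj c) + y *s wedge c (jj a)"
    using B by (auto simp: span_triple)
  \<comment> \<open>The determinants read off the coordinates of \<open>v\<close> along
    \<open>c\<close> and \<open>jj c\<close>, up to the factor \<open>vol\<close>. The coefficient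
    \<open>x0\<close> drops out because \<open>A \<and> A\<close> acts as zero.\<close>
  define q where "q v = (k * x * dt a (jj a) v (jj c)) *s a + (k * y * dt a (jj a) c v) *s jj a" for v
  have q: "clinear_on UNIV q"
    by (rule clinearI) (simp_all add: q_def dt_add dt_scale vec_eq_iff algebra_simps)
  have qv: "q a = 0" "q (jj a) = 0" "q c = (k * x * vol) *s a" "q (jj c) = (k * y * vol) *s jj a"
    by (simp_all add: q_def dt_alt dt_alt' dt_frame)
  have sk: "skew_op dt A B w = biv_der q w" if "w \<in> bivectors" for w
  proof -
    have "skew_op dt A B w =
        skew_op dt (wedge a (jj a)) ((k * x) *s wedge a (jj c) + (k * y) *s wedge c (jj a)) w"
      by (simp add: A B skew_op_def biv_form_bilin vec_eq_iff algebra_simps)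
    also have "\<dots> = biv_der q w" by (rule skew_op_eq_biv_der[OF q qv that])
    finally show ?thesis .
  qed
  \<comment> \<open>The image of \<open>q\<close> lies in its kernel, so the trace vanishes and
    \<open>lower\<close> returns \<open>q\<close> without a correction.\<close>
  have "(\<Sum>b\<in>UNIV. q (axis b 1) $ b) =
      k * x * (\<Sum>b\<in>UNIV. dt a (jj a) (axis b 1) (jj c) * a $ b) +
      k * y * (\<Sum>b\<in>UNIV. dt a (jj a) c (axis b 1) * jj a $ b)"
    by (simp add: q_def sum.distrib sum_distrib_left mult.assoc)
  also have "\<dots> = 0" by (simp add: dt_expand dt_alt dt_alt')
  finally have tr: "(\<Sum>b\<in>UNIV. q (axis b 1) $ b) = 0" .
  have "lower (skew_op dt A B) = lower (biv_der q)" by (rule lower_cong) (rule sk)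
  also have "\<dots> = q" by (simp add: fun_eq_iff lower_biv_der[OF q] tr)
  finally have low: "lower (skew_op dt A B) = q" .
  have comm: "T (q v) = q (T v)" for v
    by (rule eq_on_frame[OF clinear_comp[OF T_clinear q] clinear_comp[OF q T_clinear]])
      (simp_all add: qv T_a T_c T_ja T_jc clinear_scale[OF T_clinear] clinear_scale[OF q]
        clinear_zero[OF T_clinear] clinear_neg[OF q] mult_ac)
  have "q v = 0" if "v \<in> vec.span {a, jj a}" for v
    using that by (auto simp: span_pair clinear_add[OF q] clinear_scale[OF q] qv)
  moreover have "q v \<in> vec.span {a, jj a}" for v
    unfolding span_pair q_def by blast
  ultimately show ?thesis using q sk low comm by blast
qed

end

subsection \<open>Families of endomorphisms and Wirtinger derivatives\<close>

lemma linear_component: "linear (\<lambda>v :: complex ^ 'n. v $ i)"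
  by (auto intro!: linearI)

lemma dd_component: "f differentiable (at u) \<Longrightarrow> dd (\<lambda>v. (f v :: complex ^ 'n) $ i) u X = dd f u X $ i"
  by (rule dd_linear_comp[OF linear_component])

lemma smooth_on_component: "open U \<Longrightarrow> smooth_on U f \<Longrightarrow> smooth_on U (\<lambda>v. (f v :: complex ^ 'n) $ i)"
  by (rule smooth_on_linear[OF linear_component])

lemma linear_vec_scale: "linear (\<lambda>v :: complex ^ 'n. k *s v)"
  by (rule clinear_imp_linear) (auto intro!: clinearI simp: vec.scale_right_distrib mult.commute)

lemma smooth_on_scale: "open U \<Longrightarrow> smooth_on U f \<Longrightarrow> smooth_on U (\<lambda>v. k *s (f v :: complex ^ 'n))"
  by (rule smooth_on_linear[OF linear_vec_scale])

lemma dd_scale: "f differentiable (at u) \<Longrightarrow> dd (\<lambda>v. k *s (f v :: complex ^ 'n)) u X = k *s dd f u X"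
  by (rule dd_linear_comp[OF linear_vec_scale])

lemma dd_vec_scale:
  "g differentiable (at u) \<Longrightarrow> f differentiable (at u) \<Longrightarrow>
    dd (\<lambda>v. g v *s (f v :: complex ^ 'n)) u X = dd g u X *s f u + g u *s dd f u X"
  by (rule dd_bilinear[OF bounded_bilinear_vec_scale])

lemma dd_wedge:
  "f differentiable (at u) \<Longrightarrow> g differentiable (at u) \<Longrightarrow>
    dd (\<lambda>v. wedge (f v) (g v)) u X = wedge (dd f u X) (g u) + wedge (f u) (dd g u X)"
  by (rule dd_bilinear[OF bounded_bilinear_wedge])

lemma dd_jj: "f differentiable (at u) \<Longrightarrow> dd (\<lambda>v. jj (f v)) u X = jj (dd f u X)"
  by (rule dd_linear_comp[OF linear_jj])

lemma smooth_on_jj: "open U \<Longrightarrow> smooth_on U f \<Longrightarrow> smooth_on U (\<lambda>v. jj (f v))"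
  by (rule smooth_on_linear[OF linear_jj])

lemma smooth_on_wedge: "open U \<Longrightarrow> smooth_on U f \<Longrightarrow> smooth_on U g \<Longrightarrow> smooth_on U (\<lambda>v. wedge (f v) (g v))"
  by (rule smooth_on_bounded_bilinear[OF bounded_bilinear_wedge])

lemma differentiable_bounded_bilinear:
  "bounded_bilinear h \<Longrightarrow> f differentiable (at u) \<Longrightarrow> g differentiable (at u) \<Longrightarrow>
    (\<lambda>v. h (f v) (g v)) differentiable (at u)"
  unfolding differentiable_def using bounded_bilinear.FDERIV by blast

lemma differentiable_linear:
  fixes h :: "'a::euclidean_space \<Rightarrow> 'b::real_normed_vector"
  shows "linear h \<Longrightarrow> f differentiable (at u) \<Longrightarrow> (\<lambda>v. h (f v)) differentiable (at u)"
  unfolding differentiable_def linear_conv_bounded_linear using bounded_linear.has_derivative by blast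

lemmas differentiable_simps = differentiable_bounded_bilinear[OF bounded_bilinear_wedge]
  differentiable_bounded_bilinear[OF bounded_bilinear_vec_scale]
  differentiable_linear[OF linear_jj] differentiable_linear[OF linear_vec_scale]
  differentiable_linear[OF linear_component]

text \<open>The operators are plain functions, smooth for each fixed argument. Complex linearity
  turns \<open>A v (s v)\<close> into a finite sum over the basis, to which the product rule for
  scalars times vectors applies.\<close>

lemma
  fixes A :: "complex \<Rightarrow> complex ^ 'n \<Rightarrow> complex ^ 'n"
  assumes W: "open W" and A: "\<And>v. v \<in> W \<Longrightarrow> clinear_on UNIV (A v)" "\<And>w. smooth_on W (\<lambda>v. A v w)"
  shows smooth_on_operator_apply: "smooth_on W s \<Longrightarrow> smooth_on W (\<lambda>v. A v (s v))"
    and dd_operator_apply: "u \<in> W \<Longrightarrow> s differentiable (at u) \<Longrightarrow>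
      dd (\<lambda>v. A v (s v)) u X = dd (\<lambda>v. A v (s u)) u X + A u (dd s u X)"
    and clinear_dd_operator: "u \<in> W \<Longrightarrow> clinear_on UNIV (\<lambda>w. dd (\<lambda>v. A v w) u X)"
proof -
  have expand: "A v (s v) = (\<Sum>i\<in>UNIV. s v $ i *s A v (axis i 1))" if "v \<in> W" for v s
    by (rule clinear_expand[OF A(1)[OF that]])
  show "smooth_on W (\<lambda>v. A v (s v))" if s: "smooth_on W s"
    by (rule smooth_on_cong[OF W expand[symmetric]])
      (assumption, intro smooth_on_sum[OF W] smooth_on_bounded_bilinear[OF bounded_bilinear_vec_scale W]
        smooth_on_component[OF W s] A(2))
  have dA: "(\<lambda>v. A v w) differentiable (at u)" if "u \<in> W" for u w
    by (rule smooth_on_differentiable[OF A(2) that])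
  have gen: "dd (\<lambda>v. A v (s v)) u X =
      (\<Sum>i\<in>UNIV. dd s u X $ i *s A u (axis i 1) + s u $ i *s dd (\<lambda>v. A v (axis i 1)) u X)"
    if u: "u \<in> W" and s: "s differentiable (at u)" for s u
  proof -
    have "dd (\<lambda>v. A v (s v)) u X = dd (\<lambda>v. \<Sum>i\<in>UNIV. s v $ i *s A v (axis i 1)) u X"
      by (rule fun_cong[OF dd_cong_open[OF W u expand]])
    also have "\<dots> = (\<Sum>i\<in>UNIV. dd (\<lambda>v. s v $ i *s A v (axis i 1)) u X)"
      by (rule dd_sum) (intro differentiable_simps s dA u)
    also have "\<dots> = (\<Sum>i\<in>UNIV. dd s u X $ i *s A u (axis i 1) + s u $ i *s dd (\<lambda>v. A v (axis i 1)) u X)"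
      by (intro sum.cong refl, subst dd_vec_scale)
        (simp_all add: dd_component s dA u differentiable_simps)
    finally show ?thesis .
  qed
  have const: "dd (\<lambda>v. A v w) u X = (\<Sum>i\<in>UNIV. w $ i *s dd (\<lambda>v. A v (axis i 1)) u X)" if "u \<in> W" for u w
    using gen[OF that, of "\<lambda>_. w"] by (simp add: dd_const)
  show "dd (\<lambda>v. A v (s v)) u X = dd (\<lambda>v. A v (s u)) u X + A u (dd s u X)"
    if u: "u \<in> W" and s: "s differentiable (at u)"
    unfolding gen[OF u s] const[OF u, of "s u"] sum.distrib
    by (subst clinear_expand[OF A(1)[OF u], of "dd s u X"]) (rule add.commute)
  show "clinear_on UNIV (\<lambda>w. dd (\<lambda>v. A v w) u X)" if u: "u \<in> W"
  proof -
    define D where "D i = dd (\<lambda>v. A v (axis i 1)) u X" for i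
    have "(\<lambda>w. dd (\<lambda>v. A v w) u X) = (\<lambda>w. \<Sum>i\<in>UNIV. w $ i *s D i)"
      unfolding D_def by (rule ext) (rule const[OF u])
    then show ?thesis
      by (auto intro!: clinearI simp: vec.scale_left_distrib sum.distrib vec.scale_sum_right)
  qed
qed

lemma
  assumes W: "open W" and A: "\<And>w. smooth_on W (\<lambda>v. A v w)"
  shows smooth_on_biv_der: "smooth_on W (\<lambda>v. biv_der (A v) B)"
    and smooth_on_biv_map: "smooth_on W (\<lambda>v. biv_map (A v) B)"
  unfolding biv_der_def biv_map_def bext_def
  by (intro smooth_on_scale[OF W] smooth_on_sum[OF W] smooth_on_add[OF W] smooth_on_wedge[OF W] A
      smooth_on_const)+

text \<open>The passage from \<open>f\<close> to \<open>\<rho>(f)\<close> is linear and does not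
  depend on the point, so it commutes with differentiation.\<close>

lemma dd_biv_der:
  assumes W: "open W" "u \<in> W" and A: "\<And>v. v \<in> W \<Longrightarrow> clinear_on UNIV (A v)" "\<And>w. smooth_on W (\<lambda>v. A v w)"
    and B: "B \<in> bivectors"
  shows "dd (\<lambda>v. biv_der (A v) B) u X = biv_der (\<lambda>w. dd (\<lambda>v. A v w) u X) B"
proof -
  have dA: "(\<lambda>v. A v w) differentiable (at u)" for w
    by (rule smooth_on_differentiable[OF A(2) W(2)])
  have cl: "clinear_on UNIV (\<lambda>w. dd (\<lambda>v. A v w) u X)"
    by (rule clinear_dd_operator[OF W(1) A W(2)])
  have dB: "(\<lambda>v. biv_der (A v) B) differentiable (at u)" for B
    by (rule smooth_on_differentiable[OF smooth_on_biv_der[OF W(1) A(2)] W(2)])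
  note lins = clinear_add[OF clinear_biv_der] clinear_scale[OF clinear_biv_der]
  show ?thesis
    using B
  proof (induction rule: bivectors_induct)
    case (wedge x y)
    have "dd (\<lambda>v. biv_der (A v) (wedge x y)) u X = dd (\<lambda>v. wedge (A v x) y + wedge x (A v y)) u X"
      by (rule fun_cong[OF dd_cong_open[OF W biv_der_wedge[OF A(1)]]])
    also have "\<dots> = wedge (dd (\<lambda>v. A v x) u X) y + wedge x (dd (\<lambda>v. A v y) u X)"
      by (simp add: dd_add dd_wedge dA differentiable_simps dd_const)
    finally show ?case by (simp add: biv_der_wedge[OF cl])
  next
    case (add A B)
    then show ?case by (simp add: lins dd_add dB)
  next
    case (scale k B)
    then show ?case by (simp add: lins dd_scale dB)
  qed
qed

lemma dd_in_bivectors: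
  assumes W: "open W" "u \<in> W" "\<And>v. v \<in> W \<Longrightarrow> s v \<in> bivectors" and s: "s differentiable (at u)"
  shows "dd s u X \<in> bivectors"
proof (rule bivectorsI)
  fix a b
  have "dd (\<lambda>v. s v $ (b, a)) u X = dd (\<lambda>v. - s v $ (a, b)) u X"
    by (rule fun_cong[OF dd_cong_open[OF W(1,2) bivectors_swap[OF W(3)]]])
  also have "\<dots> = - dd s u X $ (a, b)"
    by (simp add: dd_minus dd_component s differentiable_simps)
  finally show "dd s u X $ (b, a) = - dd s u X $ (a, b)"
    by (simp add: dd_component s)
qed

section \<open>Wirtinger derivatives\<close>

lemma dd_one: "dd f u 1 = d_z f u + d_zbar f u"
  and dd_i: "dd f u \<i> = \<i> *s d_z f u - \<i> *s d_zbar f u"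
  by (simp_all add: d_z_def d_zbar_def vec_eq_iff algebra_simps)

lemma d_z_cong_open:
  assumes "open W" "u \<in> W" "\<And>v. v \<in> W \<Longrightarrow> f v = g v"
  shows "d_z f u = d_z g u" "d_zbar f u = d_zbar g u"
  using dd_cong_open[OF assms] by (simp_all add: d_z_def d_zbar_def)

lemma d_z_add:
  assumes "f differentiable (at u)" "g differentiable (at u)"
  shows "d_z (\<lambda>v. f v + g v) u = d_z f u + d_z g u" "d_zbar (\<lambda>v. f v + g v) u = d_zbar f u + d_zbar g u"
  using assms by (simp_all add: d_z_def d_zbar_def dd_add vec_eq_iff algebra_simps)

lemma d_z_wedge:
  assumes "f differentiable (at u)" "g differentiable (at u)"
  shows "d_z (\<lambda>v. wedge (f v) (g v)) u = wedge (d_z f u) (g u) + wedge (f u) (d_z g u)"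
    "d_zbar (\<lambda>v. wedge (f v) (g v)) u = wedge (d_zbar f u) (g u) + wedge (f u) (d_zbar g u)"
  using assms by (simp_all add: d_z_def d_zbar_def dd_wedge wedge_bilin vec_eq_iff algebra_simps)

text \<open>Antilinearity of \<open>jj\<close> turns \<open>\<i>\<close> into \<open>- \<i>\<close>
  and so exchanges the two derivatives.\<close>

lemma d_z_jj:
  assumes "f differentiable (at u)"
  shows "d_z (\<lambda>v. jj (f v)) u = jj (d_zbar f u)" "d_zbar (\<lambda>v. jj (f v)) u = jj (d_z f u)"
  using assms by (simp_all add: d_z_def d_zbar_def dd_jj jj_scale jj_add jj_diff)

lemma smooth_on_d_z:
  assumes "open U" "smooth_on U f"
  shows "smooth_on U (d_z f)" "smooth_on U (d_zbar f)"
  unfolding d_z_def[abs_def] d_zbar_def[abs_def]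
  by (intro smooth_on_scale smooth_on_diff smooth_on_add smooth_on_dd assms)+

lemma d_z_commute:
  assumes U: "open U" "u \<in> U" and f: "smooth_on U f"
  shows "d_z (d_zbar f) u = d_zbar (d_z f) u"
proof -
  have d: "(\<lambda>v. dd f v X) differentiable (at u)" for X
    by (rule smooth_on_differentiable[OF smooth_on_dd[OF f] U(2)])
  have comm: "dd (\<lambda>v. dd f v 1) u \<i> = dd (\<lambda>v. dd f v \<i>) u 1" by (rule dd_commute[OF U f])
  have 1: "dd (d_z f) u X = (1 / 2) *s (dd (\<lambda>v. dd f v 1) u X - \<i> *s dd (\<lambda>v. dd f v \<i>) u X)" for X
    unfolding d_z_def[abs_def]
    by (simp only: dd_scale dd_diff d differentiable_simps differentiable_diff)
  have 2: "dd (d_zbar f) u X = (1 / 2) *s (dd (\<lambda>v. dd f v 1) u X + \<i> *s dd (\<lambda>v. dd f v \<i>) u X)" for X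
    unfolding d_zbar_def[abs_def]
    by (simp only: dd_scale dd_add d differentiable_simps differentiable_add)
  show ?thesis
    by (simp add: d_z_def[of "d_zbar f"] d_zbar_def[of "d_z f"] 1 2 comm vec_eq_iff algebra_simps)
qed

text \<open>\<open>d_z\<close> is typed for vectors; this is its counterpart for scalar
  multipliers.\<close>

definition c_z :: "(complex \<Rightarrow> complex) \<Rightarrow> complex \<Rightarrow> complex" where
  "c_z f u = (1 / 2) * (dd f u 1 - \<i> * dd f u \<i>)"

definition c_zbar :: "(complex \<Rightarrow> complex) \<Rightarrow> complex \<Rightarrow> complex" where
  "c_zbar f u = (1 / 2) * (dd f u 1 + \<i> * dd f u \<i>)"

lemma smooth_on_c_z:
  assumes "open U" "smooth_on U f"
  shows "smooth_on U (c_z f)"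
  unfolding c_z_def[abs_def]
  by (intro smooth_on_bounded_bilinear[OF bounded_bilinear_mult] smooth_on_const smooth_on_diff smooth_on_dd assms)

lemma d_z_vec_scale:
  assumes "g differentiable (at u)" "f differentiable (at u)"
  shows "d_z (\<lambda>v. g v *s f v) u = c_z g u *s f u + g u *s d_z f u"
    "d_zbar (\<lambda>v. g v *s f v) u = c_zbar g u *s f u + g u *s d_zbar f u"
  using assms by (simp_all add: d_z_def d_zbar_def c_z_def c_zbar_def dd_vec_scale vec_eq_iff algebra_simps)

text \<open>Proportionality is kept in the form \<open>g F = h G\<close>, which avoids dividing
  smooth functions. Differentiating it and solving at \<open>u\<close> expresses the derivatives of
  \<open>F\<close> by those of \<open>G\<close> of at most the same order.\<close>

lemma proportional_sections_span:
  fixes F G :: "complex \<Rightarrow> complex ^ 'n"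
  assumes W: "open W" "u \<in> W" and sm: "smooth_on W F" "smooth_on W G" "smooth_on W g" "smooth_on W h"
    and eq: "\<And>v. v \<in> W \<Longrightarrow> g v *s F v = h v *s G v" and nz: "g u \<noteq> 0"
  shows "vec.span {F u, d_z F u, d_zbar F u} \<subseteq> vec.span {G u, d_z G u, d_zbar G u}"
    "vec.span {F u, d_z F u, d_zbar F u, d_zbar (d_z F) u} \<subseteq> vec.span {G u, d_z G u, d_zbar G u, d_zbar (d_z G) u}"
proof -
  have diff: "f differentiable (at v)" if "smooth_on W f" "v \<in> W" for v and f :: "complex \<Rightarrow> 'x::real_normed_vector"
    by (rule smooth_on_differentiable[OF that])
  have z: "c_z g v *s F v + g v *s d_z F v = c_z h v *s G v + h v *s d_z G v"
    and zb: "c_zbar g v *s F v + g v *s d_zbar F v = c_zbar h v *s G v + h v *s d_zbar G v"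
    if v: "v \<in> W" for v
    using d_z_cong_open[OF W(1) v eq] d_z_vec_scale[OF diff[OF sm(3) v] diff[OF sm(1) v]]
      d_z_vec_scale[OF diff[OF sm(4) v] diff[OF sm(2) v]] by simp_all
  have zzb: "c_zbar (c_z g) u *s F u + c_z g u *s d_zbar F u + (c_zbar g u *s d_z F u + g u *s d_zbar (d_z F) u) =
      c_zbar (c_z h) u *s G u + c_z h u *s d_zbar G u + (c_zbar h u *s d_z G u + h u *s d_zbar (d_z G) u)"
  proof -
    have lhs: "d_zbar (\<lambda>v. c_z g v *s F v + g v *s d_z F v) u =
        c_zbar (c_z g) u *s F u + c_z g u *s d_zbar F u + (c_zbar g u *s d_z F u + g u *s d_zbar (d_z F) u)"
      if "smooth_on W F" "smooth_on W g" for F :: "complex \<Rightarrow> complex ^ 'n" and g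
    proof -
      note d = diff[OF that(1) W(2)] diff[OF that(2) W(2)] diff[OF smooth_on_c_z[OF W(1) that(2)] W(2)]
        diff[OF smooth_on_d_z(1)[OF W(1) that(1)] W(2)]
      show ?thesis by (simp add: d_z_add d_z_vec_scale d differentiable_simps)
    qed
    show ?thesis
      using d_z_cong_open(2)[OF W z] lhs[OF sm(1,3)] lhs[OF sm(2,4)] by simp
  qed
  have solve: "x = (1 / g u) *s (y - z)" if "z + g u *s x = y" for x y z :: "complex ^ 'n"
    by (simp add: that[symmetric] nz)
  have F: "F u \<in> vec.span S" if "G u \<in> S" for S
  proof -
    have "F u = (h u / g u) *s G u"
      using eq[OF W(2)] nz by (auto simp: vec_eq_iff field_simps)
    then show ?thesis using that by (simp add: vec.span_scale vec.span_base)
  qed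
  have Fz: "d_z F u \<in> vec.span S" if "G u \<in> S" "d_z G u \<in> S" for S
    unfolding solve[OF z[OF W(2)]]
    by (intro vec.span_scale vec.span_diff vec.span_add F vec.span_base that)
  have Fzb: "d_zbar F u \<in> vec.span S" if "G u \<in> S" "d_zbar G u \<in> S" for S
    unfolding solve[OF zb[OF W(2)]]
    by (intro vec.span_scale vec.span_diff vec.span_add F vec.span_base that)
  have Fzzb: "d_zbar (d_z F) u \<in> vec.span S"
    if "G u \<in> S" "d_z G u \<in> S" "d_zbar G u \<in> S" "d_zbar (d_z G) u \<in> S" for S
    unfolding solve[OF zzb[unfolded add.assoc[symmetric]]]
    by (intro vec.span_scale vec.span_diff vec.span_add F Fz Fzb vec.span_base that)
  show "vec.span {F u, d_z F u, d_zbar F u} \<subseteq> vec.span {G u, d_z G u, d_zbar G u}"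
    by (rule vec.span_minimal) (auto intro: F Fz Fzb)
  show "vec.span {F u, d_z F u, d_zbar F u, d_zbar (d_z F) u} \<subseteq> vec.span {G u, d_z G u, d_zbar G u, d_zbar (d_z G) u}"
    by (rule vec.span_minimal) (auto intro: F Fz Fzb Fzzb)
qed

lemma wedge_eq_zero_imp:
  assumes "wedge p q = 0" "p \<noteq> 0"
  shows "\<exists>k. q = k *s p"
proof -
  obtain i where i: "p $ i \<noteq> 0" using assms(2) by (auto simp: vec_eq_iff)
  have "p $ i * q $ b = p $ b * q $ i" for b
    using arg_cong[OF assms(1), of "\<lambda>B. B $ (i, b)"] by (simp add: wedge_def)
  then have "q = (q $ i / p $ i) *s p" using i by (simp add: vec_eq_iff field_simps)
  then show ?thesis by blast
qed

subsection \<open>The central sphere congruence in a chart\<close>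

lemma UN_pairs_const:
  assumes "\<And>x y. Q x y \<Longrightarrow> f x y = C" "Q x y"
  shows "(\<Union>(x, y)\<in>{(x, y). Q x y}. f x y) = C"
  using assms by fastforce

text \<open>The hypotheses pulled back to one chart: \<open>P\<close> is \<open>L\<close> and
  \<open>T\<close> is \<open>S\<close> along the parametrisation. In \<open>T_dT\<close> the star of
  \<open>dS\<close> is written out, whence the plus sign before the term in direction
  \<open>\<i> * X\<close>.\<close>

locale mcs_chart = qdet +
  fixes U :: "complex set" and P :: "complex \<Rightarrow> cvec4 set" and T :: "complex \<Rightarrow> cvec4 \<Rightarrow> cvec4"
  assumes open_U: "open U"
    and P_subspace: "u \<in> U \<Longrightarrow> vec.subspace (P u)"
    and P_dim: "u \<in> U \<Longrightarrow> vec.dim (P u) = 2"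
    and P_jj: "u \<in> U \<Longrightarrow> w \<in> P u \<Longrightarrow> jj w \<in> P u"
    and P_frames: "u \<in> U \<Longrightarrow> \<exists>W s t. u \<in> W \<and> local_section U P W s \<and> local_section U P W t \<and>
      (\<forall>v\<in>W. P v = vec.span {s v, t v})"
    and immersed: "real_lift U P W \<sigma> \<Longrightarrow> u \<in> W \<Longrightarrow> dd \<sigma> u X \<in> span {\<sigma> u} \<Longrightarrow> X = 0"
    and T_clinear: "u \<in> U \<Longrightarrow> clinear_on UNIV (T u)"
    and T_jj: "u \<in> U \<Longrightarrow> T u (jj w) = jj (T u w)"
    and T_T: "u \<in> U \<Longrightarrow> T u (T u w) = - w"
    and T_P: "u \<in> U \<Longrightarrow> w \<in> P u \<Longrightarrow> T u w \<in> P u"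
    and T_smooth: "smooth_on U (\<lambda>v. T v w)"
    and dT_P: "u \<in> U \<Longrightarrow> w \<in> P u \<Longrightarrow> dd (\<lambda>v. T v w) u X \<in> P u"
    and star_T: "local_section U P W s \<Longrightarrow> u \<in> W \<Longrightarrow> - dd s u (\<i> * X) - T u (dd s u X) \<in> P u"
    and delta_T: "local_section U P W s \<Longrightarrow> u \<in> W \<Longrightarrow> T u (dd s u X) - dd (\<lambda>v. T v (s v)) u X \<in> P u"
    and T_dT: "u \<in> U \<Longrightarrow> w \<in> P u \<Longrightarrow> T u (dd (\<lambda>v. T v w) u X) + dd (\<lambda>v. T v w) u (\<i> * X) = 0"
begin

lemma local_sectionD:
  assumes "local_section U P W s"
  shows "open W" "W \<subseteq> U" "smooth_on W s" "v \<in> W \<Longrightarrow> s v \<in> P v"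
  using assms by (simp_all add: local_section_def)

lemma T_smooth_subset: "W \<subseteq> U \<Longrightarrow> smooth_on W (\<lambda>v. T v w)"
  by (rule smooth_on_subset[OF T_smooth])

text \<open>\<open>r - \<i> T r\<close> always lies in the eigenspace of \<open>T\<close> for
  \<open>\<i>\<close>, because \<open>T T = - 1\<close>. It remains to choose a section for which it
  does not vanish at \<open>u\<close>; by continuity it then vanishes nowhere nearby.\<close>

lemma adapted_section_exists:
  assumes u: "u \<in> U"
  shows "\<exists>W \<alpha>. u \<in> W \<and> local_section U P W \<alpha> \<and> (\<forall>v\<in>W. \<alpha> v \<noteq> 0 \<and> T v (\<alpha> v) = \<i> *s \<alpha> v)"
proof -
  obtain W s t where W: "u \<in> W" "local_section U P W s" "\<And>v. v \<in> W \<Longrightarrow> P v = vec.span {s v, t v}"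
    using P_frames[OF u] by blast
  note s = local_sectionD[OF W(2)]
  \<comment> \<open>Otherwise \<open>t u\<close> alone would span a plane of dimension 2.\<close>
  have su: "s u \<noteq> 0"
  proof
    assume "s u = 0"
    then have "P u = vec.span {t u}" using W(3)[OF W(1)] by simp
    then have "vec.dim (P u) \<le> card {t u}" using vec.dim_le_card by (metis finite.intros order_refl)
    then show False using P_dim[OF u] by simp
  qed
  \<comment> \<open>If the projection kills \<open>s u\<close>, then \<open>s u\<close> has
    eigenvalue \<open>- \<i>\<close>, so \<open>jj (s u)\<close> has eigenvalue \<open>\<i>\<close>
    and survives.\<close>
  have "\<exists>r. local_section U P W r \<and> r u - \<i> *s T u (r u) \<noteq> 0"
  proof (cases "s u - \<i> *s T u (s u) = 0")
    case True
    have "local_section U P W (\<lambda>v. jj (s v))"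
      using s by (auto simp: local_section_def intro!: smooth_on_jj P_jj)
    moreover have "jj (s u) - \<i> *s T u (jj (s u)) \<noteq> 0"
    proof
      have "jj (s u - \<i> *s T u (s u)) = 0" using True by simp
      then have 1: "jj (s u) + \<i> *s jj (T u (s u)) = 0" by (simp add: jj_diff jj_scale)
      assume "jj (s u) - \<i> *s T u (jj (s u)) = 0"
      then have 2: "jj (s u) - \<i> *s jj (T u (s u)) = 0" by (simp add: T_jj[OF u])
      have "jj (s u) + jj (s u) = 0" using 1 2 by (metis add.right_neutral add_diff_cancel diff_add_cancel eq_iff_diff_eq_0)
      then show False using su by (simp flip: scaleR_2)
    qed
    ultimately show ?thesis by blast
  next
    case False
    then show ?thesis using W(2) by blast
  qed
  then obtain r where r: "local_section U P W r" and ru: "r u - \<i> *s T u (r u) \<noteq> 0" by blast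
  note r' = local_sectionD[OF r]
  define \<alpha> where "\<alpha> v = r v - \<i> *s T v (r v)" for v
  have \<alpha>: "smooth_on W \<alpha>"
    unfolding \<alpha>_def[abs_def]
    by (intro smooth_on_diff[OF r'(1)] smooth_on_scale[OF r'(1)] r'(3)
        smooth_on_operator_apply[OF r'(1) T_clinear T_smooth_subset]) (use r'(2) in auto)
  have T\<alpha>: "T v (\<alpha> v) = \<i> *s \<alpha> v" if "v \<in> W" for v
    using that r'(2) T_T[of v]
    by (simp add: \<alpha>_def subset_iff clinear_diff[OF T_clinear] clinear_scale[OF T_clinear] vec_eq_iff algebra_simps)
  have \<alpha>P: "\<alpha> v \<in> P v" if "v \<in> W" for v
    unfolding \<alpha>_def
    by (intro vec.subspace_diff vec.subspace_scale P_subspace T_P) (use that r' in auto)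
  have "isCont \<alpha> u" using smooth_on_continuous[OF \<alpha>] r'(1) W(1) by (simp add: continuous_on_eq_continuous_at)
  then obtain e where e: "e > 0" "\<And>v. dist u v < e \<Longrightarrow> \<alpha> v \<noteq> 0"
    using continuous_at_avoid[of u \<alpha> 0] ru by (auto simp: \<alpha>_def)
  let ?W = "W \<inter> ball u e"
  have "local_section U P ?W \<alpha>"
    using r' \<alpha> \<alpha>P by (auto simp: local_section_def intro: smooth_on_subset)
  moreover have "u \<in> ?W" using W(1) e(1) by simp
  moreover have "\<forall>v\<in>?W. \<alpha> v \<noteq> 0 \<and> T v (\<alpha> v) = \<i> *s \<alpha> v" using e T\<alpha> by auto
  ultimately show ?thesis by blast
qed

text \<open>The condition \<open>*\<delta> = S \<delta>\<close> says that modulo \<open>L\<close>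
  the map \<open>T\<close> sends the derivative along \<open>X\<close> to minus that along
  \<open>\<i> X\<close>. Combining \<open>X = 1\<close> and \<open>X = \<i>\<close> shows
  \<open>d_z s\<close> to be an eigenvector for \<open>- \<i>\<close>, and \<open>d_zbar s\<close>
  one for \<open>\<i>\<close>, modulo \<open>L\<close>.\<close>

lemma T_dz_section:
  assumes s: "local_section U P W s" and u: "u \<in> W"
  shows "T u (d_z s u) + \<i> *s d_z s u \<in> P u" "T u (d_zbar s u) - \<i> *s d_zbar s u \<in> P u"
proof -
  note s' = local_sectionD[OF s]
  have uU: "u \<in> U" using u s'(2) by blast
  note P = P_subspace[OF uU] and cl = T_clinear[OF uU]
  have ds: "s differentiable (at u)" by (rule smooth_on_differentiable[OF s'(3) u])
  have a: "- dd s u \<i> - T u (dd s u 1) \<in> P u" using star_T[OF s u, of 1] by simp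
  have "- dd s u (- 1) - T u (dd s u \<i>) \<in> P u" using star_T[OF s u, of \<i>] by simp
  then have b: "dd s u 1 - T u (dd s u \<i>) \<in> P u"
    using linear_neg[OF dd_linear[OF ds]] by simp
  have "(- 1 / 2) *s (- dd s u \<i> - T u (dd s u 1)) + (\<i> / 2) *s (dd s u 1 - T u (dd s u \<i>)) \<in> P u"
    by (intro vec.subspace_add[OF P] vec.subspace_scale[OF P] a b)
  also have "(- 1 / 2) *s (- dd s u \<i> - T u (dd s u 1)) + (\<i> / 2) *s (dd s u 1 - T u (dd s u \<i>)) =
      T u (d_z s u) + \<i> *s d_z s u"
    by (simp add: d_z_def clinear_scale[OF cl] clinear_diff[OF cl] vec_eq_iff algebra_simps)
  finally show "T u (d_z s u) + \<i> *s d_z s u \<in> P u" .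
  have "(- 1 / 2) *s (- dd s u \<i> - T u (dd s u 1)) - (\<i> / 2) *s (dd s u 1 - T u (dd s u \<i>)) \<in> P u"
    by (intro vec.subspace_diff[OF P] vec.subspace_scale[OF P] a b)
  also have "(- 1 / 2) *s (- dd s u \<i> - T u (dd s u 1)) - (\<i> / 2) *s (dd s u 1 - T u (dd s u \<i>)) =
      T u (d_zbar s u) - \<i> *s d_zbar s u"
    by (simp add: d_zbar_def clinear_scale[OF cl] clinear_add[OF cl] vec_eq_iff algebra_simps)
  finally show "T u (d_zbar s u) - \<i> *s d_zbar s u \<in> P u" .
qed

text \<open>Differentiation of \<open>T T = - 1\<close>.\<close>

lemma T_dT_anticommute:
  assumes u: "u \<in> U"
  shows "T u (dd (\<lambda>v. T v w) u X) = - dd (\<lambda>v. T v (T u w)) u X"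
proof -
  have "dd (\<lambda>v. T v (T v w)) u X = dd (\<lambda>v. - w) u X"
    by (rule fun_cong[OF dd_cong_open[OF open_U u T_T]])
  moreover have "dd (\<lambda>v. T v (T v w)) u X = dd (\<lambda>v. T v (T u w)) u X + T u (dd (\<lambda>v. T v w) u X)"
    by (rule dd_operator_apply[OF open_U T_clinear T_smooth u smooth_on_differentiable[OF T_smooth u]])
  ultimately show ?thesis by (simp add: dd_const eq_neg_iff_add_eq_0 add.commute)
qed

end

locale adapted_section = mcs_chart +
  fixes W :: "complex set" and \<alpha> :: "complex \<Rightarrow> cvec4"
  assumes \<alpha>_section: "local_section U P W \<alpha>"
    and \<alpha>_nonzero: "v \<in> W \<Longrightarrow> \<alpha> v \<noteq> 0" and T_\<alpha>: "v \<in> W \<Longrightarrow> T v (\<alpha> v) = \<i> *s \<alpha> v"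
begin

lemmas W_open = local_sectionD(1)[OF \<alpha>_section]
lemmas W_U = local_sectionD(2)[OF \<alpha>_section]
lemmas \<alpha>_smooth = local_sectionD(3)[OF \<alpha>_section]
lemmas \<alpha>_P = local_sectionD(4)[OF \<alpha>_section]

lemma W_in_U: "v \<in> W \<Longrightarrow> v \<in> U" using W_U by blast

lemma \<alpha>_differentiable: "v \<in> W \<Longrightarrow> \<alpha> differentiable (at v)"
  by (rule smooth_on_differentiable[OF \<alpha>_smooth])

lemma P_eq_span:
  assumes v: "v \<in> W"
  shows "P v = vec.span {\<alpha> v, jj (\<alpha> v)}"
proof
  have ind: "x = 0 \<and> y = 0" if "x *s \<alpha> v + y *s jj (\<alpha> v) = 0" for x y
    using quaternionic_line_cancel[of "{0}" x "\<alpha> v" y] that \<alpha>_nonzero[OF v]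
    by (auto simp: vec.subspace_single_0)
  have ne: "\<alpha> v \<noteq> jj (\<alpha> v)" using ind[of 1 "- 1"] by auto
  have sub: "{\<alpha> v, jj (\<alpha> v)} \<subseteq> P v"
    using \<alpha>_P[OF v] P_jj[OF W_in_U[OF v]] by auto
  have "vec.independent {\<alpha> v, jj (\<alpha> v)}"
  proof (rule vec.independent_if_scalars_zero)
    fix f x assume "(\<Sum>x\<in>{\<alpha> v, jj (\<alpha> v)}. f x *s x) = 0" "x \<in> {\<alpha> v, jj (\<alpha> v)}"
    then show "f x = 0" using ne ind[of "f (\<alpha> v)" "f (jj (\<alpha> v))"] by auto
  qed simp
  then show "P v \<subseteq> vec.span {\<alpha> v, jj (\<alpha> v)}"
    using sub ne P_dim[OF W_in_U[OF v]] by (intro vec.card_ge_dim_independent) simp_all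
  show "vec.span {\<alpha> v, jj (\<alpha> v)} \<subseteq> P v"
    by (rule vec.span_minimal[OF sub P_subspace[OF W_in_U[OF v]]])
qed

text \<open>\<open>S \<delta> = \<delta> S\<close> and \<open>T \<alpha> = \<i> \<alpha>\<close>
  give \<open>d_z \<alpha>\<close> the eigenvalue \<open>\<i>\<close> modulo \<open>L\<close>,
  whereas \<open>T_dz_section\<close> gives it \<open>- \<i>\<close>. Both together force it to
  vanish modulo \<open>L\<close>.\<close>

lemma d_z_\<alpha>:
  assumes v: "v \<in> W"
  shows "d_z \<alpha> v \<in> P v"
proof -
  note vU = W_in_U[OF v]
  note P = P_subspace[OF vU] and cl = T_clinear[OF vU]
  have "dd (\<lambda>v. T v (\<alpha> v)) v X = dd (\<lambda>v. \<i> *s \<alpha> v) v X" for X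
    by (rule fun_cong[OF dd_cong_open[OF W_open v T_\<alpha>]])
  then have d: "T v (dd \<alpha> v X) - \<i> *s dd \<alpha> v X \<in> P v" for X
    using delta_T[OF \<alpha>_section v, of X] by (simp add: dd_scale[OF \<alpha>_differentiable[OF v]])
  have "(1 / 2) *s (T v (dd \<alpha> v 1) - \<i> *s dd \<alpha> v 1) - (\<i> / 2) *s (T v (dd \<alpha> v \<i>) - \<i> *s dd \<alpha> v \<i>) \<in> P v"
    by (intro vec.subspace_diff[OF P] vec.subspace_scale[OF P] d)
  also have "(1 / 2) *s (T v (dd \<alpha> v 1) - \<i> *s dd \<alpha> v 1) - (\<i> / 2) *s (T v (dd \<alpha> v \<i>) - \<i> *s dd \<alpha> v \<i>)
      = T v (d_z \<alpha> v) - \<i> *s d_z \<alpha> v"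
    by (simp add: d_z_def clinear_scale[OF cl] clinear_diff[OF cl] vec_eq_iff algebra_simps)
  finally have "(T v (d_z \<alpha> v) + \<i> *s d_z \<alpha> v) - (T v (d_z \<alpha> v) - \<i> *s d_z \<alpha> v) \<in> P v"
    by (intro vec.subspace_diff[OF P T_dz_section(1)[OF \<alpha>_section v]])
  \<comment> \<open>The difference is \<open>2 \<i>\<close> times
    \<open>d_z \<alpha>\<close>.\<close>
  then have "(- \<i> / 2) *s ((T v (d_z \<alpha> v) + \<i> *s d_z \<alpha> v) - (T v (d_z \<alpha> v) - \<i> *s d_z \<alpha> v)) \<in> P v"
    by (rule vec.subspace_scale[OF P])
  also have "(- \<i> / 2) *s ((T v (d_z \<alpha> v) + \<i> *s d_z \<alpha> v) - (T v (d_z \<alpha> v) - \<i> *s d_z \<alpha> v)) = d_z \<alpha> v"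
    by (simp add: vec_eq_iff algebra_simps)
  finally show ?thesis .
qed

text \<open>An exact equality, not one modulo \<open>L\<close>: here \<open>S dS = *dS\<close> on
  \<open>L\<close> enters. It makes the \<open>zbar\<close>-derivative of \<open>T\<close>
  annihilate \<alpha>, so that differentiating \<open>T \<alpha> = \<i> \<alpha>\<close> leaves no
  further term.\<close>

lemma T_d_zbar_\<alpha>:
  assumes v: "v \<in> W"
  shows "T v (d_zbar \<alpha> v) = \<i> *s d_zbar \<alpha> v"
proof -
  note vU = W_in_U[OF v]
  note cl = T_clinear[OF vU]
  define D where "D X = dd (\<lambda>x. T x (\<alpha> v)) v X" for X
  have "dd (\<lambda>v. T v (\<alpha> v)) v X = dd (\<lambda>v. \<i> *s \<alpha> v) v X" for X
    by (rule fun_cong[OF dd_cong_open[OF W_open v T_\<alpha>]])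
  moreover have "dd (\<lambda>v. T v (\<alpha> v)) v X = D X + T v (dd \<alpha> v X)" for X
    unfolding D_def by (rule dd_operator_apply[OF open_U T_clinear T_smooth vU \<alpha>_differentiable[OF v]])
  ultimately have T: "T v (dd \<alpha> v X) = \<i> *s dd \<alpha> v X - D X" for X
    by (simp add: dd_scale[OF \<alpha>_differentiable[OF v]] algebra_simps)
  have "T v (D 1) = - dd (\<lambda>x. T x (\<i> *s \<alpha> v)) v 1"
    unfolding D_def using T_dT_anticommute[OF vU] T_\<alpha>[OF v] by simp
  also have "\<dots> = - (\<i> *s D 1)"
    unfolding D_def using clinear_scale[OF clinear_dd_operator[OF open_U T_clinear T_smooth vU]] by simp
  \<comment> \<open>Hence \<open>D 1 + \<i> D \<i> = 0\<close>, which is the vanishing of that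
    derivative.\<close>
  finally have "D \<i> = \<i> *s D 1"
    using T_dT[OF vU \<alpha>_P[OF v], of 1] by (simp add: D_def)
  then show ?thesis
    by (simp add: d_zbar_def clinear_scale[OF cl] clinear_add[OF cl] T vec_eq_iff algebra_simps)
qed

definition \<sigma> :: "complex \<Rightarrow> bivec" where "\<sigma> v = wedge (\<alpha> v) (jj (\<alpha> v))"

lemma \<sigma>_nonzero:
  assumes v: "v \<in> W"
  shows "\<sigma> v \<noteq> 0"
proof
  assume "\<sigma> v = 0"
  then obtain k where k: "jj (\<alpha> v) = k *s \<alpha> v"
    using wedge_eq_zero_imp \<alpha>_nonzero[OF v] unfolding \<sigma>_def by blast
  then have "(- k) *s \<alpha> v + 1 *s jj (\<alpha> v) \<in> {0}" by simp
  then have "\<alpha> v \<in> {0}"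
    by (rule quaternionic_line_cancel[rotated 2]) (auto simp: vec.subspace_single_0)
  then show False using \<alpha>_nonzero[OF v] by simp
qed

lemma \<sigma>_lift: "real_lift U P W \<sigma>"
  unfolding real_lift_def
proof (intro conjI ballI)
  show "smooth_on W \<sigma>"
    unfolding \<sigma>_def[abs_def]
    by (intro smooth_on_wedge[OF W_open] smooth_on_jj[OF W_open] \<alpha>_smooth)
  fix v assume v: "v \<in> W"
  have "biv_j (\<sigma> v) = \<sigma> v"
    unfolding \<sigma>_def biv_j_wedge jj_jj wedge_neg_right by (rule wedge_swap[symmetric])
  moreover have "\<sigma> v \<in> ext2 (P v)"
    unfolding ext2_def \<sigma>_def using \<alpha>_P[OF v] P_jj[OF W_in_U[OF v]] by blast
  ultimately show "\<sigma> v \<in> ext2 (P v) \<inter> real_bivectors" "\<sigma> v \<noteq> 0"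
    using \<sigma>_nonzero[OF v] by (auto simp: real_bivectors_def \<sigma>_def)
qed (use W_open W_U in auto)

text \<open>Otherwise the derivative of \<alpha> along 1 would lie in \<open>L\<close>, and that of
  the real lift \<sigma> would be a multiple of \<sigma>, against immersion. The multiple
  \<open>k + cnj k\<close> is real, as the real span in the immersion condition requires.\<close>

lemma d_zbar_\<alpha>_notin:
  assumes v: "v \<in> W"
  shows "d_zbar \<alpha> v \<notin> P v"
proof
  assume "d_zbar \<alpha> v \<in> P v"
  then have "dd \<alpha> v 1 \<in> P v"
    unfolding dd_one by (intro vec.subspace_add[OF P_subspace[OF W_in_U[OF v]]] d_z_\<alpha>[OF v])
  then obtain k l where kl: "dd \<alpha> v 1 = k *s \<alpha> v + l *s jj (\<alpha> v)"
    using P_eq_span[OF v] span_pair by blast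
  have "dd \<sigma> v 1 = wedge (dd \<alpha> v 1) (jj (\<alpha> v)) + wedge (\<alpha> v) (jj (dd \<alpha> v 1))"
    unfolding \<sigma>_def[abs_def]
    by (simp add: dd_wedge dd_jj differentiable_simps \<alpha>_differentiable[OF v])
  also have "\<dots> = (k + cnj k) *s \<sigma> v"
    by (simp add: kl jj_add jj_scale wedge_bilin \<sigma>_def vec.scale_left_distrib)
  also have "\<dots> = (2 * Re k) *\<^sub>R \<sigma> v"
    by (simp add: scaleR_eq_vec_scale complex_add_cnj)
  also have "\<dots> \<in> span {\<sigma> v}" by (intro span_scale span_base) simp
  finally have "(1 :: complex) = 0" by (rule immersed[OF \<sigma>_lift v])
  then show False by simp
qed

lemma frame:
  assumes v: "v \<in> W"
  shows "adapted_frame dt (\<alpha> v) (d_zbar \<alpha> v) (T v)"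
proof
  show "d_zbar \<alpha> v \<notin> vec.span {\<alpha> v, jj (\<alpha> v)}"
    using d_zbar_\<alpha>_notin[OF v] P_eq_span[OF v] by simp
qed (use v W_in_U T_clinear T_jj T_\<alpha> T_d_zbar_\<alpha> \<alpha>_nonzero in auto)

lemma d_z_\<sigma>:
  assumes v: "v \<in> W"
  shows "d_z \<sigma> v = wedge (d_z \<alpha> v) (jj (\<alpha> v)) + wedge (\<alpha> v) (jj (d_zbar \<alpha> v))"
    "d_zbar \<sigma> v = wedge (d_zbar \<alpha> v) (jj (\<alpha> v)) + wedge (\<alpha> v) (jj (d_z \<alpha> v))"
  unfolding \<sigma>_def[abs_def]
  by (simp_all add: d_z_wedge d_z_jj differentiable_simps \<alpha>_differentiable[OF v])

lemma d_zbar_d_z_\<sigma>: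
  assumes v: "v \<in> W"
  shows "d_zbar (d_z \<sigma>) v = wedge (d_zbar (d_z \<alpha>) v) (jj (\<alpha> v)) + wedge (d_z \<alpha> v) (jj (d_z \<alpha> v)) +
    (wedge (d_zbar \<alpha> v) (jj (d_zbar \<alpha> v)) + wedge (\<alpha> v) (jj (d_zbar (d_z \<alpha>) v)))"
proof -
  note sm = smooth_on_d_z[OF W_open \<alpha>_smooth]
  note d = smooth_on_differentiable[OF sm(1) v] smooth_on_differentiable[OF sm(2) v] \<alpha>_differentiable[OF v]
  have "d_zbar (d_z \<sigma>) v = d_zbar (\<lambda>v. wedge (d_z \<alpha> v) (jj (\<alpha> v)) + wedge (\<alpha> v) (jj (d_zbar \<alpha> v))) v"
    by (rule d_z_cong_open(2)[OF W_open v d_z_\<sigma>(1)])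
  also have "\<dots> = wedge (d_zbar (d_z \<alpha>) v) (jj (\<alpha> v)) + wedge (d_z \<alpha> v) (jj (d_z \<alpha> v)) +
    (wedge (d_zbar \<alpha> v) (jj (d_zbar \<alpha> v)) + wedge (\<alpha> v) (jj (d_z (d_zbar \<alpha>) v)))"
    by (simp add: d_z_add d_z_wedge d_z_jj d differentiable_simps)
  finally show ?thesis by (simp only: d_z_commute[OF W_open v \<alpha>_smooth])
qed

text \<open>\<open>d_z \<alpha>\<close> is itself a section of \<open>L\<close>, so
  \<open>T_dz_section\<close> applies to it once more: \<open>T - \<i>\<close> maps its
  \<open>zbar\<close>-derivative into \<open>L\<close>. On the component along
  \<open>jj (d_zbar \<alpha>)\<close> that operator is \<open>- 2 \<i>\<close>, so this component is
  zero.\<close>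

lemma d_zbar_d_z_\<alpha>:
  assumes v: "v \<in> W"
  shows "\<exists>x y z. d_zbar (d_z \<alpha>) v = x *s \<alpha> v + y *s jj (\<alpha> v) + z *s d_zbar \<alpha> v"
proof -
  interpret fr: adapted_frame dt "\<alpha> v" "d_zbar \<alpha> v" "T v" by (rule frame[OF v])
  note vU = W_in_U[OF v]
  note cl = T_clinear[OF vU]
  have "local_section U P W (d_z \<alpha>)"
    using W_open W_U smooth_on_d_z(1)[OF W_open \<alpha>_smooth] d_z_\<alpha> by (auto simp: local_section_def)
  from T_dz_section(2)[OF this v]
  have mem: "T v (d_zbar (d_z \<alpha>) v) - \<i> *s d_zbar (d_z \<alpha>) v \<in> P v" .
  obtain x y z w where e: "d_zbar (d_z \<alpha>) v =
      x *s \<alpha> v + y *s jj (\<alpha> v) + z *s d_zbar \<alpha> v + w *s jj (d_zbar \<alpha> v)"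
    using fr.frame_coords by blast
  have "T v (d_zbar (d_z \<alpha>) v) - \<i> *s d_zbar (d_z \<alpha>) v =
      0 *s \<alpha> v + (- 2 * \<i> * y) *s jj (\<alpha> v) + 0 *s d_zbar \<alpha> v + (- 2 * \<i> * w) *s jj (d_zbar \<alpha> v)"
    unfolding e clinear_add[OF cl] clinear_scale[OF cl] fr.T_a fr.T_ja fr.T_c fr.T_jc
    by (simp add: vec_eq_iff algebra_simps)
  moreover obtain k l where "T v (d_zbar (d_z \<alpha>) v) - \<i> *s d_zbar (d_z \<alpha>) v =
      k *s \<alpha> v + l *s jj (\<alpha> v) + 0 *s d_zbar \<alpha> v + 0 *s jj (d_zbar \<alpha> v)"
    using mem unfolding P_eq_span[OF v] span_pair by auto
  ultimately have "- 2 * \<i> * w = 0"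
    by (intro fr.frame_coeffs_unique(4)) (rule trans[OF sym])
  then show ?thesis using e by auto
qed

text \<open>A triangular system: each further derivative of \<sigma> brings in one new frame
  bivector with coefficient 1, modulo those already reached.\<close>

lemma span_lift:
  assumes v: "v \<in> W"
  defines "a \<equiv> \<alpha> v" and "c \<equiv> d_zbar \<alpha> v"
  shows "vec.span {\<sigma> v, d_z \<sigma> v, d_zbar \<sigma> v} = vec.span {wedge a (jj a), wedge a (jj c), wedge c (jj a)}"
    "vec.span {\<sigma> v, d_z \<sigma> v, d_zbar \<sigma> v, d_zbar (d_z \<sigma>) v} =
      vec.span {wedge a (jj a), wedge a (jj c), wedge c (jj a), wedge c (jj c)}"
proof -
  obtain k l where kl: "d_z \<alpha> v = k *s a + l *s jj a"
    using d_z_\<alpha>[OF v] P_eq_span[OF v] span_pair unfolding a_def by blast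
  obtain x y z where xyz: "d_zbar (d_z \<alpha>) v = x *s a + y *s jj a + z *s c"
    using d_zbar_d_z_\<alpha>[OF v] unfolding a_def c_def by blast
  have s: "\<sigma> v = wedge a (jj a)" by (simp add: \<sigma>_def a_def)
  have sz: "d_z \<sigma> v = k *s wedge a (jj a) + wedge a (jj c)"
    unfolding d_z_\<sigma>[OF v] kl by (simp add: wedge_bilin a_def c_def)
  have szb: "d_zbar \<sigma> v = cnj k *s wedge a (jj a) + wedge c (jj a)"
    unfolding d_z_\<sigma>[OF v] kl by (simp add: wedge_bilin a_def c_def jj_add jj_scale)
  \<comment> \<open>As the second derivative of \<alpha> has no component along \<open>jj c\<close>,
    neither \<open>wedge a c\<close> nor \<open>wedge (jj a) (jj c)\<close> appears.\<close>
  have szzb: "d_zbar (d_z \<sigma>) v = (x + cnj x + (k * cnj k + l * cnj l)) *s wedge a (jj a) +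
      cnj z *s wedge a (jj c) + z *s wedge c (jj a) + wedge c (jj c)"
    unfolding d_zbar_d_z_\<sigma>[OF v] kl xyz unfolding a_def[symmetric] c_def[symmetric]
    by (simp add: wedge_bilin jj_add jj_scale wedge_swap[of "jj a" a] vec_eq_iff algebra_simps)
  have e1: "wedge a (jj c) = d_z \<sigma> v - k *s \<sigma> v" and e2: "wedge c (jj a) = d_zbar \<sigma> v - cnj k *s \<sigma> v"
    by (simp_all add: sz szb s)
  have e3: "wedge c (jj c) = d_zbar (d_z \<sigma>) v - (x + cnj x + (k * cnj k + l * cnj l)) *s wedge a (jj a) -
      cnj z *s wedge a (jj c) - z *s wedge c (jj a)"
    unfolding szzb by simp
  have s': "wedge a (jj a) = \<sigma> v" by (simp add: s)
  have A: "\<sigma> v \<in> vec.span S" if "wedge a (jj a) \<in> S" for S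
    unfolding s by (intro vec.span_base that)
  have B: "d_z \<sigma> v \<in> vec.span S" if "wedge a (jj a) \<in> S" "wedge a (jj c) \<in> S" for S
    unfolding sz by (intro vec.span_add vec.span_scale vec.span_base that)
  have C: "d_zbar \<sigma> v \<in> vec.span S" if "wedge a (jj a) \<in> S" "wedge c (jj a) \<in> S" for S
    unfolding szb by (intro vec.span_add vec.span_scale vec.span_base that)
  have D: "d_zbar (d_z \<sigma>) v \<in> vec.span S"
    if "wedge a (jj a) \<in> S" "wedge a (jj c) \<in> S" "wedge c (jj a) \<in> S" "wedge c (jj c) \<in> S" for S
    unfolding szzb by (intro vec.span_add vec.span_scale vec.span_base that)
  have A': "wedge a (jj a) \<in> vec.span S" if "\<sigma> v \<in> S" for S
    unfolding s' by (intro vec.span_base that)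
  have B': "wedge a (jj c) \<in> vec.span S" if "\<sigma> v \<in> S" "d_z \<sigma> v \<in> S" for S
    unfolding e1 by (intro vec.span_diff vec.span_scale vec.span_base that)
  have C': "wedge c (jj a) \<in> vec.span S" if "\<sigma> v \<in> S" "d_zbar \<sigma> v \<in> S" for S
    unfolding e2 by (intro vec.span_diff vec.span_scale vec.span_base that)
  have D': "wedge c (jj c) \<in> vec.span S"
    if "\<sigma> v \<in> S" "d_z \<sigma> v \<in> S" "d_zbar \<sigma> v \<in> S" "d_zbar (d_z \<sigma>) v \<in> S" for S
    unfolding e3 by (intro vec.span_diff vec.span_scale A' B' C' vec.span_base that)
  show "vec.span {\<sigma> v, d_z \<sigma> v, d_zbar \<sigma> v} = vec.span {wedge a (jj a), wedge a (jj c), wedge c (jj a)}"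
  proof
    show "vec.span {\<sigma> v, d_z \<sigma> v, d_zbar \<sigma> v} \<subseteq> vec.span {wedge a (jj a), wedge a (jj c), wedge c (jj a)}"
      by (rule vec.span_minimal) (simp_all add: A B C)
    show "vec.span {wedge a (jj a), wedge a (jj c), wedge c (jj a)} \<subseteq> vec.span {\<sigma> v, d_z \<sigma> v, d_zbar \<sigma> v}"
      by (rule vec.span_minimal) (simp_all add: A' B' C')
  qed
  show "vec.span {\<sigma> v, d_z \<sigma> v, d_zbar \<sigma> v, d_zbar (d_z \<sigma>) v} =
      vec.span {wedge a (jj a), wedge a (jj c), wedge c (jj a), wedge c (jj c)}"
  proof
    show "vec.span {\<sigma> v, d_z \<sigma> v, d_zbar \<sigma> v, d_zbar (d_z \<sigma>) v} \<subseteq>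
        vec.span {wedge a (jj a), wedge a (jj c), wedge c (jj a), wedge c (jj c)}"
      by (rule vec.span_minimal) (simp_all add: A B C D)
    show "vec.span {wedge a (jj a), wedge a (jj c), wedge c (jj a), wedge c (jj c)} \<subseteq>
        vec.span {\<sigma> v, d_z \<sigma> v, d_zbar \<sigma> v, d_zbar (d_z \<sigma>) v}"
      by (rule vec.span_minimal) (simp_all add: A' B' C' D')
  qed
qed

text \<open>The fibre of \<Lambda> is a line, so two lifts are proportional with a nonzero factor,
  and \<open>proportional_sections_span\<close> applies in both directions.\<close>

lemma span_any_lift:
  assumes v: "v \<in> W" and \<tau>: "real_lift U P W' \<tau>" "v \<in> W'"
  shows "vec.span {\<tau> v, d_z \<tau> v, d_zbar \<tau> v} = vec.span {\<sigma> v, d_z \<sigma> v, d_zbar \<sigma> v}"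
    "vec.span {\<tau> v, d_z \<tau> v, d_zbar \<tau> v, d_zbar (d_z \<tau>) v} =
      vec.span {\<sigma> v, d_z \<sigma> v, d_zbar \<sigma> v, d_zbar (d_z \<sigma>) v}"
proof -
  \<comment> \<open>The coordinates of the lifts at this index serve as smooth multipliers, in place
    of the ratio of the lifts.\<close>
  obtain i where i: "\<sigma> v $ i \<noteq> 0" using \<sigma>_nonzero[OF v] by (auto simp: vec_eq_iff)
  let ?W = "W \<inter> W'"
  have W': "open ?W" "v \<in> ?W" using \<tau> v W_open by (auto simp: real_lift_def)
  have sm: "smooth_on ?W \<tau>" "smooth_on ?W \<sigma>"
    using \<tau>(1) \<sigma>_lift by (auto simp: real_lift_def intro: smooth_on_subset)
  note sc = smooth_on_component[OF W'(1) sm(1), of i] smooth_on_component[OF W'(1) sm(2), of i]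
  have lift_multiple: "\<exists>k. k \<noteq> 0 \<and> \<tau> x = k *s \<sigma> x" if "x \<in> ?W" for x
  proof -
    have "\<tau> x \<in> ext2 (vec.span {\<alpha> x, jj (\<alpha> x)})" "\<tau> x \<noteq> 0"
      using that \<tau>(1) P_eq_span[of x] by (auto simp: real_lift_def)
    then obtain k where "\<tau> x = k *s \<sigma> x" "\<tau> x \<noteq> 0"
      unfolding \<sigma>_def using ext2_span_pair by blast
    then show ?thesis by auto
  qed
  have eq: "\<sigma> x $ i *s \<tau> x = \<tau> x $ i *s \<sigma> x" if x: "x \<in> ?W" for x
  proof -
    obtain k where k: "\<tau> x = k *s \<sigma> x" using lift_multiple[OF x] by blast
    show ?thesis unfolding k by (simp add: mult.commute)
  qed
  obtain k where "k \<noteq> 0" "\<tau> v = k *s \<sigma> v" using lift_multiple[OF W'(2)] by blast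
  then have i': "\<tau> v $ i \<noteq> 0" using i by simp
  note sub1 = proportional_sections_span[OF W' sm sc(2,1) eq i]
  note sub2 = proportional_sections_span[OF W' sm(2,1) sc(1,2) eq[symmetric] i']
  show "vec.span {\<tau> v, d_z \<tau> v, d_zbar \<tau> v} = vec.span {\<sigma> v, d_z \<sigma> v, d_zbar \<sigma> v}"
    by (rule subset_antisym[OF sub1(1) sub2(1)])
  show "vec.span {\<tau> v, d_z \<tau> v, d_zbar \<tau> v, d_zbar (d_z \<tau>) v} =
      vec.span {\<sigma> v, d_z \<sigma> v, d_zbar \<sigma> v, d_zbar (d_z \<sigma>) v}"
    by (rule subset_antisym[OF sub1(2) sub2(2)])
qed

lemma Lambda1_eq:
  assumes v: "v \<in> W"
  shows "Lambda1 U P v = vec.span {wedge (\<alpha> v) (jj (\<alpha> v)), wedge (\<alpha> v) (jj (d_zbar \<alpha> v)), wedge (d_zbar \<alpha> v) (jj (\<alpha> v))}"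
proof -
  have "Lambda1 U P v = vec.span {\<sigma> v, d_z \<sigma> v, d_zbar \<sigma> v}"
    unfolding Lambda1_def
  proof (rule UN_pairs_const)
    fix W' \<tau> assume "real_lift U P W' \<tau> \<and> v \<in> W'"
    then show "vec.span {\<tau> v, d_z \<tau> v, d_zbar \<tau> v} = vec.span {\<sigma> v, d_z \<sigma> v, d_zbar \<sigma> v}"
      by (elim conjE) (rule span_any_lift(1)[OF v])
  next
    show "real_lift U P W \<sigma> \<and> v \<in> W" using \<sigma>_lift v by (rule conjI)
  qed
  then show ?thesis by (simp only: span_lift(1)[OF v])
qed

lemma central_sphere_eq:
  assumes v: "v \<in> W"
  shows "central_sphere U P v = adapted_frame.Vplus (\<alpha> v) (d_zbar \<alpha> v)"
proof -
  interpret fr: adapted_frame dt "\<alpha> v" "d_zbar \<alpha> v" "T v" by (rule frame[OF v])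
  have "central_sphere U P v = vec.span {\<sigma> v, d_z \<sigma> v, d_zbar \<sigma> v, d_zbar (d_z \<sigma>) v}"
    unfolding central_sphere_def
  proof (rule UN_pairs_const)
    fix W' \<tau> assume "real_lift U P W' \<tau> \<and> v \<in> W'"
    then show "vec.span {\<tau> v, d_z \<tau> v, d_zbar \<tau> v, d_zbar (d_z \<tau>) v} =
        vec.span {\<sigma> v, d_z \<sigma> v, d_zbar \<sigma> v, d_zbar (d_z \<sigma>) v}"
      by (elim conjE) (rule span_any_lift(2)[OF v])
  next
    show "real_lift U P W \<sigma> \<and> v \<in> W" using \<sigma>_lift v by (rule conjI)
  qed
  then show ?thesis by (simp only: span_lift(2)[OF v] fr.Vplus_def)
qed

end

subsection \<open>Comparison of the connections\<close>

context mcs_chart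
begin

lemma adapted_section_at:
  assumes "u \<in> U"
  obtains W \<alpha> where "adapted_section dt U P T W \<alpha>" "u \<in> W"
proof -
  obtain W \<alpha> where "u \<in> W" "local_section U P W \<alpha>" "\<forall>v\<in>W. \<alpha> v \<noteq> 0 \<and> T v (\<alpha> v) = \<i> *s \<alpha> v"
    using adapted_section_exists[OF assms] by blast
  then have "adapted_section dt U P T W \<alpha>" by unfold_locales auto
  then show thesis using \<open>u \<in> W\<close> by (rule that)
qed

abbreviation V :: "complex \<Rightarrow> bivec set" where "V \<equiv> central_sphere U P"

text \<open>The frame disappears from the right-hand sides, so the projections can be differentiated
  over all of \<open>U\<close>.\<close>

lemma biv_proj_V:
  assumes u: "u \<in> U" and B: "B \<in> bivectors"
  shows "biv_proj dt (V u) B = (1 / 2) *s (B + biv_map (T u) B)"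
    "biv_proj dt (biv_perp dt (V u)) B = (1 / 2) *s (B - biv_map (T u) B)"
proof -
  obtain W \<alpha> where "adapted_section dt U P T W \<alpha>" and v: "u \<in> W"
    using adapted_section_at[OF u] .
  then interpret adapted_section dt U P T W \<alpha> by simp
  interpret fr: adapted_frame dt "\<alpha> u" "d_zbar \<alpha> u" "T u" by (rule frame[OF v])
  show "biv_proj dt (V u) B = (1 / 2) *s (B + biv_map (T u) B)"
    "biv_proj dt (biv_perp dt (V u)) B = (1 / 2) *s (B - biv_map (T u) B)"
    unfolding central_sphere_eq[OF v] by (rule fr.biv_proj_Vplus[OF B] fr.biv_proj_perp_Vplus[OF B])+
qed

text \<open>The pointwise statement with the frame eliminated: everything is expressed through
  \<open>lower F\<close>, which depends on \<open>F\<close> alone.\<close>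

lemma skew_op_imp_nilpotent:
  assumes u: "u \<in> U"
    and F: "\<exists>A\<in>ext2 (P u). \<exists>B\<in>Lambda1 U P u. \<forall>w\<in>bivectors. F w = skew_op dt A B w"
  shows "clinear_on UNIV (lower F)" "w \<in> P u \<Longrightarrow> lower F w = 0" "lower F w \<in> P u"
    "T u (lower F w) = lower F (T u w)" "B \<in> bivectors \<Longrightarrow> F B = biv_der (lower F) B"
proof -
  obtain W \<alpha> where "adapted_section dt U P T W \<alpha>" and v: "u \<in> W"
    using adapted_section_at[OF u] .
  then interpret adapted_section dt U P T W \<alpha> by simp
  interpret fr: adapted_frame dt "\<alpha> u" "d_zbar \<alpha> u" "T u" by (rule frame[OF v])
  obtain A B where A: "A \<in> ext2 (P u)" and B: "B \<in> Lambda1 U P u"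
    and F: "\<And>w. w \<in> bivectors \<Longrightarrow> F w = skew_op dt A B w"
    using F by blast
  have low: "lower F = lower (skew_op dt A B)" by (rule lower_cong[OF F])
  obtain q where q: "clinear_on UNIV q" "\<forall>v\<in>P u. q v = 0" "\<forall>v. q v \<in> P u" "\<forall>v. T u (q v) = q (T u v)"
    "lower (skew_op dt A B) = q" "\<forall>w\<in>bivectors. skew_op dt A B w = biv_der q w"
    using fr.skew_op_imp_nilpotent A B unfolding P_eq_span[OF v] Lambda1_eq[OF v] by metis
  show "clinear_on UNIV (lower F)" "w \<in> P u \<Longrightarrow> lower F w = 0" "lower F w \<in> P u"
    "T u (lower F w) = lower F (T u w)" "B \<in> bivectors \<Longrightarrow> F B = biv_der (lower F) B" for B
    using q F unfolding low q(5) by simp_all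
qed

lemma nilpotent_imp_skew_op:
  assumes u: "u \<in> U" and q: "clinear_on UNIV q" "\<And>w. w \<in> P u \<Longrightarrow> q w = 0" "\<And>w. q w \<in> P u"
    "\<And>w. T u (q w) = q (T u w)"
  shows "\<exists>A\<in>ext2 (P u). \<exists>B\<in>Lambda1 U P u. \<forall>w\<in>bivectors. biv_der q w = skew_op dt A B w"
proof -
  obtain W \<alpha> where "adapted_section dt U P T W \<alpha>" and v: "u \<in> W"
    using adapted_section_at[OF u] .
  then interpret adapted_section dt U P T W \<alpha> by simp
  interpret fr: adapted_frame dt "\<alpha> u" "d_zbar \<alpha> u" "T u" by (rule frame[OF v])
  show ?thesis
    using fr.nilpotent_imp_skew_op[OF q(1) _ _ q(4)] q(2,3)
    unfolding P_eq_span[OF v] Lambda1_eq[OF v] by simp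
qed

lemma biv_map_T_T:
  assumes u: "u \<in> U" and B: "B \<in> bivectors"
  shows "biv_map (T u) (biv_map (T u) B) = B"
  using B
  by (induction rule: bivectors_induct)
    (simp_all add: biv_map_wedge T_clinear[OF u] T_T[OF u] wedge_bilin
      clinear_add[OF clinear_biv_map] clinear_scale[OF clinear_biv_map])

lemma clinear_dT: "u \<in> U \<Longrightarrow> clinear_on UNIV (\<lambda>w. dd (\<lambda>v. T v w) u X)"
  by (rule clinear_dd_operator[OF open_U T_clinear T_smooth])

lemma clinear_N_S: "u \<in> U \<Longrightarrow> clinear_on UNIV (N_S T u X)"
  by (rule clinearI)
    (simp_all add: N_S_def clinear_add[OF clinear_dT] clinear_scale[OF clinear_dT] clinear_add[OF T_clinear]
      clinear_scale[OF T_clinear] vec.scale_right_distrib mult.commute)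

lemma smooth_N_S: "smooth_on U (\<lambda>v. N_S T v X w)"
  unfolding N_S_def
  by (intro smooth_on_scale[OF open_U] smooth_on_operator_apply[OF open_U T_clinear T_smooth]
      smooth_on_dd T_smooth)

lemma dT_differentiable: "u \<in> U \<Longrightarrow> (\<lambda>v. T v w) differentiable (at u)"
  by (rule smooth_on_differentiable[OF T_smooth])

text \<open>The product rule leaves one factor of \<open>v \<and> w\<close> undifferentiated;
  applying \<open>T\<close> a second time turns it into its negative. The constant -2 absorbs the
  1/2 in \<open>N_S\<close>.\<close>

lemma biv_map_dd_biv_map:
  assumes u: "u \<in> U" and B: "B \<in> bivectors"
  shows "biv_map (T u) (dd (\<lambda>v. biv_map (T v) B) u X) = (- 2) *s biv_der (N_S T u X) B"
proof -
  have d: "(\<lambda>v. biv_map (T v) B) differentiable (at u)" for B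
    by (rule smooth_on_differentiable[OF smooth_on_biv_map[OF open_U T_smooth] u])
  note lins = clinear_add[OF clinear_biv_map] clinear_scale[OF clinear_biv_map]
    clinear_add[OF clinear_biv_der] clinear_scale[OF clinear_biv_der]
  show ?thesis
    using B
  proof (induction rule: bivectors_induct)
    case (wedge x y)
    let ?D = "\<lambda>w. dd (\<lambda>v. T v w) u X"
    have "dd (\<lambda>v. biv_map (T v) (wedge x y)) u X = dd (\<lambda>v. wedge (T v x) (T v y)) u X"
      by (rule fun_cong[OF dd_cong_open[OF open_U u biv_map_wedge[OF T_clinear]]])
    also have "\<dots> = wedge (?D x) (T u y) + wedge (T u x) (?D y)"
      by (rule dd_wedge[OF dT_differentiable[OF u] dT_differentiable[OF u]])
    finally have "biv_map (T u) (dd (\<lambda>v. biv_map (T v) (wedge x y)) u X) =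
        - (wedge (T u (?D x)) y + wedge x (T u (?D y)))"
      by (simp add: lins biv_map_wedge T_clinear[OF u] T_T[OF u] wedge_bilin)
    also have "\<dots> = (- 2) *s biv_der (N_S T u X) (wedge x y)"
      unfolding biv_der_wedge[OF clinear_N_S[OF u]] N_S_def wedge_bilin
      by (simp add: vec_eq_iff)
    finally show ?case .
  next
    case (add A B)
    then show ?case by (simp add: lins dd_add d vec.scale_right_distrib)
  next
    case (scale k B)
    then show ?case by (simp add: lins dd_scale d mult.commute)
  qed
qed

text \<open>In terms of the reflection \<open>R\<close> in \<open>V\<close>, the connection is \<open>d + 1/2 R dR\<close>.\<close>

lemma D_V_eq:
  assumes u: "u \<in> U" and sm: "smooth_on U s" and biv: "\<And>v. v \<in> U \<Longrightarrow> s v \<in> bivectors"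
  shows "D_V dt V s u X = dd s u X - biv_der (N_S T u X) (s u)"
proof -
  note s = smooth_on_differentiable[OF sm u] biv
  define R where "R v = biv_map (T v)" for v
  define x where "x = dd s u X"
  define y where "y = dd (\<lambda>v. R v (s v)) u X"
  have R: "clinear_on UNIV (R v)" "smooth_on U (\<lambda>v. R v B)" for v B
    unfolding R_def by (rule clinear_biv_map smooth_on_biv_map[OF open_U T_smooth])+
  have Rs: "R v (s v) \<in> bivectors" for v unfolding R_def by (rule biv_map_in_bivectors)
  have y: "y = dd (\<lambda>v. R v (s u)) u X + R u x"
    unfolding y_def x_def by (rule dd_operator_apply[OF open_U R u s(1)])
  have dRs: "(\<lambda>v. R v (s v)) differentiable (at u)"
    by (rule smooth_on_differentiable[OF smooth_on_operator_apply[OF open_U R sm] u])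
  have xb: "x \<in> bivectors" unfolding x_def by (rule dd_in_bivectors[OF open_U u s(2) s(1)])
  have yb: "y \<in> bivectors" unfolding y_def by (rule dd_in_bivectors[OF open_U u Rs dRs])
  have "dd (\<lambda>v. biv_proj dt (V v) (s v)) u X = dd (\<lambda>v. (1 / 2) *s (s v + R v (s v))) u X"
    unfolding R_def by (rule fun_cong[OF dd_cong_open[OF open_U u biv_proj_V(1)[OF _ s(2)]]])
  also have "\<dots> = (1 / 2) *s (x + y)"
    by (simp only: dd_scale dd_add s(1) dRs differentiable_add x_def y_def)
  finally have p: "dd (\<lambda>v. biv_proj dt (V v) (s v)) u X = (1 / 2) *s (x + y)" .
  have "dd (\<lambda>v. biv_proj dt (biv_perp dt (V v)) (s v)) u X = dd (\<lambda>v. (1 / 2) *s (s v - R v (s v))) u X"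
    unfolding R_def by (rule fun_cong[OF dd_cong_open[OF open_U u biv_proj_V(2)[OF _ s(2)]]])
  also have "\<dots> = (1 / 2) *s (x - y)"
    by (simp only: dd_scale dd_diff s(1) dRs differentiable_diff x_def y_def)
  finally have m: "dd (\<lambda>v. biv_proj dt (biv_perp dt (V v)) (s v)) u X = (1 / 2) *s (x - y)" .
  have b: "(1 / 2) *s (x + y) \<in> bivectors" "(1 / 2) *s (x - y) \<in> bivectors"
    by (intro vec.subspace_scale vec.subspace_add vec.subspace_diff subspace_bivectors xb yb)+
  have "D_V dt V s u X = (1 / 2) *s ((1 / 2) *s (x + y) + R u ((1 / 2) *s (x + y))) +
      (1 / 2) *s ((1 / 2) *s (x - y) - R u ((1 / 2) *s (x - y)))"
    unfolding D_V_def p m biv_proj_V[OF u b(1)] biv_proj_V[OF u b(2)] R_def ..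
  also have "\<dots> = (1 / 2) *s (x + R u y)"
    by (simp add: clinear_add[OF R(1)] clinear_diff[OF R(1)] clinear_scale[OF R(1)] vec_eq_iff algebra_simps)
  \<comment> \<open>The two terms of the product rule for \<open>R s\<close>: the first is
    \<open>R dR\<close> applied to \<open>s\<close>, the second returns \<open>x\<close> because
    \<open>R\<close> is an involution.\<close>
  also have "R u y = (- 2) *s biv_der (N_S T u X) (s u) + x"
    unfolding y clinear_add[OF R(1)] unfolding R_def
    by (simp only: biv_map_dd_biv_map[OF u s(2)[OF u]] biv_map_T_T[OF u xb])
  finally show ?thesis by (simp add: x_def vec_eq_iff algebra_simps)
qed

lemma D_V_const:
  assumes "u \<in> U" "B \<in> bivectors"
  shows "D_V dt V (\<lambda>_. B) u X = - biv_der (N_S T u X) B"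
  using D_V_eq[OF assms(1) smooth_on_const, of B] assms(2) by (simp add: dd_const)

lemma N_V_eq: "u \<in> U \<Longrightarrow> B \<in> bivectors \<Longrightarrow> N_V dt V u X B = biv_der (N_S T u X) B"
  by (simp add: N_V_def dd_const D_V_const)

section \<open>Transport of the equations along \<rho>\<close>

definition operator_form :: "(complex \<Rightarrow> complex \<Rightarrow> cvec4 \<Rightarrow> cvec4) \<Rightarrow> bool" where
  "operator_form \<theta> \<longleftrightarrow> (\<forall>v\<in>U. \<forall>X. clinear_on UNIV (\<theta> v X)) \<and> (\<forall>X w. smooth_on U (\<lambda>v. \<theta> v X w))"

text \<open>Agreement is asked on bivectors only, since a form with values in the endomorphisms of
  that fibre is unconstrained elsewhere.\<close>

definition induces :: "(complex \<Rightarrow> complex \<Rightarrow> cvec4 \<Rightarrow> cvec4) \<Rightarrow> (complex \<Rightarrow> complex \<Rightarrow> bivec \<Rightarrow> bivec) \<Rightarrow> bool" where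
  "induces \<theta> Q \<longleftrightarrow> (\<forall>v\<in>U. \<forall>X. \<forall>B\<in>bivectors. Q v X B = biv_der (\<theta> v X) B)"

lemma operator_form_star_N_S: "operator_form (star (N_S T))"
  unfolding operator_form_def star_def
  by (auto intro!: clinearI smooth_on_minus[OF open_U] smooth_N_S
      simp: clinear_add[OF clinear_N_S] clinear_scale[OF clinear_N_S])

lemma induces_star_N: "induces (star (N_S T)) (star (N_V dt V))"
  by (simp add: induces_def star_def[abs_def] N_V_eq biv_der_neg)

lemma endo_cov_D_S:
  assumes u: "u \<in> U" and \<theta>: "operator_form \<theta>"
  shows "endo_cov (D_S T) (\<lambda>v. \<theta> v Y) u X w =
    dd (\<lambda>v. \<theta> v Y w) u X - (N_S T u X (\<theta> u Y w) - \<theta> u Y (N_S T u X w))"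
proof -
  have "clinear_on UNIV (\<theta> u Y)" using \<theta> u by (simp add: operator_form_def)
  then show ?thesis by (simp add: endo_cov_def D_S_def dd_const clinear_neg)
qed

text \<open>Both connections are the flat derivative minus an endomorphism, so the covariant
  derivative of an operator is its derivative minus a commutator with that endomorphism, and
  \<open>\<rho>\<close> respects both terms.\<close>

lemma endo_cov_D_V:
  assumes u: "u \<in> U" and \<theta>: "operator_form \<theta>" and Q: "induces \<theta> Q" and B: "B \<in> bivectors"
  shows "endo_cov (D_V dt V) (\<lambda>v. Q v Y) u X B = biv_der (endo_cov (D_S T) (\<lambda>v. \<theta> v Y) u X) B"
proof -
  have cl: "clinear_on UNIV (\<theta> v Y)" if "v \<in> U" for v using \<theta> that by (simp add: operator_form_def)
  have sm: "smooth_on U (\<lambda>v. \<theta> v Y w)" for w using \<theta> by (simp add: operator_form_def)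
  have Q': "Q v Y B = biv_der (\<theta> v Y) B" if "v \<in> U" "B \<in> bivectors" for v B
    using Q that by (simp add: induces_def)
  define N where "N = N_S T u X"
  have N: "clinear_on UNIV N" unfolding N_def by (rule clinear_N_S[OF u])
  have smQ: "smooth_on U (\<lambda>v. Q v Y B)"
    by (rule smooth_on_cong[OF open_U Q'[symmetric] smooth_on_biv_der[OF open_U sm]]) (use B in auto)
  have "D_V dt V (\<lambda>v. Q v Y B) u X = dd (\<lambda>v. Q v Y B) u X - biv_der N (Q u Y B)"
    unfolding N_def
    by (rule D_V_eq[OF u smQ]) (simp add: Q' B biv_der_in_bivectors)
  also have "dd (\<lambda>v. Q v Y B) u X = dd (\<lambda>v. biv_der (\<theta> v Y) B) u X"
    by (rule fun_cong[OF dd_cong_open[OF open_U u Q'[OF _ B]]])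
  also have "\<dots> = biv_der (\<lambda>w. dd (\<lambda>v. \<theta> v Y w) u X) B"
    by (rule dd_biv_der[OF open_U u cl sm B])
  finally have 1: "D_V dt V (\<lambda>v. Q v Y B) u X =
      biv_der (\<lambda>w. dd (\<lambda>v. \<theta> v Y w) u X) B - biv_der N (biv_der (\<theta> u Y) B)"
    by (simp only: Q'[OF u B])
  \<comment> \<open>A constant section has covariant derivative \<open>- \<rho>(N)\<close>; this
    supplies the second half of the commutator.\<close>
  have "Q u Y (D_V dt V (\<lambda>_. B) u X) = - biv_der (\<theta> u Y) (biv_der N B)"
    unfolding D_V_const[OF u B] N_def[symmetric]
    by (simp add: Q'[OF u] vec.subspace_neg[OF subspace_bivectors] biv_der_in_bivectors clinear_neg[OF clinear_biv_der])
  then have "endo_cov (D_V dt V) (\<lambda>v. Q v Y) u X B = biv_der (\<lambda>w. dd (\<lambda>v. \<theta> v Y w) u X) B -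
      (biv_der N (biv_der (\<theta> u Y) B) - biv_der (\<theta> u Y) (biv_der N B))"
    unfolding endo_cov_def 1 by simp
  also have "\<dots> = biv_der (\<lambda>w. dd (\<lambda>v. \<theta> v Y w) u X - (N (\<theta> u Y w) - \<theta> u Y (N w))) B"
    unfolding biv_der_commutator[OF N cl[OF u] B] by (rule biv_der_diff[symmetric])
  also have "(\<lambda>w. dd (\<lambda>v. \<theta> v Y w) u X - (N (\<theta> u Y w) - \<theta> u Y (N w))) =
      endo_cov (D_S T) (\<lambda>v. \<theta> v Y) u X"
    by (simp add: fun_eq_iff endo_cov_D_S[OF u \<theta>] N_def)
  finally show ?thesis .
qed

lemma ext_d_D_V:
  assumes "u \<in> U" "operator_form \<theta>" "induces \<theta> Q" "B \<in> bivectors"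
  shows "ext_d (D_V dt V) Q u X Y B = biv_der (ext_d (D_S T) \<theta> u X Y) B"
  unfolding ext_d_def endo_cov_D_V[OF assms] by (rule biv_der_diff[symmetric])

lemma bracket_wedge_induced:
  assumes u: "u \<in> U" and \<theta>: "operator_form \<theta>" "operator_form \<eta>" and Q: "induces \<theta> Q" "induces \<eta> R"
    and B: "B \<in> bivectors"
  shows "bracket_wedge Q R u X Y B = biv_der (bracket_wedge \<theta> \<eta> u X Y) B"
proof -
  have cl: "clinear_on UNIV (\<theta> u X)" "clinear_on UNIV (\<eta> u X)" for X
    using \<theta> u by (simp_all add: operator_form_def)
  have Q': "Q u X C = biv_der (\<theta> u X) C" "R u X C = biv_der (\<eta> u X) C" if "C \<in> bivectors" for X C
    using Q u that by (simp_all add: induces_def)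
  show ?thesis
    unfolding bracket_wedge_def
    by (simp only: Q' B biv_der_in_bivectors biv_der_commutator[OF cl(1) cl(2) B] biv_der_diff)
qed

lemma clinear_ext_d:
  assumes u: "u \<in> U" and \<theta>: "operator_form \<theta>"
  shows "clinear_on UNIV (ext_d (D_S T) \<theta> u X Y)"
proof -
  have cl: "clinear_on UNIV (\<theta> u Y)" "clinear_on UNIV (\<lambda>w. dd (\<lambda>v. \<theta> v Y w) u X)" for X Y
    using \<theta> u clinear_dd_operator[OF open_U, of "\<lambda>v. \<theta> v Y" u X] by (simp_all add: operator_form_def)
  show ?thesis
    unfolding ext_d_def endo_cov_D_S[OF u \<theta>]
    by (rule clinearI)
      (simp_all add: clinear_add[OF cl(1)] clinear_scale[OF cl(1)] clinear_add[OF cl(2)] clinear_scale[OF cl(2)]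
        clinear_add[OF clinear_N_S[OF u]] clinear_scale[OF clinear_N_S[OF u]] vec_eq_iff algebra_simps)
qed

lemma clinear_bracket_wedge:
  assumes u: "u \<in> U" and \<theta>: "operator_form \<theta>" "operator_form \<eta>"
  shows "clinear_on UNIV (bracket_wedge \<theta> \<eta> u X Y)"
proof -
  have cl: "clinear_on UNIV (\<theta> u X)" "clinear_on UNIV (\<eta> u X)" for X
    using \<theta> u by (simp_all add: operator_form_def)
  show ?thesis
    unfolding bracket_wedge_def
    by (rule clinearI)
      (simp_all add: clinear_add[OF cl(1)] clinear_scale[OF cl(1)] clinear_add[OF cl(2)] clinear_scale[OF cl(2)]
        vec_eq_iff algebra_simps)
qed

text \<open>The bivector equation is \<open>\<rho>\<close> of the spinor equation. Injectivity of
  \<open>\<rho>\<close>, which requires complex linearity of the exterior derivative, recovers the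
  latter.\<close>

lemma closed_iff:
  assumes u: "u \<in> U" and \<theta>: "operator_form \<theta>" "induces \<theta> Q"
  shows "(\<forall>X Y. \<forall>w\<in>bivectors. ext_d (D_V dt V) Q u X Y w = 0) \<longleftrightarrow>
    (\<forall>X Y w. ext_d (D_S T) \<theta> u X Y w = 0)" (is "?l \<longleftrightarrow> ?r")
proof
  have z: "biv_der (\<lambda>_. 0) B = 0" for B using biv_der_scale[of 0 "\<lambda>_. 0" B] by simp
  assume ?l
  then have "ext_d (D_S T) \<theta> u X Y = (\<lambda>_. 0)" for X Y
    by (intro biv_der_inject[OF clinear_ext_d[OF u \<theta>(1)]])
      (simp_all add: z ext_d_D_V[OF u \<theta>, symmetric] clinearI)
  then show ?r by simp
next
  have z: "biv_der (\<lambda>_. 0) B = 0" for B using biv_der_scale[of 0 "\<lambda>_. 0" B] by simp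
  assume ?r
  then have "ext_d (D_S T) \<theta> u X Y = (\<lambda>_. 0)" for X Y by (simp add: fun_eq_iff)
  then show ?l by (simp add: ext_d_D_V[OF u \<theta>] z)
qed

text \<open>Both sides are values of \<open>\<rho>\<close> on complex linear maps, so injectivity of
  \<open>\<rho>\<close> again lets the equation pass in both directions.\<close>

lemma euler_lagrange_iff:
  assumes u: "u \<in> U" and \<theta>: "operator_form \<theta>" "induces \<theta> Q"
  shows "(\<forall>X Y. \<forall>w\<in>bivectors. ext_d (D_V dt V) (star (N_V dt V)) u X Y w =
      2 *s bracket_wedge Q (star (N_V dt V)) u X Y w) \<longleftrightarrow>
    (\<forall>X Y w. ext_d (D_S T) (star (N_S T)) u X Y w = 2 *s bracket_wedge \<theta> (star (N_S T)) u X Y w)"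
    (is "?l \<longleftrightarrow> ?r")
proof -
  note N = operator_form_star_N_S induces_star_N
  have 1: "ext_d (D_V dt V) (star (N_V dt V)) u X Y B = biv_der (ext_d (D_S T) (star (N_S T)) u X Y) B"
    if "B \<in> bivectors" for X Y B
    by (rule ext_d_D_V[OF u N that])
  have 2: "2 *s bracket_wedge Q (star (N_V dt V)) u X Y B =
      biv_der (\<lambda>w. 2 *s bracket_wedge \<theta> (star (N_S T)) u X Y w) B"
    if "B \<in> bivectors" for X Y B
    unfolding bracket_wedge_induced[OF u \<theta>(1) N(1) \<theta>(2) N(2) that] by (rule biv_der_scale[symmetric])
  have cl: "clinear_on UNIV (\<lambda>w. 2 *s bracket_wedge \<theta> (star (N_S T)) u X Y w)" for X Y
    using clinear_bracket_wedge[OF u \<theta>(1) N(1), of X Y]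
    by (auto intro!: clinearI simp: clinear_add clinear_scale vec.scale_right_distrib mult.commute)
  show ?thesis
  proof
    assume l: ?l
    have "ext_d (D_S T) (star (N_S T)) u X Y = (\<lambda>w. 2 *s bracket_wedge \<theta> (star (N_S T)) u X Y w)" for X Y
    proof (rule biv_der_inject[OF clinear_ext_d[OF u N(1)] cl])
      fix B assume B: "B \<in> bivectors"
      have "biv_der (ext_d (D_S T) (star (N_S T)) u X Y) B = 2 *s bracket_wedge Q (star (N_V dt V)) u X Y B"
        using l B by (simp only: 1[OF B, symmetric])
      then show "biv_der (ext_d (D_S T) (star (N_S T)) u X Y) B =
          biv_der (\<lambda>w. 2 *s bracket_wedge \<theta> (star (N_S T)) u X Y w) B"
        by (simp only: 2[OF B])
    qed
    then show ?r by (simp add: fun_eq_iff)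
  next
    assume ?r
    then have "ext_d (D_S T) (star (N_S T)) u X Y = (\<lambda>w. 2 *s bracket_wedge \<theta> (star (N_S T)) u X Y w)" for X Y
      by (simp add: fun_eq_iff)
    then show ?l by (intro allI ballI) (simp only: 1 2)
  qed
qed

text \<open>Both sides vanish on \<open>L\<close>, so by linearity only
  \<open>c = d_zbar \<alpha>\<close> and \<open>jj c\<close> remain to be tested. There the symmetry
  \<open>q X (dd r u Y) = q Y (dd r u X)\<close> makes \<open>q X c\<close> conjugate linear and
  \<open>q X (jj c)\<close> complex linear in \<open>X\<close>, in accordance with the eigenvalues
  of \<open>T\<close>.\<close>

lemma closed_imp_star:
  assumes u: "u \<in> U" and q: "operator_form q"
    and lin: "\<And>w. linear (\<lambda>X. q u X w)"
    and ker: "\<And>v X w. v \<in> U \<Longrightarrow> w \<in> P v \<Longrightarrow> q v X w = 0"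
    and closed: "\<And>X Y w. ext_d (D_S T) q u X Y w = 0"
  shows "star q u X w = q u X (T u w)"
proof -
  obtain W \<alpha> where "adapted_section dt U P T W \<alpha>" and uW: "u \<in> W"
    using adapted_section_at[OF u] .
  then interpret adapted_section dt U P T W \<alpha> by simp
  interpret fr: adapted_frame dt "\<alpha> u" "d_zbar \<alpha> u" "T u" by (rule frame[OF uW])
  have cl: "clinear_on UNIV (q v X)" if "v \<in> U" for v X using q that by (simp add: operator_form_def)
  have sm: "smooth_on U (\<lambda>v. q v X w)" for X w using q by (simp add: operator_form_def)
  have smW: "smooth_on W (\<lambda>v. q v X w)" for X w by (rule smooth_on_subset[OF sm W_U])
  have sym: "q u X (dd r u Y) = q u Y (dd r u X)" if r: "local_section U P W r" for r X Y
  proof -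
    note r' = local_sectionD[OF r]
    have dr: "r differentiable (at u)" by (rule smooth_on_differentiable[OF r'(3) uW])
    \<comment> \<open>Differentiation of the identity \<open>q Y r = 0\<close>, valid for every
      section \<open>r\<close> of \<open>L\<close>.\<close>
    have e: "endo_cov (D_S T) (\<lambda>v. q v Y) u X (r u) = - q u Y (dd r u X)" for X Y
    proof -
      have "dd (\<lambda>v. q v Y (r v)) u X = dd (\<lambda>v. 0) u X"
        by (rule fun_cong[OF dd_cong_open[OF W_open uW ker[OF W_in_U r'(4)]]])
      moreover have "dd (\<lambda>v. q v Y (r v)) u X = dd (\<lambda>v. q v Y (r u)) u X + q u Y (dd r u X)"
        by (rule dd_operator_apply[OF W_open cl[OF W_in_U] smW uW dr])
      ultimately have "dd (\<lambda>v. q v Y (r u)) u X = - q u Y (dd r u X)"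
        by (simp add: dd_const eq_neg_iff_add_eq_0)
      \<comment> \<open>Since \<open>S\<close> and \<open>dS\<close> preserve \<open>L\<close>, so
        does \<open>N_S\<close>; hence both terms of the commutator vanish on
        \<open>r\<close>.\<close>
      moreover have "N_S T u X (r u) \<in> P u"
        unfolding N_S_def by (intro vec.subspace_scale[OF P_subspace[OF u]] T_P[OF u] dT_P[OF u] r'(4)[OF uW])
      ultimately show ?thesis
        by (simp add: endo_cov_D_S[OF u q] ker[OF u] r'(4)[OF uW] clinear_zero[OF clinear_N_S[OF u]])
    qed
    show ?thesis using closed[of X Y "r u"] by (simp add: ext_d_def e)
  qed
  define c where "c = d_zbar \<alpha> u"
  define p where "p = d_z \<alpha> u"
  have p: "q u X p = 0" "q u X (jj p) = 0" for X
    using ker[OF u] d_z_\<alpha>[OF uW] P_jj[OF u] by (simp_all add: p_def)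
  note cu = cl[OF u]
  have j\<alpha>: "local_section U P W (\<lambda>v. jj (\<alpha> v))"
    using \<alpha>_section W_in_U by (auto simp: local_section_def intro!: smooth_on_jj P_jj)
  have d: "dd \<alpha> u 1 = p + c" "dd \<alpha> u \<i> = \<i> *s p - \<i> *s c"
    unfolding dd_one dd_i p_def c_def by (rule refl)+
  have "q u \<i> (dd \<alpha> u 1) = q u 1 (dd \<alpha> u \<i>)" by (rule sym[OF \<alpha>_section])
  \<comment> \<open>The \<open>d_z\<close> parts lie in \<open>L\<close> and are killed; only the
    \<open>d_zbar\<close> parts, with factors 1 and \<open>- \<i>\<close>, survive.\<close>
  then have qc: "q u \<i> c = (- \<i>) *s q u 1 c"
    by (simp add: d clinear_add[OF cu] clinear_diff[OF cu] clinear_scale[OF cu] p)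
  have "q u \<i> (dd (\<lambda>v. jj (\<alpha> v)) u 1) = q u 1 (dd (\<lambda>v. jj (\<alpha> v)) u \<i>)" by (rule sym[OF j\<alpha>])
  then have qjc: "q u \<i> (jj c) = \<i> *s q u 1 (jj c)"
    by (simp add: dd_jj[OF \<alpha>_differentiable[OF uW]] d jj_add jj_diff jj_scale
        clinear_add[OF cu] clinear_diff[OF cu] clinear_scale[OF cu] p)
  have ex: "q u X w = of_real (Re X) *s q u 1 w + of_real (Im X) *s q u \<i> w" for X w
  proof -
    have "q u X w = q u (Re X *\<^sub>R 1 + Im X *\<^sub>R \<i>) w"
      by (rule arg_cong[where f = "\<lambda>X. q u X w"]) (simp add: complex_eq_iff)
    also have "\<dots> = Re X *\<^sub>R q u 1 w + Im X *\<^sub>R q u \<i> w"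
      by (simp only: linear_add[OF lin] linear_scale[OF lin])
    finally show ?thesis by (simp only: scaleR_eq_vec_scale)
  qed
  show ?thesis
  proof (rule fr.eq_on_frame[where f = "star q u X" and g = "\<lambda>w. q u X (T u w)"])
    show "clinear_on UNIV (star q u X)"
      by (rule clinearI) (simp_all add: star_def clinear_add[OF cu] clinear_scale[OF cu])
    show "clinear_on UNIV (\<lambda>w. q u X (T u w))" by (rule clinear_comp[OF cu T_clinear[OF u]])
    have "\<alpha> u \<in> P u" "jj (\<alpha> u) \<in> P u" using \<alpha>_P[OF uW] P_jj[OF u] by auto
    then show "star q u X (\<alpha> u) = q u X (T u (\<alpha> u))" "star q u X (jj (\<alpha> u)) = q u X (T u (jj (\<alpha> u)))"
      using ker[OF u] T_P[OF u] by (simp_all add: star_def)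
    show "star q u X (d_zbar \<alpha> u) = q u X (T u (d_zbar \<alpha> u))"
      unfolding star_def fr.T_c clinear_scale[OF cu] unfolding c_def[symmetric]
      by (simp add: ex[of X] ex[of "\<i> * X"] qc vec_eq_iff algebra_simps)
    show "star q u X (jj (d_zbar \<alpha> u)) = q u X (T u (jj (d_zbar \<alpha> u)))"
      unfolding star_def fr.T_jc clinear_scale[OF cu] unfolding c_def[symmetric]
      by (simp add: ex[of X] ex[of "\<i> * X"] qjc vec_eq_iff algebra_simps)
  qed
qed

section \<open>Translation of the 1-forms within a chart\<close>

lemma smooth_on_lower:
  assumes "\<And>w. w \<in> bivectors \<Longrightarrow> smooth_on U (\<lambda>u. F u w)"
  shows "smooth_on U (\<lambda>u. lower (F u) w)"
proof -
  have "lower F w = (\<Sum>c\<in>UNIV. ((1 / 2) * (\<Sum>b\<in>UNIV. F (wedge w (axis b 1)) $ (c, b))) *s axis c 1)" for F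
    using basis_expansion[of "lower F w"] by (simp add: lower_def)
  then show ?thesis
    by (simp only:)
      (intro smooth_on_sum[OF open_U] smooth_on_bounded_bilinear[OF bounded_bilinear_vec_scale open_U]
        smooth_on_bounded_bilinear[OF bounded_bilinear_mult open_U] smooth_on_const
        smooth_on_component[OF open_U] assms wedge_in_bivectors)
qed

text \<open>From bivectors down. The skew form of \<open>Q\<close> supplies nilpotency and
  commutation with \<open>T\<close>, closedness supplies the star condition, and reality becomes
  commutation with \<open>jj\<close>.\<close>

lemma willmore_form_lower:
  assumes lin: "\<And>u w. u \<in> U \<Longrightarrow> w \<in> bivectors \<Longrightarrow> linear (\<lambda>X. Q u X w)"
    and sm: "\<And>X w. w \<in> bivectors \<Longrightarrow> smooth_on U (\<lambda>u. Q u X w)"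
    and real: "\<And>u X w. u \<in> U \<Longrightarrow> w \<in> bivectors \<Longrightarrow> Q u X (biv_j w) = biv_j (Q u X w)"
    and skew: "\<And>u X. u \<in> U \<Longrightarrow>
      \<exists>A\<in>ext2 (P u). \<exists>B\<in>Lambda1 U P u. \<forall>w\<in>bivectors. Q u X w = skew_op dt A B w"
    and closed: "\<And>u. u \<in> U \<Longrightarrow> \<forall>X Y. \<forall>w\<in>bivectors. ext_d (D_V dt V) Q u X Y w = 0"
    and el: "\<And>u. u \<in> U \<Longrightarrow> \<forall>X Y. \<forall>w\<in>bivectors. ext_d (D_V dt V) (star (N_V dt V)) u X Y w =
      2 *s bracket_wedge Q (star (N_V dt V)) u X Y w"
  defines "\<theta> \<equiv> \<lambda>u X. lower (Q u X)"
  shows "operator_form \<theta>"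
    and "u \<in> U \<Longrightarrow> linear (\<lambda>X. \<theta> u X w)"
    and "u \<in> U \<Longrightarrow> \<theta> u X (jj w) = jj (\<theta> u X w)"
    and "u \<in> U \<Longrightarrow> w \<in> P u \<Longrightarrow> \<theta> u X w = 0"
    and "u \<in> U \<Longrightarrow> \<theta> u X w \<in> P u"
    and "u \<in> U \<Longrightarrow> T u (\<theta> u X w) = star \<theta> u X w"
    and "u \<in> U \<Longrightarrow> star \<theta> u X w = \<theta> u X (T u w)"
    and "u \<in> U \<Longrightarrow> \<forall>X Y w. ext_d (D_S T) \<theta> u X Y w = 0"
    and "u \<in> U \<Longrightarrow> \<forall>X Y w. ext_d (D_S T) (star (N_S T)) u X Y w =
      2 *s bracket_wedge \<theta> (star (N_S T)) u X Y w"
proof -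
  have cl: "clinear_on UNIV (\<theta> u X)" if "u \<in> U" for u X
    unfolding \<theta>_def by (rule skew_op_imp_nilpotent(1)[OF that skew[OF that]])
  have ker: "\<theta> u X w = 0" if "u \<in> U" "w \<in> P u" for u X w
    unfolding \<theta>_def by (rule skew_op_imp_nilpotent(2)[OF that(1) skew[OF that(1)] that(2)])
  have im: "\<theta> u X w \<in> P u" if "u \<in> U" for u X w
    unfolding \<theta>_def by (rule skew_op_imp_nilpotent(3)[OF that skew[OF that]])
  have comm: "T u (\<theta> u X w) = \<theta> u X (T u w)" if "u \<in> U" for u X w
    unfolding \<theta>_def by (rule skew_op_imp_nilpotent(4)[OF that skew[OF that]])
  have Q: "Q u X B = biv_der (\<theta> u X) B" if "u \<in> U" "B \<in> bivectors" for u X B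
    unfolding \<theta>_def by (rule skew_op_imp_nilpotent(5)[OF that(1) skew[OF that(1)] that(2)])
  have linear: "linear (\<lambda>X. \<theta> u X w)" if "u \<in> U" for u w
    unfolding \<theta>_def
    by (rule linearI)
      (simp_all add: lower_def vec_eq_iff linear_add[OF lin[OF that]] linear_scale[OF lin[OF that]]
        sum.distrib scaleR_sum_right algebra_simps)
  show form: "operator_form \<theta>"
    unfolding operator_form_def
  proof (intro conjI ballI allI)
    show "smooth_on U (\<lambda>v. \<theta> v X w)" for X w
      unfolding \<theta>_def by (rule smooth_on_lower) (rule sm)
  qed (rule cl)
  have ind: "induces \<theta> Q" using Q by (simp add: induces_def)
  show "linear (\<lambda>X. \<theta> u X w)" if "u \<in> U" by (rule linear[OF that])
  show "\<theta> u X w = 0" if "u \<in> U" "w \<in> P u" by (rule ker[OF that])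
  show "\<theta> u X w \<in> P u" if "u \<in> U" by (rule im[OF that])
  show "\<theta> u X (jj w) = jj (\<theta> u X w)" if u: "u \<in> U"
  proof (rule jj_commute_if_biv_der[OF cl[OF u]])
    fix B assume "B \<in> bivectors"
    then show "biv_der (\<theta> u X) (biv_j B) = biv_j (biv_der (\<theta> u X) B)"
      using real[OF u, of B X] Q[OF u] biv_j_in_bivectors by simp
  qed
  show cl0: "\<forall>X Y w. ext_d (D_S T) \<theta> u X Y w = 0" if u: "u \<in> U" for u
    using closed[OF u] closed_iff[OF u form ind] by blast
  show "\<forall>X Y w. ext_d (D_S T) (star (N_S T)) u X Y w =
      2 *s bracket_wedge \<theta> (star (N_S T)) u X Y w" if u: "u \<in> U"
    using el[OF u] euler_lagrange_iff[OF u form ind] by blast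
  show star: "star \<theta> u X w = \<theta> u X (T u w)" if u: "u \<in> U"
    by (rule closed_imp_star[OF u form linear[OF u] ker]) (use cl0[OF u] in blast)+
  \<comment> \<open>Commutation with \<open>T\<close> converts the one star identity into the
    other.\<close>
  show "T u (\<theta> u X w) = star \<theta> u X w" if u: "u \<in> U"
    using star[OF u] comm[OF u] by simp
qed

text \<open>From spinors up, by applying \<rho>. Nilpotency together with commutation with
  \<open>T\<close> is what places the values in \<Lambda> wedged with the first derived
  bundle.\<close>

lemma willmore_form_lift:
  assumes form: "operator_form \<theta>"
    and lin: "\<And>u w. u \<in> U \<Longrightarrow> linear (\<lambda>X. \<theta> u X w)"
    and real: "\<And>u X w. u \<in> U \<Longrightarrow> \<theta> u X (jj w) = jj (\<theta> u X w)"
    and ker: "\<And>u X w. u \<in> U \<Longrightarrow> w \<in> P u \<Longrightarrow> \<theta> u X w = 0"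
    and im: "\<And>u X w. u \<in> U \<Longrightarrow> \<theta> u X w \<in> P u"
    and comm: "\<And>u X w. u \<in> U \<Longrightarrow> T u (\<theta> u X w) = \<theta> u X (T u w)"
    and closed: "\<And>u. u \<in> U \<Longrightarrow> \<forall>X Y w. ext_d (D_S T) \<theta> u X Y w = 0"
    and el: "\<And>u. u \<in> U \<Longrightarrow> \<forall>X Y w. ext_d (D_S T) (star (N_S T)) u X Y w =
      2 *s bracket_wedge \<theta> (star (N_S T)) u X Y w"
  defines "Q \<equiv> \<lambda>u X. biv_der (\<theta> u X)"
  shows "u \<in> U \<Longrightarrow> linear (\<lambda>X. Q u X w)"
    and "smooth_on U (\<lambda>u. Q u X w)"
    and "u \<in> U \<Longrightarrow> w \<in> bivectors \<Longrightarrow> Q u X (biv_j w) = biv_j (Q u X w)"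
    and "u \<in> U \<Longrightarrow> \<exists>A\<in>ext2 (P u). \<exists>B\<in>Lambda1 U P u. \<forall>w\<in>bivectors. Q u X w = skew_op dt A B w"
    and "u \<in> U \<Longrightarrow> \<forall>X Y. \<forall>w\<in>bivectors. ext_d (D_V dt V) Q u X Y w = 0"
    and "u \<in> U \<Longrightarrow> \<forall>X Y. \<forall>w\<in>bivectors. ext_d (D_V dt V) (star (N_V dt V)) u X Y w =
      2 *s bracket_wedge Q (star (N_V dt V)) u X Y w"
proof -
  have cl: "clinear_on UNIV (\<theta> u X)" if "u \<in> U" for u X using form that by (simp add: operator_form_def)
  have sm: "smooth_on U (\<lambda>v. \<theta> v X w)" for X w using form by (simp add: operator_form_def)
  have ind: "induces \<theta> Q" by (simp add: induces_def Q_def)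
  show "linear (\<lambda>X. Q u X w)" if u: "u \<in> U"
  proof (rule linearI)
    fix X Y :: complex and r :: real
    have "\<theta> u (X + Y) = (\<lambda>v. \<theta> u X v + \<theta> u Y v)"
      by (rule ext) (rule linear_add[OF lin[OF u]])
    then show "Q u (X + Y) w = Q u X w + Q u Y w" by (simp only: Q_def biv_der_add)
    have "\<theta> u (r *\<^sub>R X) = (\<lambda>v. of_real r *s \<theta> u X v)"
      by (rule ext) (simp only: linear_scale[OF lin[OF u]] scaleR_eq_vec_scale)
    then show "Q u (r *\<^sub>R X) w = r *\<^sub>R Q u X w" by (simp only: Q_def biv_der_scale scaleR_eq_vec_scale)
  qed
  show "smooth_on U (\<lambda>u. Q u X w)" unfolding Q_def by (rule smooth_on_biv_der[OF open_U sm])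
  show "Q u X (biv_j w) = biv_j (Q u X w)" if u: "u \<in> U" and w: "w \<in> bivectors"
    unfolding Q_def by (rule biv_der_biv_j[OF cl[OF u] w real[OF u]])
  show "\<exists>A\<in>ext2 (P u). \<exists>B\<in>Lambda1 U P u. \<forall>w\<in>bivectors. Q u X w = skew_op dt A B w" if u: "u \<in> U"
    unfolding Q_def by (rule nilpotent_imp_skew_op[OF u cl[OF u] ker[OF u] im[OF u] comm[OF u]])
  show "\<forall>X Y. \<forall>w\<in>bivectors. ext_d (D_V dt V) Q u X Y w = 0" if u: "u \<in> U"
    using closed[OF u] closed_iff[OF u form ind] by blast
  show "\<forall>X Y. \<forall>w\<in>bivectors. ext_d (D_V dt V) (star (N_V dt V)) u X Y w =
      2 *s bracket_wedge Q (star (N_V dt V)) u X Y w" if u: "u \<in> U"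
    using el[OF u] euler_lagrange_iff[OF u form ind] by blast
qed

end

subsection \<open>The equivalence\<close>

lemma Ball_pairD: "\<forall>(x, y)\<in>A. Q x y \<Longrightarrow> (x, y) \<in> A \<Longrightarrow> Q x y"
  by auto

lemma Ball_pairI: "(\<And>x y. (x, y) \<in> A \<Longrightarrow> Q x y) \<Longrightarrow> \<forall>(x, y)\<in>A. Q x y"
  by auto

lemma mcs_chartI:
  assumes "quaternionic_det dt" "oriented_surface \<A>" "immersed_bundle \<A> L" "mean_curvature_sphere \<A> L S"
    and chart: "(U, \<phi>) \<in> \<A>"
  shows "mcs_chart dt U (\<lambda>v. L (\<phi> v)) (\<lambda>v. S (\<phi> v))"
proof -
  have L: "vec.subspace (L p)" "vec.dim (L p) = 2" "jj ` L p \<subseteq> L p" for p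
    using assms(3) by (simp_all add: immersed_bundle_def j_stable_bundle_def)
  have frames: "\<forall>u\<in>U. \<exists>W s t. u \<in> W \<and> local_section U (\<lambda>v. L (\<phi> v)) W s \<and>
      local_section U (\<lambda>v. L (\<phi> v)) W t \<and> (\<forall>v\<in>W. L (\<phi> v) = vec.span {s v, t v})"
    by (rule Ball_pairD[OF assms(3)[unfolded immersed_bundle_def j_stable_bundle_def,
          THEN conjunct1, THEN conjunct2] chart])
  have imm: "\<forall>W \<sigma>. real_lift U (\<lambda>v. L (\<phi> v)) W \<sigma> \<longrightarrow> (\<forall>u\<in>W. \<forall>X. dd \<sigma> u X \<in> span {\<sigma> u} \<longrightarrow> X = 0)"
    by (rule Ball_pairD[OF assms(3)[unfolded immersed_bundle_def, THEN conjunct2, THEN conjunct1] chart])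
  have S: "clinear_on UNIV (S p)" "S p (jj w) = jj (S p w)" "S p (S p w) = - w" "S p ` L p = L p" for p w
    using assms(4) by (simp_all add: mean_curvature_sphere_def)
  have smooth: "\<forall>w. smooth_on U (\<lambda>v. S (\<phi> v) w)"
    and dS: "\<forall>u\<in>U. \<forall>X. \<forall>w\<in>L (\<phi> u). dd (\<lambda>v. S (\<phi> v) w) u X \<in> L (\<phi> u)"
    and delta: "\<forall>W s. local_section U (\<lambda>v. L (\<phi> v)) W s \<longrightarrow> (\<forall>u\<in>W. \<forall>X.
        - dd s u (\<i> * X) - S (\<phi> u) (dd s u X) \<in> L (\<phi> u) \<and>
        S (\<phi> u) (dd s u X) - dd (\<lambda>v. S (\<phi> v) (s v)) u X \<in> L (\<phi> u))"
    and SdS: "\<forall>u\<in>U. \<forall>X. \<forall>w\<in>L (\<phi> u).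
        S (\<phi> u) (dd (\<lambda>v. S (\<phi> v) w) u X) - star (\<lambda>x Y w'. dd (\<lambda>v. S (\<phi> v) w') x Y) u X w = 0"
    using Ball_pairD[OF assms(4)[unfolded mean_curvature_sphere_def, THEN conjunct2] chart]
    by auto
  show ?thesis
  proof
    show "quaternionic_det dt" by fact
    show "open U" using assms(2) chart by (auto simp: oriented_surface_def)
    show "vec.subspace (L (\<phi> u))" "vec.dim (L (\<phi> u)) = 2" for u by (rule L)+
    show "jj w \<in> L (\<phi> u)" if "w \<in> L (\<phi> u)" for u w using L(3)[of "\<phi> u"] that by blast
    show "\<exists>W s t. u \<in> W \<and> local_section U (\<lambda>v. L (\<phi> v)) W s \<and>
      local_section U (\<lambda>v. L (\<phi> v)) W t \<and> (\<forall>v\<in>W. L (\<phi> v) = vec.span {s v, t v})" if "u \<in> U" for u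
      using frames that by blast
    show "X = 0" if "real_lift U (\<lambda>v. L (\<phi> v)) W \<sigma>" "u \<in> W" "dd \<sigma> u X \<in> span {\<sigma> u}" for W \<sigma> u X
      using imm that by blast
    show "clinear_on UNIV (S (\<phi> u))" "S (\<phi> u) (jj w) = jj (S (\<phi> u) w)" "S (\<phi> u) (S (\<phi> u) w) = - w" for u w
      by (rule S)+
    show "S (\<phi> u) w \<in> L (\<phi> u)" if "w \<in> L (\<phi> u)" for u w using S(4)[of "\<phi> u"] that by blast
    show "smooth_on U (\<lambda>v. S (\<phi> v) w)" for w using smooth by blast
    show "dd (\<lambda>v. S (\<phi> v) w) u X \<in> L (\<phi> u)" if "u \<in> U" "w \<in> L (\<phi> u)" for u w X
      using dS that by blast
    show "- dd s u (\<i> * X) - S (\<phi> u) (dd s u X) \<in> L (\<phi> u)"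
      "S (\<phi> u) (dd s u X) - dd (\<lambda>v. S (\<phi> v) (s v)) u X \<in> L (\<phi> u)"
      if "local_section U (\<lambda>v. L (\<phi> v)) W s" "u \<in> W" for W s u X
      using delta that by blast+
    show "S (\<phi> u) (dd (\<lambda>v. S (\<phi> v) w) u X) + dd (\<lambda>v. S (\<phi> v) w) u (\<i> * X) = 0"
      if "u \<in> U" "w \<in> L (\<phi> u)" for u w X
      using SdS that by (simp add: star_def)
  qed
qed

theorem theorem9p12:
  fixes dt :: "cvec4 \<Rightarrow> cvec4 \<Rightarrow> cvec4 \<Rightarrow> cvec4 \<Rightarrow> complex"
    and \<A> :: "('m::{t2_space,second_countable_topology}) chart set"
    and L :: "'m \<Rightarrow> cvec4 set"
    and S :: "'m \<Rightarrow> cvec4 \<Rightarrow> cvec4"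
  assumes "quaternionic_det dt"
    and "oriented_surface \<A>"
    and "immersed_bundle \<A> L"
    and "holomorphic_charts dt \<A> L"
    and "mean_curvature_sphere \<A> L S"
  shows "constrained_willmore dt \<A> L \<longleftrightarrow>
    (\<exists>q. hom_j_one_form \<A> L q \<and>
       (\<forall>(U, \<phi>)\<in>\<A>. \<forall>u\<in>U.
          let T = (\<lambda>v. S (\<phi> v)); q' = q (U, \<phi>) in
            (\<forall>X w. T u (q' u X w) = star q' u X w \<and> star q' u X w = q' u X (T u w)) \<and>
            (\<forall>X Y w. ext_d (D_S T) q' u X Y w = 0) \<and>
            (\<forall>X Y w. ext_d (D_S T) (star (N_S T)) u X Y w =
               2 *s bracket_wedge q' (star (N_S T)) u X Y w)))"
proof -
  let ?P = "\<lambda>\<phi> v. L (\<phi> v)" and ?T = "\<lambda>\<phi> v. S (\<phi> v)"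
  note chart = mcs_chartI[OF assms(1,2,3,5)]
  show ?thesis
  proof
    assume "constrained_willmore dt \<A> L"
    then obtain Q where one: "endo_one_form \<A> bivectors Q"
      and cw: "\<forall>(U, \<phi>)\<in>\<A>. \<forall>u\<in>U. let P = ?P \<phi>; V = central_sphere U P; q' = Q (U, \<phi>) in
         (\<forall>X. \<forall>w\<in>bivectors. q' u X (biv_j w) = biv_j (q' u X w)) \<and>
         (\<forall>X. \<exists>A\<in>ext2 (P u). \<exists>B\<in>Lambda1 U P u. \<forall>w\<in>bivectors. q' u X w = skew_op dt A B w) \<and>
         (\<forall>X Y. \<forall>w\<in>bivectors. ext_d (D_V dt V) q' u X Y w = 0) \<and>
         (\<forall>X Y. \<forall>w\<in>bivectors. ext_d (D_V dt V) (star (N_V dt V)) u X Y w =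
            2 *s bracket_wedge q' (star (N_V dt V)) u X Y w)"
      unfolding constrained_willmore_def by (elim exE conjE) (rule that)
    define q where "q a u X = lower (Q a u X)" for a u X
    have loc: "mcs_chart.operator_form U (q (U, \<phi>))"
      "u \<in> U \<Longrightarrow> linear (\<lambda>X. q (U, \<phi>) u X w)"
      "u \<in> U \<Longrightarrow> q (U, \<phi>) u X (jj w) = jj (q (U, \<phi>) u X w)"
      "u \<in> U \<Longrightarrow> w \<in> L (\<phi> u) \<Longrightarrow> q (U, \<phi>) u X w = 0"
      "u \<in> U \<Longrightarrow> q (U, \<phi>) u X w \<in> L (\<phi> u)"
      "u \<in> U \<Longrightarrow> S (\<phi> u) (q (U, \<phi>) u X w) = star (q (U, \<phi>)) u X w"
      "u \<in> U \<Longrightarrow> star (q (U, \<phi>)) u X w = q (U, \<phi>) u X (S (\<phi> u) w)"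
      "u \<in> U \<Longrightarrow> \<forall>X Y w. ext_d (D_S (?T \<phi>)) (q (U, \<phi>)) u X Y w = 0"
      "u \<in> U \<Longrightarrow> \<forall>X Y w. ext_d (D_S (?T \<phi>)) (star (N_S (?T \<phi>))) u X Y w =
        2 *s bracket_wedge (q (U, \<phi>)) (star (N_S (?T \<phi>))) u X Y w"
      if A: "(U, \<phi>) \<in> \<A>" for U \<phi> u X w
    proof -
      interpret mcs_chart dt U "?P \<phi>" "?T \<phi>" by (rule chart[OF A])
      have Qlin: "linear (\<lambda>X. Q (U, \<phi>) u X w)" if "u \<in> U" "w \<in> bivectors" for u w
        using one[unfolded endo_one_form_def, THEN conjunct1, THEN bspec, OF A] that by simp
      have Qsm: "smooth_on U (\<lambda>u. Q (U, \<phi>) u X w)" if "w \<in> bivectors" for X w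
        using one[unfolded endo_one_form_def, THEN conjunct2, THEN conjunct1, THEN bspec, OF A] that by simp
      note cw' = bspec[OF Ball_pairD[OF cw A], unfolded Let_def]
      have real: "Q (U, \<phi>) u X (biv_j w) = biv_j (Q (U, \<phi>) u X w)" if "u \<in> U" "w \<in> bivectors" for u X w
        using conjunct1[OF cw'[OF that(1)]] that(2) by simp
      note skew = cw'[THEN conjunct2, THEN conjunct1, THEN spec]
      note eqs = cw'[THEN conjunct2, THEN conjunct2, THEN conjunct1]
        cw'[THEN conjunct2, THEN conjunct2, THEN conjunct2]
      note hyps = Qlin Qsm real skew eqs
      note lower = willmore_form_lower[where Q = "Q (U, \<phi>)", folded q_def]
      show "operator_form (q (U, \<phi>))" by (rule lower(1); rule hyps; assumption)
      show "linear (\<lambda>X. q (U, \<phi>) u X w)" "q (U, \<phi>) u X (jj w) = jj (q (U, \<phi>) u X w)"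
        "w \<in> L (\<phi> u) \<Longrightarrow> q (U, \<phi>) u X w = 0" "q (U, \<phi>) u X w \<in> L (\<phi> u)"
        "S (\<phi> u) (q (U, \<phi>) u X w) = star (q (U, \<phi>)) u X w"
        "star (q (U, \<phi>)) u X w = q (U, \<phi>) u X (S (\<phi> u) w)"
        "\<forall>X Y w. ext_d (D_S (?T \<phi>)) (q (U, \<phi>)) u X Y w = 0"
        "\<forall>X Y w. ext_d (D_S (?T \<phi>)) (star (N_S (?T \<phi>))) u X Y w =
          2 *s bracket_wedge (q (U, \<phi>)) (star (N_S (?T \<phi>))) u X Y w" if u: "u \<in> U"
        by (rule lower; (assumption | rule u | (rule hyps; assumption)))+
    qed
    \<comment> \<open>\<open>lower\<close> acts at a single point and does not refer to the chart,
      so the transition law of \<open>Q\<close> is inherited.\<close>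
    have trans: "q a u X w = q b (transition a b u) (dd (transition a b) u X) w"
      if "a \<in> \<A>" "b \<in> \<A>" "u \<in> overlap a b" for a b u X w
    proof -
      have "lower (Q a u X) = lower (Q b (transition a b u) (dd (transition a b) u X))"
        by (rule lower_cong)
          (rule one[unfolded endo_one_form_def, THEN conjunct2, THEN conjunct2, rule_format, OF that])
      then show ?thesis by (simp add: q_def)
    qed
    have "endo_one_form \<A> UNIV q"
      unfolding endo_one_form_def
    proof (intro conjI ballI allI)
      fix a u X assume a: "a \<in> \<A>" "u \<in> fst a"
      obtain U \<phi> where [simp]: "a = (U, \<phi>)" by (cases a)
      interpret mcs_chart dt U "?P \<phi>" "?T \<phi>" by (rule chart) (use a in simp)
      show "clinear_on UNIV (q a u X)"
        using loc(1)[of U \<phi>] a by (simp add: operator_form_def)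
    next
      fix a u w assume a: "a \<in> \<A>" "u \<in> fst a"
      obtain U \<phi> where [simp]: "a = (U, \<phi>)" by (cases a)
      show "linear (\<lambda>X. q a u X w)" using loc(2)[of U \<phi> u w] a by simp
    next
      fix a X w assume a: "a \<in> \<A>"
      obtain U \<phi> where [simp]: "a = (U, \<phi>)" by (cases a)
      interpret mcs_chart dt U "?P \<phi>" "?T \<phi>" by (rule chart) (use a in simp)
      show "smooth_on (fst a) (\<lambda>u. q a u X w)"
        using loc(1)[of U \<phi>] a by (simp add: operator_form_def)
    qed (rule trans)
    then have "hom_j_one_form \<A> L q"
      unfolding hom_j_one_form_def
      by (intro conjI Ball_pairI ballI allI) (assumption | (rule loc(3,4,5); assumption))+
    moreover have "\<forall>(U, \<phi>)\<in>\<A>. \<forall>u\<in>U. let T = ?T \<phi>; q' = q (U, \<phi>) in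
        (\<forall>X w. T u (q' u X w) = star q' u X w \<and> star q' u X w = q' u X (T u w)) \<and>
        (\<forall>X Y w. ext_d (D_S T) q' u X Y w = 0) \<and>
        (\<forall>X Y w. ext_d (D_S T) (star (N_S T)) u X Y w = 2 *s bracket_wedge q' (star (N_S T)) u X Y w)"
      unfolding Let_def
      by (intro Ball_pairI ballI conjI allI;
          rule loc(6,7) loc(8,9)[THEN spec, THEN spec, THEN spec]; assumption)
    ultimately show "\<exists>q. hom_j_one_form \<A> L q \<and> (\<forall>(U, \<phi>)\<in>\<A>. \<forall>u\<in>U. let T = ?T \<phi>; q' = q (U, \<phi>) in
        (\<forall>X w. T u (q' u X w) = star q' u X w \<and> star q' u X w = q' u X (T u w)) \<and>
        (\<forall>X Y w. ext_d (D_S T) q' u X Y w = 0) \<and>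
        (\<forall>X Y w. ext_d (D_S T) (star (N_S T)) u X Y w = 2 *s bracket_wedge q' (star (N_S T)) u X Y w))"
      by blast
  next
    assume "\<exists>q. hom_j_one_form \<A> L q \<and> (\<forall>(U, \<phi>)\<in>\<A>. \<forall>u\<in>U. let T = ?T \<phi>; q' = q (U, \<phi>) in
        (\<forall>X w. T u (q' u X w) = star q' u X w \<and> star q' u X w = q' u X (T u w)) \<and>
        (\<forall>X Y w. ext_d (D_S T) q' u X Y w = 0) \<and>
        (\<forall>X Y w. ext_d (D_S T) (star (N_S T)) u X Y w = 2 *s bracket_wedge q' (star (N_S T)) u X Y w))"
    then obtain q where hom: "hom_j_one_form \<A> L q"
      and eqs: "\<forall>(U, \<phi>)\<in>\<A>. \<forall>u\<in>U. let T = ?T \<phi>; q' = q (U, \<phi>) in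
        (\<forall>X w. T u (q' u X w) = star q' u X w \<and> star q' u X w = q' u X (T u w)) \<and>
        (\<forall>X Y w. ext_d (D_S T) q' u X Y w = 0) \<and>
        (\<forall>X Y w. ext_d (D_S T) (star (N_S T)) u X Y w = 2 *s bracket_wedge q' (star (N_S T)) u X Y w)"
      by (elim exE conjE) (rule that)
    note one = hom[unfolded hom_j_one_form_def, THEN conjunct1]
    note hom' = hom[unfolded hom_j_one_form_def, THEN conjunct2]
    define Q where "Q a u X = biv_der (q a u X)" for a u X
    have loc: "u \<in> U \<Longrightarrow> linear (\<lambda>X. Q (U, \<phi>) u X w)"
      "smooth_on U (\<lambda>u. Q (U, \<phi>) u X w)"
      "u \<in> U \<Longrightarrow> w \<in> bivectors \<Longrightarrow> Q (U, \<phi>) u X (biv_j w) = biv_j (Q (U, \<phi>) u X w)"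
      "u \<in> U \<Longrightarrow> \<exists>A\<in>ext2 (L (\<phi> u)). \<exists>B\<in>Lambda1 U (?P \<phi>) u. \<forall>w\<in>bivectors. Q (U, \<phi>) u X w = skew_op dt A B w"
      "u \<in> U \<Longrightarrow> \<forall>X Y. \<forall>w\<in>bivectors. ext_d (D_V dt (central_sphere U (?P \<phi>))) (Q (U, \<phi>)) u X Y w = 0"
      "u \<in> U \<Longrightarrow> \<forall>X Y. \<forall>w\<in>bivectors.
        ext_d (D_V dt (central_sphere U (?P \<phi>))) (star (N_V dt (central_sphere U (?P \<phi>)))) u X Y w =
        2 *s bracket_wedge (Q (U, \<phi>)) (star (N_V dt (central_sphere U (?P \<phi>)))) u X Y w"
      if A: "(U, \<phi>) \<in> \<A>" for U \<phi> u X w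
    proof -
      interpret mcs_chart dt U "?P \<phi>" "?T \<phi>" by (rule chart[OF A])
      have cl: "clinear_on UNIV (q (U, \<phi>) v X)" and lin: "linear (\<lambda>X. q (U, \<phi>) v X w)"
        if "v \<in> U" for v X w
        using one[unfolded endo_one_form_def, THEN conjunct1, THEN bspec, OF A] that by simp_all
      have "smooth_on U (\<lambda>v. q (U, \<phi>) v X w)" for X w
        using one[unfolded endo_one_form_def, THEN conjunct2, THEN conjunct1, THEN bspec, OF A] by simp
      then have form: "operator_form (q (U, \<phi>))" using cl by (simp add: operator_form_def)
      note h = bspec[OF Ball_pairD[OF hom' A], THEN spec]
      note e = bspec[OF Ball_pairD[OF eqs A], unfolded Let_def]
      have real: "q (U, \<phi>) v X (jj w) = jj (q (U, \<phi>) v X w)"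
        and im: "q (U, \<phi>) v X w \<in> L (\<phi> v)"
        and ker: "w \<in> L (\<phi> v) \<Longrightarrow> q (U, \<phi>) v X w = 0" if "v \<in> U" for v X w
        using h[OF that, of X] by simp_all
      \<comment> \<open>Commutation with \<open>S\<close> results from joining the two equalities
        through the star form.\<close>
      have comm: "S (\<phi> v) (q (U, \<phi>) v X w) = q (U, \<phi>) v X (S (\<phi> v) w)" if "v \<in> U" for v X w
        using e[OF that, THEN conjunct1, THEN spec, THEN spec, of X w] by (elim conjE) (rule trans)
      note hyps = form lin real ker im comm e[THEN conjunct2, THEN conjunct1] e[THEN conjunct2, THEN conjunct2]
      note lift = willmore_form_lift[where \<theta> = "q (U, \<phi>)", folded Q_def]
      show "smooth_on U (\<lambda>u. Q (U, \<phi>) u X w)" by (rule lift(2); rule hyps; assumption)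
      show "linear (\<lambda>X. Q (U, \<phi>) u X w)"
        "w \<in> bivectors \<Longrightarrow> Q (U, \<phi>) u X (biv_j w) = biv_j (Q (U, \<phi>) u X w)"
        "\<exists>A\<in>ext2 (L (\<phi> u)). \<exists>B\<in>Lambda1 U (?P \<phi>) u. \<forall>w\<in>bivectors. Q (U, \<phi>) u X w = skew_op dt A B w"
        "\<forall>X Y. \<forall>w\<in>bivectors. ext_d (D_V dt V) (Q (U, \<phi>)) u X Y w = 0"
        "\<forall>X Y. \<forall>w\<in>bivectors. ext_d (D_V dt V) (star (N_V dt V)) u X Y w =
          2 *s bracket_wedge (Q (U, \<phi>)) (star (N_V dt V)) u X Y w" if u: "u \<in> U"
        by (rule lift; (assumption | rule u | (rule hyps; assumption)))+
    qed
    have "endo_one_form \<A> bivectors Q"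
      unfolding endo_one_form_def
    proof (intro conjI ballI allI)
      fix a u X assume a: "a \<in> \<A>" "u \<in> fst a"
      \<comment> \<open>A derivation has all its values in \<open>bivectors\<close>, so the fibre is
        preserved.\<close>
      show "clinear_on bivectors (Q a u X)"
        by (simp add: clinear_on_def Q_def biv_der_in_bivectors clinear_add[OF clinear_biv_der]
            clinear_scale[OF clinear_biv_der])
    next
      fix a u w assume a: "a \<in> \<A>" "u \<in> fst a"
      obtain U \<phi> where [simp]: "a = (U, \<phi>)" by (cases a)
      show "linear (\<lambda>X. Q a u X w)" using loc(1)[of U \<phi> u w] a by simp
    next
      fix a X w assume a: "a \<in> \<A>"
      obtain U \<phi> where [simp]: "a = (U, \<phi>)" by (cases a)
      show "smooth_on (fst a) (\<lambda>u. Q a u X w)" using loc(2)[of U \<phi> X w] a by simp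
    next
      fix a b u X w assume "a \<in> \<A>" "b \<in> \<A>" "u \<in> overlap a b"
      then have "q a u X = q b (transition a b u) (dd (transition a b) u X)"
        by (intro ext one[unfolded endo_one_form_def, THEN conjunct2, THEN conjunct2, rule_format]) auto
      then show "Q a u X w = Q b (transition a b u) (dd (transition a b) u X) w" by (simp add: Q_def)
    qed
    then show "constrained_willmore dt \<A> L"
      unfolding constrained_willmore_def Let_def
      by (intro exI[of _ Q] conjI Ball_pairI ballI allI)
        (assumption | (rule loc(3,4) loc(5,6)[THEN spec, THEN spec, THEN bspec]; assumption))+
  qed
qed

end
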